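(* Let $\Lambda(\Omega)\subset\mathbb{R}^m$ be a simple generic model set with $\Omega$ symmetric around the origin, let $\Delta\subset\mathbb{R}^m$ be relatively dense and uniformly discrete, and let $g_1,\dots,g_L\in W(L^2,\ell^1)$. The Gabor system $$\mathcal{G}(g,\Lambda(\Omega),\Delta)=\{T_\lambda M_\beta g_l: l=1,\dots,L,\ \lambda\in\Lambda(\Omega),\ \beta\in\Delta\}$$ is a normalized tight frame for $L^2(\mathbb{R}^m)$ if and only if it is a Bessel sequence with upper frame bound $B_g=1$ and $$D(\Lambda(\Omega))\sum_{l=1}^L\sum_{\beta\in\Delta}|\widehat{g_l}(t-\beta)|^2=1\quad\text{for a.e. } t\in\mathbb{R}^m.$$
   Context: Notation: $T_\lambda f(t)=f(t-\lambda)$, $M_\beta f(t)=e^{2\pi i\beta\cdot t}f(t)$; $\widehat f(\omega)=\int_{\mathbb{R}^m} f(t)e^{-2\pi i t\cdot\omega}\,dt$. $W(L^p,\ell^q)$ is the space of measurable functions $f$ on $\mathbb{R}^m$ with $\|f\|_{p,q}=\big(\sum_{k\in\mathbb{Z}^m}\|f\mathbf{1}_{k+[0,1]^m}\|_p^q\big)^{1/q}<\infty$. A family $\{e_j\}$ is a Bessel sequence with upper frame bound $B$ if $\sum_j|\langle f,e_j\rangle|^2\le B\|f\|_2^2$ for all $f\in L^2(\mathbb{R}^m)$, and a normalized tight frame if $\sum_j|\langle f,e_j\rangle|^2=\|f\|_2^2$ for all $f$. A set is uniformly discrete if distinct points are at distance at least some $r>0$, and relatively dense if for some $r>0$ it meets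 every cube $t+r[0,1]^m$. Model sets: let $\Gamma\subset\mathbb{R}^m\times\mathbb{R}$ be a lattice and $p_1:\mathbb{R}^m\times\mathbb{R}\to\mathbb{R}^m$, $p_2:\mathbb{R}^m\times\mathbb{R}\to\mathbb{R}$ the orthogonal projections; assume $p_1|_\Gamma$ and $p_2|_\Gamma$ are injective with dense images. $\Gamma^*$ is the dual lattice and $p_1^*,p_2^*$ are the same projections used on $\Gamma^*$. For a compact interval $\Omega\subset\mathbb{R}$ with non-empty interior, $\Lambda(\Omega)=\{p_1(\gamma):\gamma\in\Gamma,\ p_2(\gamma)\in\Omega\}$ is a simple model set; it is generic if $p_2(\Gamma)\cap\partial\Omega=\emptyset$. Standing assumption: also $p_2^*(\Gamma^* )\cap\partial\Omega=\emptyset$. Its density is $D(\Lambda(\Omega))=\lim_{R\to\infty}\#(\Lambda(\Omega)\cap(x+R[0,1]^m))/R^m=|\Omega|/\mathrm{vol}(\Gamma)$. *)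

theory Defs
  imports "HOL-Analysis.Analysis"
begin

definition cube :: "real ^ 'm \<Rightarrow> real \<Rightarrow> (real ^ 'm) set" where
  "cube x R = cbox x (x + R *\<^sub>R 1)"

definition in_Lp :: "real \<Rightarrow> (real ^ 'm \<Rightarrow> complex) \<Rightarrow> bool" where
  "in_Lp p f \<longleftrightarrow>
     f \<in> borel_measurable lebesgue \<and> integrable lebesgue (\<lambda>t. cmod (f t) powr p)"

definition Lp_norm :: "real \<Rightarrow> (real ^ 'm \<Rightarrow> complex) \<Rightarrow> real" where
  "Lp_norm p f = (\<integral>t. cmod (f t) powr p \<partial>lebesgue) powr (1 / p)"

definition L2_inner :: "(real ^ 'm \<Rightarrow> complex) \<Rightarrow> (real ^ 'm \<Rightarrow> complex) \<Rightarrow> complex" where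
  "L2_inner f h = (\<integral>t. f t * cnj (h t) \<partial>lebesgue)"

definition int_vectors :: "(real ^ 'm) set" where
  "int_vectors = {k. \<forall>i. k $ i \<in> \<int>}"

text \<open>The space \<open>W(L\<^sup>p, \<ell>\<^sup>q)\<close> for finite exponents.\<close>

definition in_wiener :: "real \<Rightarrow> real \<Rightarrow> (real ^ 'm \<Rightarrow> complex) \<Rightarrow> bool" where
  "in_wiener p q f \<longleftrightarrow>
     f \<in> borel_measurable lebesgue \<and>
     (\<forall>k\<in>int_vectors. in_Lp p (\<lambda>t. indicator (cube k 1) t * f t)) \<and>
     (\<lambda>k. Lp_norm p (\<lambda>t. indicator (cube k 1) t * f t) powr q) summable_on int_vectors"

text \<open>The integral formula is meaningful for \<open>f \<in> L\<^sup>1\<close>, in particular for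
  \<open>f \<in> W(L\<^sup>2, \<ell>\<^sup>1) \<subseteq> L\<^sup>1 \<inter> L\<^sup>2\<close>.\<close>

definition fourier :: "(real ^ 'm \<Rightarrow> complex) \<Rightarrow> real ^ 'm \<Rightarrow> complex" where
  "fourier f \<omega> = (\<integral>t. f t * cis (- 2 * pi * (t \<bullet> \<omega>)) \<partial>lebesgue)"

definition translation :: "real ^ 'm \<Rightarrow> (real ^ 'm \<Rightarrow> complex) \<Rightarrow> real ^ 'm \<Rightarrow> complex" where
  "translation x f = (\<lambda>t. f (t - x))"

definition modulation :: "real ^ 'm \<Rightarrow> (real ^ 'm \<Rightarrow> complex) \<Rightarrow> real ^ 'm \<Rightarrow> complex" where
  "modulation \<beta> f = (\<lambda>t. cis (2 * pi * (\<beta> \<bullet> t)) * f t)"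

text \<open>Sums over possibly infinite index sets are taken in \<^typ>\<open>ennreal\<close>, where they always
  exist, so that a divergent sum has the value \<open>\<infinity>\<close> and not the default value \<open>0\<close>.\<close>

definition is_Bessel_seq :: "real \<Rightarrow> 'i set \<Rightarrow> ('i \<Rightarrow> real ^ 'm \<Rightarrow> complex) \<Rightarrow> bool" where
  "is_Bessel_seq B I e \<longleftrightarrow>
     (\<forall>j\<in>I. in_Lp 2 (e j)) \<and>
     (\<forall>f. in_Lp 2 f \<longrightarrow>
        (\<Sum>\<^sub>\<infinity>j\<in>I. ennreal ((cmod (L2_inner f (e j)))\<^sup>2)) \<le> ennreal (B * (Lp_norm 2 f)\<^sup>2))"

definition is_normalized_tight_frame :: "'i set \<Rightarrow> ('i \<Rightarrow> real ^ 'm \<Rightarrow> complex) \<Rightarrow> bool" where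
  "is_normalized_tight_frame I e \<longleftrightarrow>
     (\<forall>j\<in>I. in_Lp 2 (e j)) \<and>
     (\<forall>f. in_Lp 2 f \<longrightarrow>
        (\<Sum>\<^sub>\<infinity>j\<in>I. ennreal ((cmod (L2_inner f (e j)))\<^sup>2)) = ennreal ((Lp_norm 2 f)\<^sup>2))"

text \<open>The Gabor system is the family \<open>gabor g\<close> over \<open>gabor_index L \<Lambda> \<Delta>\<close>; the functions
  are counted with multiplicity, e.g. when two of the windows coincide.\<close>

definition gabor_index ::
    "nat \<Rightarrow> (real ^ 'm) set \<Rightarrow> (real ^ 'm) set \<Rightarrow> (nat \<times> (real ^ 'm) \<times> (real ^ 'm)) set" where
  "gabor_index L \<Lambda> \<Delta> = {1..L} \<times> \<Lambda> \<times> \<Delta>"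

definition gabor ::
    "(nat \<Rightarrow> real ^ 'm \<Rightarrow> complex) \<Rightarrow> nat \<times> (real ^ 'm) \<times> (real ^ 'm) \<Rightarrow> real ^ 'm \<Rightarrow> complex" where
  "gabor g = (\<lambda>(l, x, \<beta>). translation x (modulation \<beta> (g l)))"

definition relatively_dense :: "(real ^ 'm) set \<Rightarrow> bool" where
  "relatively_dense S \<longleftrightarrow> (\<exists>r>0. \<forall>t. S \<inter> cube t r \<noteq> {})"

definition has_point_density :: "(real ^ 'm) set \<Rightarrow> real \<Rightarrow> bool" where
  "has_point_density S d \<longleftrightarrow>
     (\<forall>x. ((\<lambda>R. real (card (S \<inter> cube x R)) / R ^ CARD('m)) \<longlongrightarrow> d) at_top)"

definition point_density :: "(real ^ 'm) set \<Rightarrow> real" where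
  "point_density S = (THE d. has_point_density S d)"

definition is_lattice :: "'a::euclidean_space set \<Rightarrow> bool" where
  "is_lattice \<Gamma> \<longleftrightarrow>
     (\<exists>B. independent B \<and> span B = UNIV \<and>
          \<Gamma> = {\<Sum>b\<in>B. of_int (c b) *\<^sub>R b | c :: 'a \<Rightarrow> int. True})"

definition dual_lattice :: "'a::euclidean_space set \<Rightarrow> 'a set" where
  "dual_lattice \<Gamma> = {\<eta>. \<forall>\<gamma>\<in>\<Gamma>. \<eta> \<bullet> \<gamma> \<in> \<int>}"

text \<open>The lattices admitted in the construction of a model set; the projections \<open>p\<^sub>1\<close>
  and \<open>p\<^sub>2\<close> are \<^const>\<open>fst\<close> and \<^const>\<open>snd\<close>.\<close>

definition cut_and_project :: "((real ^ 'm) \<times> real) set \<Rightarrow> bool" where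
  "cut_and_project \<Gamma> \<longleftrightarrow>
     is_lattice \<Gamma> \<and>
     inj_on fst \<Gamma> \<and> inj_on snd \<Gamma> \<and>
     closure (fst ` \<Gamma>) = UNIV \<and> closure (snd ` \<Gamma>) = UNIV"

definition model_set :: "((real ^ 'm) \<times> real) set \<Rightarrow> real set \<Rightarrow> (real ^ 'm) set" where
  "model_set \<Gamma> \<Omega> = {fst \<gamma> | \<gamma>. \<gamma> \<in> \<Gamma> \<and> snd \<gamma> \<in> \<Omega>}"

definition generic_window :: "((real ^ 'm) \<times> real) set \<Rightarrow> real set \<Rightarrow> bool" where
  "generic_window \<Gamma> \<Omega> \<longleftrightarrow> snd ` \<Gamma> \<inter> frontier \<Omega> = {}"

end

theory Submission
  imports Defs "HOL-Probability.Characteristic_Functions" "HOL-Real_Asymp.Real_Asymp"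
begin

text \<open>
  Let \<open>D\<close> be the density of the model set \<open>\<Lambda>\<close> and let \<open>N x\<close> be the sum of the squared moduli of
  the frame coefficients of the translate of \<open>f\<close> by \<open>x\<close>. Translating \<open>f\<close> has the same effect as
  translating the point set, so \<open>N x\<close> is the sum of \<open>W (z - x)\<close> over \<open>z \<in> \<Lambda>\<close>, where \<open>W y\<close> collects
  \<open>\<bar>\<langle>f, T\<^sub>y M\<^sub>\<beta> g\<^sub>l\<rangle>\<bar>\<^sup>2\<close> over all \<open>l\<close> and \<open>\<beta>\<close> (\<open>window_energy\<close>, \<open>frame_sum_gabor_translation\<close>). The mean
  value of \<open>N\<close> over large cubes is \<open>D \<integral>W\<close>. Since \<open>y \<mapsto> \<langle>f, T\<^sub>y M\<^sub>\<beta> g\<^sub>l\<rangle>\<close> is a correlation, whose Fourier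
  transform is a product, Plancherel's theorem identifies \<open>\<integral>W\<close> with the integral of
  \<open>\<bar>F\<bar>\<^sup>2 S\<close>, where \<open>F\<close> is the Fourier transform of \<open>f\<close> and \<open>S \<omega>\<close> is the sum over \<open>l\<close> and \<open>\<beta>\<close> of the
  squared moduli of the transforms of the windows at \<open>\<omega> - \<beta>\<close> (\<open>fiber_sum\<close>,
  \<open>nn_integral_window_energy\<close>).

  If the system is a normalized tight frame, then \<open>N\<close> is constantly the squared norm of \<open>f\<close>, and so is
  its mean. Hence \<open>D S\<close> and \<open>1\<close> have the same integral against \<open>\<bar>F\<bar>\<^sup>2\<close>; for modulated Gaussians
  \<open>f\<close> these weights are all translated and dilated Gaussians, which forces \<open>D S = 1\<close> almost
  everywhere (\<open>AE_eq_1_of_gaussian_averages\<close>).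

  Conversely, the Bessel bound gives \<open>N \<le> E\<close> for the squared norm \<open>E\<close> of \<open>f\<close>, while the condition
  on \<open>S\<close> says that the mean of \<open>N\<close> is \<open>E\<close>. So a value of \<open>N\<close> below \<open>E\<close> would have to be exceptional,
  but low values recur: if \<open>\<gamma>\<close> is a lattice point
  with small second coordinate, then shifting by its first coordinate changes the model set only by
  points whose second coordinate lies just outside the window, and their contribution is
  arbitrarily small. So \<open>N\<close> is almost as small at this point as at \<open>0\<close>, and by the Bessel bound it
  stays so nearby. These points form a model set again, hence occur with positive density, and a
  deficit at \<open>0\<close> would bring the mean below \<open>E\<close> (\<open>model_sum_attains_mean\<close>). This proves the frame
  identity on a dense class of functions, and the Bessel bound extends it to all of \<open>L\<^sup>2\<close>
  (\<open>tight_of_tight_on_test_fun\<close>).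

  The density is handled without harmonic analysis. Averaging the number of lattice points in a
  translated box over a fundamental cell gives exactly the volume of the box. As the lattice has a
  dense second projection, a translation by a vector of the cell agrees, up to a lattice vector,
  with one that is bounded in the first and tiny in the second coordinate. So every single count
  is close to the average, uniformly in the position of the box (\<open>model_set_uniform_density\<close>), and
  the statements on mean values follow by interchanging sum and integral.
\<close>

section \<open>Sums over countable sets as integrals\<close>

abbreviation sqn :: "complex \<Rightarrow> ennreal" where
  "sqn z \<equiv> ennreal ((norm z)\<^sup>2)"

text \<open>Integrals over a counting measure come with Fubini, Fatou and dominated convergence, so all sums are turned into
  them.\<close>

lemma infsum_ennreal_eq_nn_integral:
  fixes f :: "'a \<Rightarrow> ennreal"
  assumes "countable A"
  shows "infsum f A = (\<integral>\<^sup>+x. f x \<partial>count_space A)"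
proof (rule antisym)
  have S: "infsum f A = (SUP F\<in>{F. finite F \<and> F \<subseteq> A}. sum f F)"
    by (rule nonneg_infsum_complete) auto
  show "infsum f A \<le> (\<integral>\<^sup>+x. f x \<partial>count_space A)"
    unfolding S
  proof (rule SUP_least)
    fix F assume "F \<in> {F. finite F \<and> F \<subseteq> A}"
    then have "sum f F = (\<integral>\<^sup>+x. f x * indicator F x \<partial>count_space A)"
      by (subst nn_integral_count_space'[of F]) (auto intro!: sum.cong)
    also have "\<dots> \<le> (\<integral>\<^sup>+x. f x \<partial>count_space A)"
      by (rule nn_integral_mono) (auto split: split_indicator)
    finally show "sum f F \<le> (\<integral>\<^sup>+x. f x \<partial>count_space A)" .
  qed
  show "(\<integral>\<^sup>+x. f x \<partial>count_space A) \<le> infsum f A"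
  proof (cases "finite A")
    case True
    then show ?thesis by (simp add: nn_integral_count_space_finite)
  next
    case False
    note bij = bij_betw_from_nat_into[OF assms False]
    have "(\<integral>\<^sup>+x. f x \<partial>count_space A) = (\<Sum>n. f (from_nat_into A n))"
      by (simp add: nn_integral_bij_count_space[symmetric, OF bij] nn_integral_count_space_nat)
    also have "\<dots> \<le> infsum f A"
    proof (rule suminf_le_const)
      fix n
      have inj: "inj_on (from_nat_into A) {..<n}"
        using bij by (auto simp: bij_betw_def intro: inj_on_subset)
      have "(\<Sum>k<n. f (from_nat_into A k)) = sum f (from_nat_into A ` {..<n})"
        by (simp add: sum.reindex[OF inj])
      also have "\<dots> \<le> infsum f A"
        unfolding S using bij by (intro SUP_upper) (auto simp: bij_betw_def)
      finally show "(\<Sum>k<n. f (from_nat_into A k)) \<le> infsum f A" .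
    qed auto
    finally show ?thesis .
  qed
qed

text \<open>Joint measurability in the index and the argument need not be discussed for a countable index set.\<close>

lemma borel_measurable_nn_integral_countable:
  fixes f :: "'i \<Rightarrow> 'a \<Rightarrow> ennreal"
  assumes I: "countable I" and f[measurable]: "\<And>i. i \<in> I \<Longrightarrow> f i \<in> borel_measurable M"
  shows "(\<lambda>x. \<integral>\<^sup>+i. f i x \<partial>count_space I) \<in> borel_measurable M"
proof (cases "finite I")
  case True
  then show ?thesis by (simp add: nn_integral_count_space_finite)
next
  case False
  note bij = bij_betw_from_nat_into[OF I False]
  have "(\<integral>\<^sup>+i. f i x \<partial>count_space I) = (\<Sum>n. f (from_nat_into I n) x)" for x
    by (simp add: nn_integral_bij_count_space[symmetric, OF bij] nn_integral_count_space_nat)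
  moreover have "f (from_nat_into I n) \<in> borel_measurable M" for n
    using bij by (intro f) (auto simp: bij_betw_def)
  ultimately show ?thesis by simp
qed

section \<open>Lattices and fundamental cells\<close>

lemma lattice_add: "is_lattice \<Gamma> \<Longrightarrow> x \<in> \<Gamma> \<Longrightarrow> y \<in> \<Gamma> \<Longrightarrow> x + y \<in> \<Gamma>"
proof -
  assume "is_lattice \<Gamma>" and xy: "x \<in> \<Gamma>" "y \<in> \<Gamma>"
  then obtain B where G: "\<Gamma> = {\<Sum>b\<in>B. of_int (c b) *\<^sub>R b | c :: 'a \<Rightarrow> int. True}"
    unfolding is_lattice_def by blast
  from xy obtain c d :: "'a \<Rightarrow> int" where "x = (\<Sum>b\<in>B. of_int (c b) *\<^sub>R b)" "y = (\<Sum>b\<in>B. of_int (d b) *\<^sub>R b)"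
    unfolding G by blast
  then have "x + y = (\<Sum>b\<in>B. of_int (c b + d b) *\<^sub>R b)"
    by (simp add: sum.distrib scaleR_add_left)
  then show ?thesis unfolding G by (intro CollectI exI[of _ "\<lambda>b. c b + d b"]) simp
qed

lemma lattice_uminus: "is_lattice \<Gamma> \<Longrightarrow> x \<in> \<Gamma> \<Longrightarrow> - x \<in> \<Gamma>"
proof -
  assume "is_lattice \<Gamma>" and x: "x \<in> \<Gamma>"
  then obtain B where G: "\<Gamma> = {\<Sum>b\<in>B. of_int (c b) *\<^sub>R b | c :: 'a \<Rightarrow> int. True}"
    unfolding is_lattice_def by blast
  from x obtain c :: "'a \<Rightarrow> int" where "x = (\<Sum>b\<in>B. of_int (c b) *\<^sub>R b)"
    unfolding G by blast
  then have "- x = (\<Sum>b\<in>B. of_int (- c b) *\<^sub>R b)"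
    by (simp add: sum_negf)
  then show ?thesis unfolding G by (intro CollectI exI[of _ "\<lambda>b. - c b"]) simp
qed

lemma lattice_diff: "is_lattice \<Gamma> \<Longrightarrow> x \<in> \<Gamma> \<Longrightarrow> y \<in> \<Gamma> \<Longrightarrow> x - y \<in> \<Gamma>"
  using lattice_add[of \<Gamma> x "- y"] lattice_uminus[of \<Gamma> y] by simp

lemma countable_lattice: "countable \<Gamma>" if "is_lattice (\<Gamma> :: 'a::euclidean_space set)"
proof -
  from that obtain B where B: "independent B"
    and G: "\<Gamma> = {\<Sum>b\<in>B. of_int (c b) *\<^sub>R b | c :: 'a \<Rightarrow> int. True}"
    unfolding is_lattice_def by blast
  have "\<Gamma> \<subseteq> (\<lambda>c. \<Sum>b\<in>B. of_int (c b) *\<^sub>R b) ` (\<Pi>\<^sub>E b\<in>B. (UNIV :: int set))"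
  proof
    fix x assume "x \<in> \<Gamma>"
    then obtain c :: "'a \<Rightarrow> int" where "x = (\<Sum>b\<in>B. of_int (c b) *\<^sub>R b)" unfolding G by blast
    then have "x = (\<Sum>b\<in>B. of_int (restrict c B b) *\<^sub>R b)" by simp
    then show "x \<in> (\<lambda>c. \<Sum>b\<in>B. of_int (c b) *\<^sub>R b) ` (\<Pi>\<^sub>E b\<in>B. (UNIV :: int set))"
      by (rule image_eqI[where x = "restrict c B"]) auto
  qed
  moreover have "countable (\<Pi>\<^sub>E b\<in>B. (UNIV :: int set))"
    by (intro countable_PiE) (auto simp: B finiteI_independent)
  ultimately show ?thesis by (meson countable_image countable_subset)
qed

text \<open>The cell consists of the vectors whose coordinates in a lattice basis lie in \<open>[0, 1)\<close>; subtracting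
  the integral parts of the coordinates moves any vector into it, and in only one way.\<close>

lemma lattice_fundamental_domain:
  fixes \<Gamma> :: "'a::euclidean_space set"
  assumes "is_lattice \<Gamma>"
  obtains P where "P \<in> sets borel" "bounded P" "\<And>v. \<exists>!\<gamma>. \<gamma> \<in> \<Gamma> \<and> v - \<gamma> \<in> P"
proof -
  from assms obtain B where B: "independent B" "span B = UNIV"
    and G: "\<Gamma> = {\<Sum>b\<in>B. of_int (c b) *\<^sub>R b | c :: 'a \<Rightarrow> int. True}"
    unfolding is_lattice_def by blast
  have fB: "finite B" using B(1) by (rule finiteI_independent)
  define r where "r b v = representation B v b" for b v
  have lin: "linear (r b)" for b
    using B by unfold_locales
      (simp_all add: r_def representation_add representation_scale)
  have rsum: "(\<Sum>b\<in>B. r b v *\<^sub>R b) = v" for v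
    unfolding r_def using B fB by (intro sum_representation_eq) auto
  have rcomb: "r b (\<Sum>b'\<in>B. c b' *\<^sub>R b') = c b" if "b \<in> B" for b c
  proof -
    have "r b (\<Sum>b'\<in>B. c b' *\<^sub>R b') = (\<Sum>b'\<in>B. c b' * r b b')"
      by (simp add: linear_sum[OF lin] linear_cmul[OF lin])
    also have "\<dots> = (\<Sum>b'\<in>B. if b' = b then c b' else 0)"
      by (rule sum.cong) (auto simp: r_def representation_basis[OF B(1)])
    also have "\<dots> = c b" using that fB by simp
    finally show ?thesis .
  qed
  define P where "P = {v. \<forall>b\<in>B. 0 \<le> r b v \<and> r b v < 1}"
  have [measurable]: "r b \<in> borel_measurable borel" for b
    using linear_continuous_on[OF linear_conv_bounded_linear[THEN iffD1, OF lin]]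
    by (intro borel_measurable_continuous_onI)
  have "P \<in> sets borel"
  proof -
    have "P = (\<Inter>b\<in>B. {v. 0 \<le> r b v \<and> r b v < 1}) \<inter> UNIV" by (auto simp: P_def)
    moreover have "{v \<in> space borel. 0 \<le> r b v \<and> r b v < 1} \<in> sets borel" for b
      by measurable
    ultimately show ?thesis using fB
      by (cases "B = {}") (auto intro!: sets.finite_INT)
  qed
  moreover have "bounded P"
  proof (rule boundedI)
    fix v assume v: "v \<in> P"
    have "norm v = norm (\<Sum>b\<in>B. r b v *\<^sub>R b)" by (simp add: rsum)
    also have "\<dots> \<le> (\<Sum>b\<in>B. norm b)"
      using v by (intro sum_norm_le) (auto simp: P_def mult_left_le_one_le)
    finally show "norm v \<le> (\<Sum>b\<in>B. norm b)" .
  qed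
  moreover have "\<exists>!\<gamma>. \<gamma> \<in> \<Gamma> \<and> v - \<gamma> \<in> P" for v
  proof (rule ex1I)
    let ?g = "\<Sum>b\<in>B. of_int \<lfloor>r b v\<rfloor> *\<^sub>R b"
    have "v - ?g \<in> P"
      unfolding P_def by (auto simp: linear_diff[OF lin] rcomb) linarith+
    moreover have "?g \<in> \<Gamma>"
      unfolding G by (rule CollectI, rule exI[of _ "\<lambda>b. \<lfloor>r b v\<rfloor>"]) simp
    ultimately show "?g \<in> \<Gamma> \<and> v - ?g \<in> P" by simp
  next
    fix \<gamma> assume *: "\<gamma> \<in> \<Gamma> \<and> v - \<gamma> \<in> P"
    then obtain c :: "'a \<Rightarrow> int" where c: "\<gamma> = (\<Sum>b\<in>B. of_int (c b) *\<^sub>R b)" unfolding G by blast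
    have "c b = \<lfloor>r b v\<rfloor>" if "b \<in> B" for b
    proof -
      have "0 \<le> r b (v - \<gamma>) \<and> r b (v - \<gamma>) < 1" using * that by (auto simp: P_def)
      then show ?thesis using that by (simp add: c linear_diff[OF lin] rcomb) linarith
    qed
    then show "\<gamma> = (\<Sum>b\<in>B. of_int \<lfloor>r b v\<rfloor> *\<^sub>R b)" by (simp add: c)
  qed
  ultimately show ?thesis by (rule that)
qed

lemma nn_integral_lborel_affine:
  fixes f :: "'a::euclidean_space \<Rightarrow> ennreal"
  assumes [measurable]: "f \<in> borel_measurable borel" and c: "c \<noteq> 0"
  shows "(\<integral>\<^sup>+x. f x \<partial>lborel) = ennreal (\<bar>c\<bar> ^ DIM('a)) * (\<integral>\<^sup>+x. f (t + c *\<^sub>R x) \<partial>lborel)"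
  by (subst lborel_affine[OF c, of t])
     (simp add: nn_integral_density nn_integral_distr nn_integral_cmult)

text \<open>The translates of the cell tile the space, so integrating the periodization of \<open>F\<close> over one cell
  integrates \<open>F\<close> over all of them.\<close>

lemma nn_integral_lattice_unfold:
  fixes \<Gamma> :: "'a::euclidean_space set" and F :: "'a \<Rightarrow> ennreal"
  assumes \<Gamma>: "countable \<Gamma>" and P[measurable]: "P \<in> sets borel"
    and tile: "\<And>v. \<exists>!\<gamma>. \<gamma> \<in> \<Gamma> \<and> v - \<gamma> \<in> P"
    and F[measurable]: "F \<in> borel_measurable borel"
  shows "(\<integral>\<^sup>+u. (\<integral>\<^sup>+\<gamma>. F (\<gamma> + u) \<partial>count_space \<Gamma>) * indicator P u \<partial>lborel) = (\<integral>\<^sup>+u. F u \<partial>lborel)"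
proof -
  have one: "(\<integral>\<^sup>+\<gamma>. indicator P (v - \<gamma>) \<partial>count_space \<Gamma>) = (1 :: ennreal)" for v
  proof -
    from tile[of v] obtain \<gamma>0 where g: "\<gamma>0 \<in> \<Gamma>" "v - \<gamma>0 \<in> P"
      and u: "\<And>\<gamma>. \<gamma> \<in> \<Gamma> \<Longrightarrow> v - \<gamma> \<in> P \<Longrightarrow> \<gamma> = \<gamma>0" by metis
    have "(\<integral>\<^sup>+\<gamma>. indicator P (v - \<gamma>) \<partial>count_space \<Gamma>) = (\<integral>\<^sup>+\<gamma>. indicator {\<gamma>0} \<gamma> \<partial>count_space \<Gamma>)"
    proof (rule nn_integral_cong)
      fix \<gamma> assume "\<gamma> \<in> space (count_space \<Gamma>)"
      then have "\<gamma> \<in> \<Gamma>" by simp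
      then have "v - \<gamma> \<in> P \<longleftrightarrow> \<gamma> = \<gamma>0"
        by (intro iffI u) (simp_all add: g)
      then show "indicator P (v - \<gamma>) = (indicator {\<gamma>0} \<gamma> :: ennreal)"
        by (simp add: indicator_def)
    qed
    also have "\<dots> = emeasure (count_space \<Gamma>) {\<gamma>0}"
      by (rule nn_integral_indicator) (use g in simp)
    finally show ?thesis using g by simp
  qed
  have "(\<integral>\<^sup>+u. (\<integral>\<^sup>+\<gamma>. F (\<gamma> + u) \<partial>count_space \<Gamma>) * indicator P u \<partial>lborel)
      = (\<integral>\<^sup>+u. (\<integral>\<^sup>+\<gamma>. F (\<gamma> + u) * indicator P u \<partial>count_space \<Gamma>) \<partial>lborel)"
    by (simp add: nn_integral_multc)
  also have "\<dots> = (\<integral>\<^sup>+\<gamma>. (\<integral>\<^sup>+u. F (\<gamma> + u) * indicator P u \<partial>lborel) \<partial>count_space \<Gamma>)"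
    by (rule nn_integral_count_space_nn_integral) (use \<Gamma> in auto)
  also have "\<dots> = (\<integral>\<^sup>+\<gamma>. (\<integral>\<^sup>+w. F w * indicator P (w - \<gamma>) \<partial>lborel) \<partial>count_space \<Gamma>)"
  proof (rule nn_integral_cong)
    fix \<gamma>
    show "(\<integral>\<^sup>+u. F (\<gamma> + u) * indicator P u \<partial>lborel) = (\<integral>\<^sup>+w. F w * indicator P (w - \<gamma>) \<partial>lborel)"
      using nn_integral_lborel_affine[of "\<lambda>w. F w * indicator P (w - \<gamma>)" 1 \<gamma>] by simp
  qed
  also have "\<dots> = (\<integral>\<^sup>+w. (\<integral>\<^sup>+\<gamma>. F w * indicator P (w - \<gamma>) \<partial>count_space \<Gamma>) \<partial>lborel)"
    by (rule nn_integral_count_space_nn_integral[symmetric]) (use \<Gamma> in auto)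
  also have "\<dots> = (\<integral>\<^sup>+w. F w \<partial>lborel)"
    by (simp add: nn_integral_cmult one)
  finally show ?thesis .
qed

section \<open>Uniform density of model sets\<close>

lemma mem_cube: "y \<in> cube x R \<longleftrightarrow> (\<forall>i. x $ i \<le> y $ i \<and> y $ i \<le> x $ i + R)"
  by (simp add: cube_def mem_box_cart)

lemma cube_borel[measurable]: "cube x R \<in> sets borel"
  by (simp add: cube_def)

lemma emeasure_cube:
  fixes x :: "real ^ 'm"
  assumes "0 \<le> R"
  shows "emeasure lborel (cube x R) = ennreal (R ^ CARD('m))"
proof -
  have b: "(R *\<^sub>R 1 :: real ^ 'm) \<bullet> b = R" if "b \<in> Basis" for b
    using that by (auto simp: Basis_vec_def inner_axis)
  have "emeasure lborel (cube x R) = (\<Prod>b\<in>Basis. (x + R *\<^sub>R 1 - x) \<bullet> b)"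
    unfolding cube_def by (rule emeasure_lborel_cbox) (simp only: inner_add_left b assms, simp add: assms)
  also have "(\<Prod>b\<in>Basis. (x + R *\<^sub>R 1 - x) \<bullet> b) = (\<Prod>b\<in>(Basis :: (real^'m) set). R)"
    by (intro prod.cong refl) (simp only: add_diff_cancel_left' b)
  also have "\<dots> = R ^ CARD('m)" by simp
  finally show ?thesis .
qed

abbreviation lattice_count :: "'a set \<Rightarrow> 'a set \<Rightarrow> ennreal" where
  "lattice_count \<Gamma> A \<equiv> (\<integral>\<^sup>+\<gamma>. indicator A \<gamma> \<partial>count_space \<Gamma>)"

abbreviation lattice_count_at :: "'a::plus set \<Rightarrow> 'a set \<Rightarrow> 'a \<Rightarrow> ennreal" where
  "lattice_count_at \<Gamma> A u \<equiv> (\<integral>\<^sup>+\<gamma>. indicator A (\<gamma> + u) \<partial>count_space \<Gamma>)"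

abbreviation cube_count :: "(real ^ 'm) set \<Rightarrow> real ^ 'm \<Rightarrow> real \<Rightarrow> ennreal" where
  "cube_count S y R \<equiv> (\<integral>\<^sup>+z. indicator (cube y R) z \<partial>count_space S)"

lemma nn_integral_lattice_shift:
  assumes "is_lattice \<Gamma>" "\<gamma>0 \<in> \<Gamma>"
  shows "(\<integral>\<^sup>+\<gamma>. f (\<gamma> - \<gamma>0) \<partial>count_space \<Gamma>) = (\<integral>\<^sup>+\<gamma>. f \<gamma> \<partial>count_space \<Gamma>)"
proof -
  have "bij_betw (\<lambda>\<gamma>. \<gamma> - \<gamma>0) \<Gamma> \<Gamma>"
    by (rule bij_betwI[where g = "\<lambda>\<gamma>. \<gamma> + \<gamma>0"])
       (use assms lattice_add lattice_diff in auto)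
  then show ?thesis by (rule nn_integral_bij_count_space)
qed

text \<open>Finitely many \<open>\<delta>\<close>-intervals around second coordinates of lattice points cover the bounded
  second projection of \<open>P\<close>. Subtracting one of these finitely many lattice points makes the second
  coordinate small and leaves the first one bounded.\<close>

lemma lattice_near_snd:
  fixes \<Gamma> :: "((real ^ 'm) \<times> real) set"
  assumes dense: "closure (snd ` \<Gamma>) = UNIV" and P: "bounded P" and \<delta>: "\<delta> > 0"
  obtains C where "C > 0"
    "\<And>u. u \<in> P \<Longrightarrow> \<exists>\<gamma>\<in>\<Gamma>. (\<forall>i. \<bar>fst (u - \<gamma>) $ i\<bar> \<le> C) \<and> \<bar>snd (u - \<gamma>)\<bar> \<le> \<delta>"
proof -
  obtain M where M: "M > 0" "\<And>u. u \<in> P \<Longrightarrow> norm u \<le> M"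
    using P bounded_pos by blast
  have "compact {-M..M}" by simp
  moreover have "{-M..M} \<subseteq> (\<Union>\<gamma>\<in>\<Gamma>. ball (snd \<gamma>) \<delta>)"
  proof
    fix s :: real
    have "s \<in> closure (snd ` \<Gamma>)" using dense by simp
    then obtain t where "t \<in> snd ` \<Gamma>" "dist t s < \<delta>" using \<delta> by (meson closure_approachable)
    then show "s \<in> (\<Union>\<gamma>\<in>\<Gamma>. ball (snd \<gamma>) \<delta>)" by auto
  qed
  ultimately obtain G where G: "G \<subseteq> \<Gamma>" "finite G" "{-M..M} \<subseteq> (\<Union>\<gamma>\<in>G. ball (snd \<gamma>) \<delta>)"
    using compactE_image[of "{-M..M}" \<Gamma> "\<lambda>\<gamma>. ball (snd \<gamma>) \<delta>"] by (metis open_ball)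
  define C where "C = M + (\<Sum>\<gamma>\<in>G. norm \<gamma>)"
  have "C > 0" using M(1) by (simp add: C_def add_pos_nonneg sum_nonneg)
  moreover have "\<exists>\<gamma>\<in>\<Gamma>. (\<forall>i. \<bar>fst (u - \<gamma>) $ i\<bar> \<le> C) \<and> \<bar>snd (u - \<gamma>)\<bar> \<le> \<delta>" if u: "u \<in> P" for u
  proof -
    have "\<bar>snd u\<bar> \<le> M" using M(2)[OF u] norm_snd_le[of "snd u" "fst u"] by simp
    then have "snd u \<in> {-M..M}" by (simp add: abs_le_iff)
    then obtain \<gamma> where \<gamma>: "\<gamma> \<in> G" "dist (snd \<gamma>) (snd u) < \<delta>" using G(3) by (auto simp: subset_iff)
    have "\<bar>fst (u - \<gamma>) $ i\<bar> \<le> C" for i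
    proof -
      have "\<bar>fst (u - \<gamma>) $ i\<bar> \<le> norm (fst (u - \<gamma>))" by (rule component_le_norm_cart)
      also have "\<dots> \<le> norm (u - \<gamma>)" using norm_fst_le[of "fst (u - \<gamma>)" "snd (u - \<gamma>)"] unfolding prod.collapse .
      also have "\<dots> \<le> norm u + norm \<gamma>" by (rule norm_triangle_ineq4)
      also have "norm \<gamma> \<le> (\<Sum>\<gamma>\<in>G. norm \<gamma>)" using \<gamma>(1) G(2) by (intro member_le_sum) auto
      finally show ?thesis using M(2)[OF u] by (simp add: C_def)
    qed
    moreover have "\<bar>snd (u - \<gamma>)\<bar> \<le> \<delta>" using \<gamma>(2) by (simp add: dist_real_def)
    ultimately show ?thesis using \<gamma>(1) G(1) by blast
  qed
  ultimately show ?thesis by (rule that)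
qed

text \<open>By \<open>nn_integral_lattice_unfold\<close> the average over \<open>u \<in> P\<close> of the number of lattice
  points in a box shifted by \<open>u\<close> is the volume of the box. Modulo the lattice each shift is bounded
  by \<open>C\<close> in the first and by \<open>\<delta>\<close> in the second coordinate, so each such number is
  bounded by the number of lattice points in the fixed box enlarged by these amounts, and from below by that in
  the fixed box made smaller. Rewritten for the number of points in one given box, this compares it with the
  volumes of the enlarged and the diminished box.\<close>

lemma lattice_box_count_bounds:
  fixes \<Gamma> :: "((real ^ 'm) \<times> real) set"
  assumes lat: "is_lattice \<Gamma>" and dense: "closure (snd ` \<Gamma>) = UNIV"
    and P[measurable]: "P \<in> sets borel" and bP: "bounded P"
    and tile: "\<And>v. \<exists>!\<gamma>. \<gamma> \<in> \<Gamma> \<and> v - \<gamma> \<in> P" and \<delta>: "\<delta> > 0"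
  obtains C where "C > 0"
    "\<And>x R a b. 2 * C \<le> R \<Longrightarrow> a + 2 * \<delta> \<le> b \<Longrightarrow>
       ennreal ((R - 2 * C) ^ CARD('m) * (b - a - 2 * \<delta>))
         \<le> emeasure lborel P * (lattice_count \<Gamma> (cube x R \<times> {a..b}))"
    "\<And>x R a b. 0 \<le> R \<Longrightarrow> a \<le> b \<Longrightarrow>
       emeasure lborel P * (lattice_count \<Gamma> (cube x R \<times> {a..b}))
         \<le> ennreal ((R + 2 * C) ^ CARD('m) * (b - a + 2 * \<delta>))"
proof -
  obtain C where C: "C > 0"
    "\<And>u. u \<in> P \<Longrightarrow> \<exists>\<gamma>\<in>\<Gamma>. (\<forall>i. \<bar>fst (u - \<gamma>) $ i\<bar> \<le> C) \<and> \<bar>snd (u - \<gamma>)\<bar> \<le> \<delta>"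
    using lattice_near_snd[OF dense bP \<delta>] by blast
  define n where "n x R a b = (\<integral>\<^sup>+\<gamma>. indicator (cube x R \<times> {a..b}) \<gamma> \<partial>count_space \<Gamma> :: ennreal)"
    for x :: "real ^ 'm" and R a b
  let ?c = "C *\<^sub>R 1 :: real ^ 'm"
  have avg: "(\<integral>\<^sup>+u. (lattice_count_at \<Gamma> (cube x R \<times> {a..b}) u) * indicator P u \<partial>lborel)
      = ennreal (R ^ CARD('m) * (b - a))"
    if "0 \<le> R" "a \<le> b" for x :: "real ^ 'm" and R a b
  proof -
    have [measurable]: "cube x R \<times> {a..b} \<in> sets borel"
      by (simp add: borel_prod[symmetric])
    have "(\<integral>\<^sup>+u. (lattice_count_at \<Gamma> (cube x R \<times> {a..b}) u) * indicator P u \<partial>lborel)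
        = (\<integral>\<^sup>+u. indicator (cube x R \<times> {a..b}) u \<partial>lborel)"
      by (rule nn_integral_lattice_unfold) (use countable_lattice[OF lat] tile in auto)
    also have "\<dots> = emeasure (lborel \<Otimes>\<^sub>M lborel) (cube x R \<times> {a..b})"
      by (simp add: lborel_prod)
    also have "\<dots> = ennreal (R ^ CARD('m) * (b - a))"
      using that by (subst lborel.emeasure_pair_measure_Times) (auto simp: emeasure_cube ennreal_mult)
    finally show ?thesis .
  qed
  have near: "\<exists>w. (\<forall>i. \<bar>fst w $ i\<bar> \<le> C) \<and> \<bar>snd w\<bar> \<le> \<delta> \<and>
      (\<forall>A. (lattice_count_at \<Gamma> A u) = (lattice_count_at \<Gamma> A w))"
    if u: "u \<in> P" for u
  proof -
    obtain \<gamma>0 where g: "\<gamma>0 \<in> \<Gamma>" "\<forall>i. \<bar>fst (u - \<gamma>0) $ i\<bar> \<le> C" "\<bar>snd (u - \<gamma>0)\<bar> \<le> \<delta>"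
      using C(2)[OF u] by blast
    have "(lattice_count_at \<Gamma> A u) = (\<integral>\<^sup>+\<gamma>. indicator A (\<gamma> + (u - \<gamma>0)) \<partial>count_space \<Gamma> :: ennreal)" for A
      using nn_integral_lattice_shift[OF lat g(1), of "\<lambda>\<gamma>. indicator A (\<gamma> + u)"] by (simp add: algebra_simps)
    then show ?thesis using g by (intro exI[of _ "u - \<gamma>0"]) auto
  qed
  have lower: "ennreal ((R - 2 * C) ^ CARD('m) * (b - a - 2 * \<delta>)) \<le> emeasure lborel P * n x R a b"
    if "2 * C \<le> R" "a + 2 * \<delta> \<le> b" for x R a b
  proof -
    have "ennreal ((R - 2 * C) ^ CARD('m) * (b - a - 2 * \<delta>)) =
      (\<integral>\<^sup>+u. (lattice_count_at \<Gamma> (cube (x + ?c) (R - 2 * C) \<times> {a + \<delta>..b - \<delta>}) u) * indicator P u \<partial>lborel)"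
      using that by (subst avg) (auto simp: algebra_simps)
    also have "\<dots> \<le> (\<integral>\<^sup>+u. n x R a b * indicator P u \<partial>lborel)"
    proof (rule nn_integral_mono)
      fix u
      show "(lattice_count_at \<Gamma> (cube (x + ?c) (R - 2 * C) \<times> {a + \<delta>..b - \<delta>}) u) * indicator P u
          \<le> n x R a b * indicator P u"
      proof (cases "u \<in> P")
        case True
        from near[OF this] obtain w where w: "\<forall>i. \<bar>fst w $ i\<bar> \<le> C" "\<bar>snd w\<bar> \<le> \<delta>"
          and eq: "\<forall>A. (lattice_count_at \<Gamma> A u) = (lattice_count_at \<Gamma> A w)"
          by blast
        have "(lattice_count_at \<Gamma> (cube (x + ?c) (R - 2 * C) \<times> {a + \<delta>..b - \<delta>}) w) \<le> n x R a b"
          unfolding n_def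
        proof (rule nn_integral_mono)
          fix \<gamma>
          have "\<gamma> \<in> cube x R \<times> {a..b}" if *: "\<gamma> + w \<in> cube (x + ?c) (R - 2 * C) \<times> {a + \<delta>..b - \<delta>}"
          proof -
            have "x $ i \<le> fst \<gamma> $ i \<and> fst \<gamma> $ i \<le> x $ i + R" for i
              using *[unfolded mem_Times_iff mem_cube, THEN conjunct1, rule_format, of i] w(1)[rule_format, of i]
              by (simp add: abs_le_iff)
            moreover have "a \<le> snd \<gamma>" "snd \<gamma> \<le> b"
              using * w(2) by (auto simp: mem_Times_iff)
            ultimately show ?thesis by (simp add: mem_Times_iff mem_cube)
          qed
          then show "indicator (cube (x + ?c) (R - 2 * C) \<times> {a + \<delta>..b - \<delta>}) (\<gamma> + w)
              \<le> (indicator (cube x R \<times> {a..b}) \<gamma> :: ennreal)"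
            by (simp add: indicator_def)
        qed
        then show ?thesis using eq by (simp add: True)
      qed simp
    qed
    also have "\<dots> = emeasure lborel P * n x R a b"
      by (subst nn_integral_cmult_indicator) (simp_all add: mult.commute)
    finally show ?thesis .
  qed
  have upper: "emeasure lborel P * n x R a b \<le> ennreal ((R + 2 * C) ^ CARD('m) * (b - a + 2 * \<delta>))"
    if "0 \<le> R" "a \<le> b" for x R a b
  proof -
    have "emeasure lborel P * n x R a b = (\<integral>\<^sup>+u. n x R a b * indicator P u \<partial>lborel)"
      by (subst nn_integral_cmult_indicator) (simp_all add: mult.commute)
    also have "\<dots> \<le> (\<integral>\<^sup>+u. (lattice_count_at \<Gamma> (cube (x - ?c) (R + 2 * C) \<times> {a - \<delta>..b + \<delta>}) u) * indicator P u \<partial>lborel)"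
    proof (rule nn_integral_mono)
      fix u
      show "n x R a b * indicator P u \<le> (lattice_count_at \<Gamma> (cube (x - ?c) (R + 2 * C) \<times> {a - \<delta>..b + \<delta>}) u) * indicator P u"
      proof (cases "u \<in> P")
        case True
        from near[OF this] obtain w where w: "\<forall>i. \<bar>fst w $ i\<bar> \<le> C" "\<bar>snd w\<bar> \<le> \<delta>"
          and eq: "\<forall>A. (lattice_count_at \<Gamma> A u) = (lattice_count_at \<Gamma> A w)"
          by blast
        have "n x R a b \<le> (lattice_count_at \<Gamma> (cube (x - ?c) (R + 2 * C) \<times> {a - \<delta>..b + \<delta>}) w)"
          unfolding n_def
        proof (rule nn_integral_mono)
          fix \<gamma>
          have "\<gamma> + w \<in> cube (x - ?c) (R + 2 * C) \<times> {a - \<delta>..b + \<delta>}" if *: "\<gamma> \<in> cube x R \<times> {a..b}"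
          proof -
            have "(x - ?c) $ i \<le> fst (\<gamma> + w) $ i \<and> fst (\<gamma> + w) $ i \<le> (x - ?c) $ i + (R + 2 * C)" for i
              using *[unfolded mem_Times_iff mem_cube, THEN conjunct1, rule_format, of i] w(1)[rule_format, of i]
              by (simp add: abs_le_iff)
            moreover have "a - \<delta> \<le> snd (\<gamma> + w)" "snd (\<gamma> + w) \<le> b + \<delta>"
              using * w(2) by (auto simp: mem_Times_iff)
            ultimately show ?thesis unfolding mem_Times_iff mem_cube by simp
          qed
          then show "(indicator (cube x R \<times> {a..b}) \<gamma> :: ennreal)
             \<le> indicator (cube (x - ?c) (R + 2 * C) \<times> {a - \<delta>..b + \<delta>}) (\<gamma> + w)"
            by (simp add: indicator_def)
        qed
        then show ?thesis using eq by (simp add: True)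
      qed simp
    qed
    also have "\<dots> = ennreal ((R + 2 * C) ^ CARD('m) * (b - a + 2 * \<delta>))"
      using that \<delta> C(1) by (subst avg) (auto simp: algebra_simps)
    finally show ?thesis .
  qed
  show ?thesis
    by (rule that[OF C(1)]) (use lower upper in \<open>auto simp: n_def\<close>)
qed

lemma countable_model_set: "countable \<Gamma> \<Longrightarrow> countable (model_set \<Gamma> \<Omega>)"
proof -
  have "model_set \<Gamma> \<Omega> \<subseteq> fst ` \<Gamma>" by (force simp: model_set_def)
  then show "countable \<Gamma> \<Longrightarrow> countable (model_set \<Gamma> \<Omega>)"
    by (meson countable_image countable_subset)
qed

text \<open>Sums over a model set are sums over the lattice with the window as a weight; this makes them comparable for
  different windows and under lattice translations.\<close>

lemma nn_integral_model_set:
  assumes "inj_on fst \<Gamma>"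
  shows "(\<integral>\<^sup>+z. f z \<partial>count_space (model_set \<Gamma> \<Omega>))
     = (\<integral>\<^sup>+\<gamma>. f (fst \<gamma>) * indicator \<Omega> (snd \<gamma>) \<partial>count_space \<Gamma>)"
proof -
  let ?G = "{\<gamma> \<in> \<Gamma>. snd \<gamma> \<in> \<Omega>}"
  have "bij_betw fst ?G (model_set \<Gamma> \<Omega>)"
    using assms by (auto simp: bij_betw_def model_set_def inj_on_def image_iff)
  then have "(\<integral>\<^sup>+z. f z \<partial>count_space (model_set \<Gamma> \<Omega>)) = (\<integral>\<^sup>+\<gamma>. f (fst \<gamma>) \<partial>count_space ?G)"
    by (rule nn_integral_bij_count_space[symmetric])
  also have "\<dots> = (\<integral>\<^sup>+\<gamma>. f (fst \<gamma>) * indicator ?G \<gamma> \<partial>count_space UNIV)"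
    by (rule nn_integral_count_space_indicator) auto
  also have "\<dots> = (\<integral>\<^sup>+\<gamma>. (f (fst \<gamma>) * indicator \<Omega> (snd \<gamma>)) * indicator \<Gamma> \<gamma> \<partial>count_space UNIV)"
    by (rule nn_integral_cong) (auto simp: indicator_def)
  also have "\<dots> = (\<integral>\<^sup>+\<gamma>. f (fst \<gamma>) * indicator \<Omega> (snd \<gamma>) \<partial>count_space \<Gamma>)"
    by (rule nn_integral_count_space_indicator[symmetric]) auto
  finally show ?thesis .
qed

text \<open>Uniformity in the position \<open>y\<close> of the cube allows the estimate to be integrated over
  \<open>y\<close> when mean values are taken. The counts are kept in \<^typ>\<open>ennreal\<close>, so that the
  upper bound also says that they are finite.\<close>

definition has_uniform_density :: "(real ^ 'm) set \<Rightarrow> real \<Rightarrow> bool" where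
  "has_uniform_density S D \<longleftrightarrow>
     (\<forall>\<epsilon>>0. \<exists>R0>0. \<forall>R\<ge>R0. \<forall>y.
        ennreal ((D - \<epsilon>) * R ^ CARD('m)) \<le> (cube_count S y R) \<and>
        (cube_count S y R) \<le> ennreal ((D + \<epsilon>) * R ^ CARD('m)))"

text \<open>The number \<open>p\<close> is the volume of a fundamental cell. In \<open>lattice_box_count_bounds\<close>, the
  constant \<open>C\<close> becomes negligible as \<open>R\<close> grows, and the remaining error \<open>2
  \<delta> / p\<close> is at most a given \<open>\<epsilon>\<close> for suitable \<open>\<delta>\<close>. The same
  \<open>p\<close> serves all windows.\<close>

lemma model_set_uniform_density:
  fixes \<Gamma> :: "((real ^ 'm) \<times> real) set"
  assumes "cut_and_project \<Gamma>"
  obtains p :: real where "p > 0"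
    "\<And>a b. a < b \<Longrightarrow> has_uniform_density (model_set \<Gamma> {a..b}) ((b - a) / p)"
proof -
  have lat: "is_lattice \<Gamma>" and inj: "inj_on fst \<Gamma>" and dense: "closure (snd ` \<Gamma>) = UNIV"
    using assms by (auto simp: cut_and_project_def)
  obtain P where P: "P \<in> sets borel" "bounded P" "\<And>v. \<exists>!\<gamma>. \<gamma> \<in> \<Gamma> \<and> v - \<gamma> \<in> P"
    by (rule lattice_fundamental_domain[OF lat]) (rule that, assumption+)
  note bounds = lattice_box_count_bounds[OF lat dense P]
  define p where "p = measure lborel P"
  have eP: "emeasure lborel P = ennreal p"
    unfolding p_def by (rule emeasure_eq_ennreal_measure) (use emeasure_bounded_finite[OF P(2)] in auto)
  have N: "(cube_count (model_set \<Gamma> {a..b}) y R)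
      = (\<integral>\<^sup>+\<gamma>. indicator (cube y R \<times> {a..b}) \<gamma> \<partial>count_space \<Gamma> :: ennreal)" for y R a b
    unfolding nn_integral_model_set[OF inj]
    by (rule nn_integral_cong) (auto simp: indicator_def mem_Times_iff)
  have "p > 0"
  proof -
    obtain C where C: "C > 0" "\<And>x R a b. 2 * C \<le> R \<Longrightarrow> a + 2 * (1::real) \<le> b \<Longrightarrow>
       ennreal ((R - 2 * C) ^ CARD('m) * (b - a - 2 * 1))
         \<le> emeasure lborel P * (lattice_count \<Gamma> (cube x R \<times> {a..b}))"
      using bounds[of 1] by (metis zero_less_one)
    have "ennreal 1 \<le> ennreal p * (lattice_count \<Gamma> (cube 0 (2 * C + 1) \<times> {0..3}))"
      using C(2)[of "2 * C + 1" 0 3 0] by (simp add: eP)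
    then have "p \<noteq> 0" by (intro notI) simp
    then show ?thesis by (simp add: p_def zero_less_measure_iff)
  qed
  moreover have "\<exists>R0>0. \<forall>R\<ge>R0. \<forall>y.
        ennreal (((b - a) / p - \<epsilon>) * R ^ CARD('m))
          \<le> (cube_count (model_set \<Gamma> {a..b}) y R) \<and>
        (cube_count (model_set \<Gamma> {a..b}) y R)
          \<le> ennreal (((b - a) / p + \<epsilon>) * R ^ CARD('m))"
    if ab: "a < b" and \<epsilon>: "\<epsilon> > 0" for a b \<epsilon>
  proof -
    \<comment> \<open>The first bound keeps the error \<open>2 \<delta> / p\<close> of the density below \<open>\<epsilon>\<close>, the second keeps the diminished window nondegenerate.\<close>
    define \<delta> where "\<delta> = min (\<epsilon> * p / 4) ((b - a) / 4)"
    have \<delta>: "\<delta> > 0" "2 * \<delta> < \<epsilon> * p" "a + 2 * \<delta> \<le> b"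
      using ab \<epsilon> \<open>p > 0\<close> mult_pos_pos[OF \<epsilon> \<open>p > 0\<close>] by (auto simp: \<delta>_def min_def field_simps)
    obtain C where C: "C > 0"
    "\<And>x R a b. 2 * C \<le> R \<Longrightarrow> a + 2 * \<delta> \<le> b \<Longrightarrow>
       ennreal ((R - 2 * C) ^ CARD('m) * (b - a - 2 * \<delta>))
         \<le> emeasure lborel P * (lattice_count \<Gamma> (cube x R \<times> {a..b}))"
    "\<And>x R a b. 0 \<le> R \<Longrightarrow> a \<le> b \<Longrightarrow>
       emeasure lborel P * (lattice_count \<Gamma> (cube x R \<times> {a..b}))
         \<le> ennreal ((R + 2 * C) ^ CARD('m) * (b - a + 2 * \<delta>))"
      using bounds[OF \<delta>(1)] by blast
    have "((\<lambda>R. ((R - 2 * C) / R) ^ CARD('m) * ((b - a - 2 * \<delta>) / p)) \<longlongrightarrow> 1 ^ CARD('m) * ((b - a - 2 * \<delta>) / p)) at_top"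
      by (intro tendsto_intros) real_asymp
    moreover have "1 ^ CARD('m) * ((b - a - 2 * \<delta>) / p) > (b - a) / p - \<epsilon>"
      using \<delta> \<open>p > 0\<close> by (simp add: field_simps)
    ultimately have "\<forall>\<^sub>F R in at_top. ((R - 2 * C) / R) ^ CARD('m) * ((b - a - 2 * \<delta>) / p) > (b - a) / p - \<epsilon>"
      by (rule order_tendstoD)
    moreover have "((\<lambda>R. ((R + 2 * C) / R) ^ CARD('m) * ((b - a + 2 * \<delta>) / p)) \<longlongrightarrow> 1 ^ CARD('m) * ((b - a + 2 * \<delta>) / p)) at_top"
      by (intro tendsto_intros) real_asymp
    moreover have "1 ^ CARD('m) * ((b - a + 2 * \<delta>) / p) < (b - a) / p + \<epsilon>"
      using \<delta> \<open>p > 0\<close> by (simp add: field_simps)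
    ultimately have "\<forall>\<^sub>F R in at_top. ((R - 2 * C) / R) ^ CARD('m) * ((b - a - 2 * \<delta>) / p) > (b - a) / p - \<epsilon> \<and>
       ((R + 2 * C) / R) ^ CARD('m) * ((b - a + 2 * \<delta>) / p) < (b - a) / p + \<epsilon>"
      by (intro eventually_conj) (auto dest: order_tendstoD(2))
    then obtain R1 where R1: "\<And>R. R \<ge> R1 \<Longrightarrow> ((R - 2 * C) / R) ^ CARD('m) * ((b - a - 2 * \<delta>) / p) > (b - a) / p - \<epsilon> \<and>
       ((R + 2 * C) / R) ^ CARD('m) * ((b - a + 2 * \<delta>) / p) < (b - a) / p + \<epsilon>"
      by (auto simp: eventually_at_top_linorder)
    define R0 where "R0 = max R1 (2 * C)"
    have "R0 > 0" using C(1) by (simp add: R0_def)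
    moreover have "ennreal (((b - a) / p - \<epsilon>) * R ^ CARD('m))
          \<le> (cube_count (model_set \<Gamma> {a..b}) y R)"
        (is "_ \<le> ?N") 
        "(cube_count (model_set \<Gamma> {a..b}) y R)
          \<le> ennreal (((b - a) / p + \<epsilon>) * R ^ CARD('m))"
      if R: "R \<ge> R0" for R y
    proof -
      have R': "R \<ge> R1" "R \<ge> 2 * C" "R > 0" using R C(1) by (auto simp: R0_def)
      have e: "1 = ennreal p * ennreal (1 / p)" using \<open>p > 0\<close> by (simp add: ennreal_mult[symmetric])
      have NN: "?N = ennreal (1 / p) * (emeasure lborel P * ?N)"
        unfolding eP by (simp add: mult.assoc[symmetric] e[symmetric] mult.commute[of "ennreal (1/p)"] flip: ennreal_mult)
      have "((b - a) / p - \<epsilon>) * R ^ CARD('m) \<le> ((R - 2 * C) / R) ^ CARD('m) * ((b - a - 2 * \<delta>) / p) * R ^ CARD('m)"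
        using R1[OF R'(1)] R'(3) by (intro mult_right_mono) auto
      also have "\<dots> = 1 / p * ((R - 2 * C) ^ CARD('m) * (b - a - 2 * \<delta>))"
        using R'(3) by (simp add: power_divide)
      finally have "ennreal (((b - a) / p - \<epsilon>) * R ^ CARD('m)) \<le> ennreal (1 / p * ((R - 2 * C) ^ CARD('m) * (b - a - 2 * \<delta>)))"
        by (rule ennreal_leI)
      also have "\<dots> = ennreal (1 / p) * ennreal ((R - 2 * C) ^ CARD('m) * (b - a - 2 * \<delta>))"
        using \<open>p > 0\<close> R' \<delta> by (intro ennreal_mult) auto
      also have "\<dots> \<le> ennreal (1 / p) * (emeasure lborel P * ?N)"
        unfolding N using R' \<delta> by (intro mult_left_mono C(2)) auto
      finally show "ennreal (((b - a) / p - \<epsilon>) * R ^ CARD('m)) \<le> ?N" using NN by simp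
      have "?N = ennreal (1 / p) * (emeasure lborel P * ?N)" by (rule NN)
      also have "\<dots> \<le> ennreal (1 / p) * ennreal ((R + 2 * C) ^ CARD('m) * (b - a + 2 * \<delta>))"
        unfolding N using R' ab by (intro mult_left_mono C(3)) auto
      also have "\<dots> = ennreal (1 / p * ((R + 2 * C) ^ CARD('m) * (b - a + 2 * \<delta>)))"
        using \<open>p > 0\<close> R' \<delta> ab C(1) by (intro ennreal_mult[symmetric]) auto
      also have "1 / p * ((R + 2 * C) ^ CARD('m) * (b - a + 2 * \<delta>)) = ((R + 2 * C) / R) ^ CARD('m) * ((b - a + 2 * \<delta>) / p) * R ^ CARD('m)"
        using R'(3) by (simp add: power_divide)
      also have "ennreal \<dots> \<le> ennreal (((b - a) / p + \<epsilon>) * R ^ CARD('m))"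
        using R1[OF R'(1)] R'(3) by (intro ennreal_leI mult_right_mono) auto
      finally show "?N \<le> ennreal (((b - a) / p + \<epsilon>) * R ^ CARD('m))" .
    qed
    ultimately show ?thesis by blast
  qed
  ultimately show ?thesis by (intro that) (auto simp: has_uniform_density_def)
qed

lemma point_density_eqI:
  fixes S :: "(real ^ 'm) set"
  assumes D: "D \<ge> 0" and U: "has_uniform_density S D"
  shows "point_density S = D"
proof -
  have cnt: "(cube_count S y R) = emeasure (count_space S) (S \<inter> cube y R)" for y R
  proof -
    have "(cube_count S y R) = (\<integral>\<^sup>+z. indicator (S \<inter> cube y R) z \<partial>count_space S)"
      by (rule nn_integral_cong) (auto simp: indicator_def)
    then show ?thesis by simp
  qed
  have "((\<lambda>R. real (card (S \<inter> cube x R)) / R ^ CARD('m)) \<longlongrightarrow> D) at_top" for x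
  proof (rule tendstoI)
    fix e :: real assume "e > 0"
    then obtain R0 where R0: "R0 > 0" and B: "\<And>R y. R \<ge> R0 \<Longrightarrow>
        ennreal ((D - e / 2) * R ^ CARD('m)) \<le> emeasure (count_space S) (S \<inter> cube y R) \<and>
        emeasure (count_space S) (S \<inter> cube y R) \<le> ennreal ((D + e / 2) * R ^ CARD('m))"
      using U unfolding has_uniform_density_def cnt by (meson half_gt_zero)
    have "dist (real (card (S \<inter> cube x R)) / R ^ CARD('m)) D < e" if R: "R \<ge> R0" for R
    proof -
      have Rp: "R ^ CARD('m) > 0" using R R0 by simp
      have fin: "finite (S \<inter> cube x R)"
        using B[OF R, of x] by (metis Int_lower1 emeasure_count_space_infinite ennreal_neq_top top.extremum_unique infinity_ennreal_def)
      then have em: "emeasure (count_space S) (S \<inter> cube x R) = ennreal (real (card (S \<inter> cube x R)))"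
        by (simp add: emeasure_count_space_finite ennreal_of_nat_eq_real_of_nat)
      have lo: "(D - e / 2) * R ^ CARD('m) \<le> real (card (S \<inter> cube x R))"
        using B[OF R, of x] unfolding em by (auto simp: ennreal_le_iff)
      have hi: "real (card (S \<inter> cube x R)) \<le> (D + e / 2) * R ^ CARD('m)"
      proof -
        have "0 \<le> (D + e / 2) * R ^ CARD('m)" using D Rp \<open>e > 0\<close> by simp
        then show ?thesis using B[OF R, of x] unfolding em by (auto simp: ennreal_le_iff)
      qed
      show ?thesis
        using lo hi Rp \<open>e > 0\<close>
        by (simp add: dist_real_def abs_less_iff flip: pos_le_divide_eq pos_divide_le_eq)
    qed
    then show "\<forall>\<^sub>F R in at_top. dist (real (card (S \<inter> cube x R)) / R ^ CARD('m)) D < e"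
      unfolding eventually_at_top_linorder by blast
  qed
  then have "has_point_density S D" by (simp add: has_point_density_def)
  moreover have "d = D" if "has_point_density S d" for d
    using that calculation unfolding has_point_density_def
    by (meson tendsto_unique trivial_limit_at_top_linorder)
  ultimately show ?thesis unfolding point_density_def by (rule the_equality)
qed

section \<open>Gaussians and Plancherel's theorem\<close>

lemma integral_lborel_affine:
  fixes f :: "'a::euclidean_space \<Rightarrow> 'b::{banach, second_countable_topology}"
  assumes [measurable]: "f \<in> borel_measurable borel" and c: "c \<noteq> 0"
  shows "(\<integral>x. f x \<partial>lborel) = (\<bar>c\<bar> ^ DIM('a)) *\<^sub>R (\<integral>x. f (t + c *\<^sub>R x) \<partial>lborel)"
  by (subst lborel_affine[OF c, of t]) (simp add: integral_density integral_distr)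

lemma integrable_lborel_affine:
  fixes f :: "'a::euclidean_space \<Rightarrow> 'b::{banach, second_countable_topology}"
  assumes [measurable]: "f \<in> borel_measurable borel" and c: "c \<noteq> 0"
  shows "integrable lborel (\<lambda>x. f (t + c *\<^sub>R x)) \<longleftrightarrow> integrable lborel f"
proof -
  have "integrable lborel f \<longleftrightarrow> integrable lborel (\<lambda>x. \<bar>c\<bar> ^ DIM('a) *\<^sub>R f (t + c *\<^sub>R x))"
    by (subst lborel_affine[OF c, of t]) (simp add: integrable_density integrable_distr_eq)
  also have "\<dots> \<longleftrightarrow> integrable lborel (\<lambda>x. f (t + c *\<^sub>R x))"
  proof
    assume "integrable lborel (\<lambda>x. \<bar>c\<bar> ^ DIM('a) *\<^sub>R f (t + c *\<^sub>R x))"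
    then have "integrable lborel (\<lambda>x. (1 / \<bar>c\<bar> ^ DIM('a)) *\<^sub>R \<bar>c\<bar> ^ DIM('a) *\<^sub>R f (t + c *\<^sub>R x))"
      by (rule integrable_scaleR_right)
    then show "integrable lborel (\<lambda>x. f (t + c *\<^sub>R x))" using c by simp
  qed simp
  finally show ?thesis ..
qed

lemma integral_lborel_prod:
  fixes f :: "'a::euclidean_space \<Rightarrow> real \<Rightarrow> complex"
  assumes int: "\<And>b. b \<in> Basis \<Longrightarrow> integrable lborel (f b)"
  shows "(\<integral>x. (\<Prod>b\<in>Basis. f b (x \<bullet> b)) \<partial>lborel) = (\<Prod>b\<in>Basis. (\<integral>x. f b x \<partial>lborel))"
proof -
  interpret product_sigma_finite "\<lambda>_::'a. lborel :: real measure" ..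
  have [measurable]: "f b \<in> borel_measurable borel" if "b \<in> Basis" for b
    using borel_measurable_integrable[OF int[OF that]] by simp
  have "(\<integral>x. (\<Prod>b\<in>Basis. f b (x \<bullet> b)) \<partial>(lborel :: 'a measure))
      = (\<integral>x. (\<Prod>b\<in>Basis. f b ((\<Sum>b\<in>Basis. x b *\<^sub>R b) \<bullet> b)) \<partial>(\<Pi>\<^sub>M b\<in>Basis. lborel))"
    by (subst lborel_eq) (simp add: integral_distr)
  also have "\<dots> = (\<integral>x. (\<Prod>b\<in>Basis. f b (x b)) \<partial>(\<Pi>\<^sub>M b\<in>Basis. lborel))"
    by (intro Bochner_Integration.integral_cong prod.cong) simp_all
  also have "\<dots> = (\<Prod>b\<in>Basis. (\<integral>x. f b x \<partial>lborel))"
    by (rule product_integral_prod) (use int in auto)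
  finally show ?thesis .
qed

text \<open>The density of the standard normal distribution in dimension \<open>DIM('a)\<close>.\<close>

definition gauss :: "'a::euclidean_space \<Rightarrow> real" where
  "gauss v = exp (- (norm v)\<^sup>2 / 2) / sqrt (2 * pi) ^ DIM('a)"

lemma gauss_eq_prod: "gauss (v :: 'a::euclidean_space) = (\<Prod>b\<in>Basis. std_normal_density (v \<bullet> b))"
proof -
  have "(norm v)\<^sup>2 = (\<Sum>b\<in>Basis. (v \<bullet> b)\<^sup>2)"
    unfolding power2_norm_eq_inner by (subst euclidean_inner) (simp add: power2_eq_square)
  then have "exp (- (norm v)\<^sup>2 / 2) = (\<Prod>b\<in>Basis. exp (- (v \<bullet> b)\<^sup>2 / 2))"
    by (simp add: exp_sum[symmetric] sum_negf sum_divide_distrib)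
  then show ?thesis
    by (simp add: gauss_def std_normal_density_def prod_dividef)
qed

lemma gauss_pos: "gauss v > 0"
  by (simp add: gauss_def)

lemma gauss_uminus[simp]: "gauss (- v) = gauss v"
  by (simp add: gauss_def)

lemma gauss_borel[measurable]: "gauss \<in> borel_measurable borel"
  unfolding gauss_def by measurable

lemma nn_integral_gauss: "(\<integral>\<^sup>+v. ennreal (gauss (v :: 'a::euclidean_space)) \<partial>lborel) = 1"
proof -
  have "(\<integral>\<^sup>+x. ennreal (std_normal_density x) \<partial>lborel) = 1"
    using integral_normal_density[of 1 0] integrable_normal_density[of 1 0]
    by (subst nn_integral_eq_integral) auto
  moreover have "(\<integral>\<^sup>+v. ennreal (gauss v) \<partial>(lborel :: 'a measure))
      = (\<integral>\<^sup>+v. (\<Prod>b\<in>Basis. ennreal (std_normal_density (v \<bullet> b))) \<partial>(lborel :: 'a measure))"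
    by (intro nn_integral_cong) (simp add: gauss_eq_prod prod_ennreal)
  ultimately show ?thesis
    by (subst (asm) nn_integral_lborel_prod) auto
qed

lemma integrable_gauss[simp]: "integrable lborel (gauss :: 'a::euclidean_space \<Rightarrow> real)"
  using nn_integral_gauss[where 'a = 'a]
  by (intro integrableI_nonneg) (auto simp: less_imp_le[OF gauss_pos])

lemma integral_gauss: "(\<integral>v. gauss (v :: 'a::euclidean_space) \<partial>lborel) = 1"
  using nn_integral_gauss[where 'a = 'a] nn_integral_eq_integral[OF integrable_gauss[where 'a = 'a]]
  by (simp add: less_imp_le[OF gauss_pos] ennreal_eq_1)

lemma cis_sum: "cis (sum f A) = (\<Prod>a\<in>A. cis (f a))"
  by (cases "finite A") (simp_all add: cis_conv_exp exp_sum sum_distrib_left)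

text \<open>The integrand is a product over the coordinates, so this reduces to the characteristic function of the standard
  normal distribution on the line.\<close>

lemma integral_gauss_cis:
  "(\<integral>v. gauss v *\<^sub>R cis (u \<bullet> v) \<partial>lborel) = exp (- (norm (u :: 'a::euclidean_space))\<^sup>2 / 2)"
proof -
  have one: "(\<integral>x. std_normal_density x *\<^sub>R cis (t * x) \<partial>lborel) = exp (- t\<^sup>2 / 2)" for t :: real
  proof -
    have "exp (- t\<^sup>2 / 2) = char std_normal_distribution t"
      by (simp add: char_std_normal_distribution)
    also have "\<dots> = (\<integral>x. iexp (t * x) \<partial>density lborel (\<lambda>x. ennreal (std_normal_density x)))"
      by (simp add: char_def)
    also have "\<dots> = (\<integral>x. std_normal_density x *\<^sub>R iexp (t * x) \<partial>lborel)"
      by (rule integral_density) auto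
    finally show ?thesis by (simp add: cis_conv_exp)
  qed
  have int: "integrable lborel (\<lambda>x. std_normal_density x *\<^sub>R cis (t * x))" for t :: real
    using integrable_normal_density[of 1 0]
    by (rule Bochner_Integration.integrable_bound) (auto simp: cis_conv_exp)
  have "(\<integral>v. gauss v *\<^sub>R cis (u \<bullet> v) \<partial>lborel)
      = (\<integral>v. (\<Prod>b\<in>Basis. std_normal_density (v \<bullet> b) *\<^sub>R cis ((u \<bullet> b) * (v \<bullet> b))) \<partial>lborel)"
  proof (intro Bochner_Integration.integral_cong refl)
    fix v :: 'a
    have "cis (u \<bullet> v) = (\<Prod>b\<in>Basis. cis ((u \<bullet> b) * (v \<bullet> b)))"
      by (subst euclidean_inner) (rule cis_sum)
    then show "gauss v *\<^sub>R cis (u \<bullet> v) = (\<Prod>b\<in>Basis. std_normal_density (v \<bullet> b) *\<^sub>R cis ((u \<bullet> b) * (v \<bullet> b)))"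
      by (simp add: gauss_eq_prod scaleR_conv_of_real prod.distrib)
  qed
  also have "\<dots> = (\<Prod>b\<in>Basis. complex_of_real (exp (- (u \<bullet> b)\<^sup>2 / 2)))"
    by (subst integral_lborel_prod[where f = "\<lambda>b x. std_normal_density x *\<^sub>R cis ((u \<bullet> b) * x)"])
       (simp_all add: int one)
  also have "\<dots> = exp (- (norm u)\<^sup>2 / 2)"
  proof -
    have "(norm u)\<^sup>2 = (\<Sum>b\<in>Basis. (u \<bullet> b)\<^sup>2)"
      unfolding power2_norm_eq_inner by (subst euclidean_inner) (simp add: power2_eq_square)
    then have "exp (- (norm u)\<^sup>2 / 2) = (\<Prod>b\<in>Basis. exp (- (u \<bullet> b)\<^sup>2 / 2))"
      by (simp add: exp_sum[symmetric] sum_negf sum_divide_distrib)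
    then show ?thesis by simp
  qed
  finally show ?thesis .
qed

text \<open>With respect to \<^const>\<open>lborel\<close> the theorems on product measures apply directly; on Borel
  functions the values are those of \<^const>\<open>fourier\<close>.\<close>

definition ft :: "('a::euclidean_space \<Rightarrow> complex) \<Rightarrow> 'a \<Rightarrow> complex" where
  "ft f \<omega> = (\<integral>t. f t * cis (- 2 * pi * (t \<bullet> \<omega>)) \<partial>lborel)"

lemma cis_borel[measurable]: "cis \<in> borel_measurable borel"
  by (intro borel_measurable_continuous_onI continuous_intros)

lemma cnj_borel[measurable]: "cnj \<in> borel_measurable borel"
  by (intro borel_measurable_continuous_onI continuous_intros)

lemma ft_borel[measurable]:
  assumes [measurable]: "f \<in> borel_measurable borel"
  shows "ft f \<in> borel_measurable borel"
  unfolding ft_def[abs_def] by measurable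

lemma integrable_mult_cis:
  assumes "integrable lborel f" and [measurable]: "h \<in> borel_measurable borel"
  shows "integrable lborel (\<lambda>t. f t * cis (h t))"
  using assms(1) borel_measurable_integrable[OF assms(1)]
  by (intro Bochner_Integration.integrable_bound[OF assms(1)]) (auto simp: norm_mult)

lemma norm_ft_le:
  assumes "integrable lborel f"
  shows "norm (ft f \<omega>) \<le> (\<integral>t. norm (f t) \<partial>lborel)"
  unfolding ft_def by (rule order_trans[OF integral_norm_bound]) (simp add: norm_mult)

text \<open>The multiplication formula, an instance of Fubini's theorem.\<close>

lemma integral_ft_mult:
  fixes f h :: "'a::euclidean_space \<Rightarrow> complex"
  assumes f: "integrable lborel f" and h: "integrable lborel h"
  shows "(\<integral>\<omega>. ft f \<omega> * h \<omega> \<partial>lborel) = (\<integral>t. f t * ft h t \<partial>lborel)"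
proof -
  have [measurable]: "f \<in> borel_measurable borel" "h \<in> borel_measurable borel"
    using f h borel_measurable_integrable by auto
  let ?F = "\<lambda>\<omega> t. f t * cis (- 2 * pi * (t \<bullet> \<omega>)) * h \<omega>"
  have "integrable (lborel \<Otimes>\<^sub>M lborel) (case_prod ?F)"
  proof (rule lborel_pair.Fubini_integrable)
    show "integrable lborel (\<lambda>\<omega>. \<integral>t. norm (case (\<omega>, t) of (\<omega>, t) \<Rightarrow> ?F \<omega> t) \<partial>lborel)"
      using h by (simp add: norm_mult)
    show "AE \<omega> in lborel. integrable lborel (\<lambda>t. case (\<omega>, t) of (\<omega>, t) \<Rightarrow> ?F \<omega> t)"
      using integrable_mult_left[OF integrable_mult_cis[OF f]] by (auto simp: split_def)
  qed measurable
  then have "(\<integral>\<omega>. (\<integral>t. ?F \<omega> t \<partial>lborel) \<partial>lborel) = (\<integral>t. (\<integral>\<omega>. ?F \<omega> t \<partial>lborel) \<partial>lborel)"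
    by (rule lborel_pair.Fubini_integral[symmetric])
  moreover have "(\<integral>t. ?F \<omega> t \<partial>lborel) = ft f \<omega> * h \<omega>" for \<omega>
    by (simp add: ft_def)
  moreover have "(\<integral>\<omega>. ?F \<omega> t \<partial>lborel) = f t * ft h t" for t
    unfolding ft_def by (simp add: inner_commute ac_simps flip: integral_mult_right_zero)
  ultimately show ?thesis by (simp only:)
qed

text \<open>A Gaussian weight of width \<open>1 / r\<close> on the frequency side becomes an approximate identity of width
  \<open>r\<close>; the constants are arranged such that the latter has integral \<open>1\<close>.\<close>

lemma ft_gauss_modulated:
  fixes x y :: "'a::euclidean_space"
  assumes r: "r > 0"
  shows "ft (\<lambda>\<omega>. exp (- (2 * pi * r * norm \<omega>)\<^sup>2 / 2) *\<^sub>R cis (2 * pi * (x \<bullet> \<omega>))) y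
       = (gauss ((y - x) /\<^sub>R r) / r ^ DIM('a))"
proof -
  define s where "s = 2 * pi * r"
  have s: "s > 0" using r by (simp add: s_def)
  let ?f = "\<lambda>\<omega>::'a. exp (- (s * norm \<omega>)\<^sup>2 / 2) *\<^sub>R cis (2 * pi * ((x - y) \<bullet> \<omega>))"
  have "ft (\<lambda>\<omega>. exp (- (s * norm \<omega>)\<^sup>2 / 2) *\<^sub>R cis (2 * pi * (x \<bullet> \<omega>))) y = (\<integral>\<omega>. ?f \<omega> \<partial>lborel)"
    unfolding ft_def
    by (intro Bochner_Integration.integral_cong refl)
       (simp add: cis_mult scaleR_conv_of_real algebra_simps inner_commute inner_diff_left)
  also have "\<dots> = \<bar>1 / s\<bar> ^ DIM('a) *\<^sub>R (\<integral>v. ?f (0 + (1 / s) *\<^sub>R v) \<partial>lborel)"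
    using s by (intro integral_lborel_affine) auto
  also have "(\<integral>v. ?f (0 + (1 / s) *\<^sub>R v) \<partial>lborel)
      = (\<integral>v. sqrt (2 * pi) ^ DIM('a) *\<^sub>R (gauss v *\<^sub>R cis (((2 * pi / s) *\<^sub>R (x - y)) \<bullet> v)) \<partial>lborel)"
  proof (intro Bochner_Integration.integral_cong refl)
    fix v :: 'a
    have "2 * pi * ((x - y) \<bullet> (0 + (1 / s) *\<^sub>R v)) = ((2 * pi / s) *\<^sub>R (x - y)) \<bullet> v"
      by simp
    moreover have "exp (- (s * norm (0 + (1 / s) *\<^sub>R v))\<^sup>2 / 2) = sqrt (2 * pi) ^ DIM('a) * gauss v"
      using s by (simp add: gauss_def)
    ultimately show "?f (0 + (1 / s) *\<^sub>R v)
        = sqrt (2 * pi) ^ DIM('a) *\<^sub>R (gauss v *\<^sub>R cis (((2 * pi / s) *\<^sub>R (x - y)) \<bullet> v))"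
      by (simp only: scaleR_scaleR)
  qed
  also have "\<dots> = sqrt (2 * pi) ^ DIM('a) *\<^sub>R complex_of_real (exp (- (norm ((2 * pi / s) *\<^sub>R (x - y)))\<^sup>2 / 2))"
    by (simp only: integral_scaleR_right integral_gauss_cis)
  also have "norm ((2 * pi / s) *\<^sub>R (x - y)) = norm ((y - x) /\<^sub>R r)"
  proof -
    have "(2 * pi / s) *\<^sub>R (x - y) = - ((y - x) /\<^sub>R r)"
      using r by (simp add: s_def inverse_eq_divide scaleR_diff_right)
    then show ?thesis by (simp only: norm_minus_cancel)
  qed
  also have "\<bar>1 / s\<bar> ^ DIM('a) *\<^sub>R (sqrt (2 * pi) ^ DIM('a) *\<^sub>R complex_of_real (exp (- (norm ((y - x) /\<^sub>R r))\<^sup>2 / 2)))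
     = complex_of_real (gauss ((y - x) /\<^sub>R r) / r ^ DIM('a))"
  proof -
    have "sqrt (2 * pi) ^ DIM('a) * sqrt (2 * pi) ^ DIM('a) = (2 * pi) ^ DIM('a)"
      unfolding power_mult_distrib[symmetric] by simp
    then have "1 / (2 * pi * r) ^ DIM('a) * sqrt (2 * pi) ^ DIM('a) * (r ^ DIM('a) * sqrt (2 * pi) ^ DIM('a)) = 1"
      using r by (simp add: power_mult_distrib divide_simps)
    then have *: "\<bar>1 / s\<bar> ^ DIM('a) * sqrt (2 * pi) ^ DIM('a) = 1 / (r ^ DIM('a) * sqrt (2 * pi) ^ DIM('a))"
      using r by (simp add: s_def power_one_over[symmetric] eq_divide_eq)
    have "gauss ((y - x) /\<^sub>R r) / r ^ DIM('a)
        = (\<bar>1 / s\<bar> ^ DIM('a) * sqrt (2 * pi) ^ DIM('a)) * exp (- (norm ((y - x) /\<^sub>R r))\<^sup>2 / 2)"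
      unfolding * gauss_def by simp
    then show ?thesis by (simp only: scaleR_conv_of_real of_real_mult mult.assoc)
  qed
  finally show ?thesis by (simp add: s_def)
qed

lemma integrable_exp_norm_square:
  assumes "c > 0"
  shows "integrable lborel (\<lambda>x :: 'a::euclidean_space. exp (- (c * norm x)\<^sup>2 / 2))"
proof -
  have "exp (- (c * norm x)\<^sup>2 / 2) = sqrt (2 * pi) ^ DIM('a) * gauss (0 + c *\<^sub>R x)" for x :: 'a
    using assms by (simp add: gauss_def)
  moreover have "integrable lborel (\<lambda>x :: 'a. sqrt (2 * pi) ^ DIM('a) * gauss (0 + c *\<^sub>R x))"
    using assms by (intro integrable_mult_right) (subst integrable_lborel_affine, auto)
  ultimately show ?thesis by (simp only:)
qed

abbreviation gauss_mean :: "('a::euclidean_space \<Rightarrow> complex) \<Rightarrow> real \<Rightarrow> 'a \<Rightarrow> complex" where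
  "gauss_mean V r x \<equiv> (\<integral>v. gauss v *\<^sub>R V (x + r *\<^sub>R v) \<partial>lborel)"

text \<open>The weight makes every integral absolutely convergent. Applying the multiplication formula twice moves both
  Fourier transforms onto the weight, whose transform is the kernel in \<open>ft_gauss_modulated\<close>;
  substituting \<open>y = x + r v\<close> turns this kernel into \<^const>\<open>gauss\<close>.\<close>

lemma weighted_plancherel:
  fixes V :: "'a::euclidean_space \<Rightarrow> complex"
  assumes V: "integrable lborel V" and r: "r > 0"
  shows "(\<integral>\<omega>. exp (- (2 * pi * r * norm \<omega>)\<^sup>2 / 2) *\<^sub>R complex_of_real ((norm (ft V \<omega>))\<^sup>2) \<partial>lborel)
       = (\<integral>x. V x * cnj (gauss_mean V r x) \<partial>lborel)"
proof -
  define w where "w \<omega> = exp (- (2 * pi * r * norm \<omega>)\<^sup>2 / 2)" for \<omega> :: 'a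
  have [measurable]: "V \<in> borel_measurable borel"
    using V borel_measurable_integrable by auto
  have [measurable]: "w \<in> borel_measurable borel" unfolding w_def by measurable
  have w: "integrable lborel w"
    unfolding w_def using r by (intro integrable_exp_norm_square) simp
  have w0: "w \<omega> \<ge> 0" for \<omega> by (simp add: w_def)
  define H where "H x \<omega> = w \<omega> *\<^sub>R cis (2 * pi * (x \<bullet> \<omega>))" for x \<omega>
  have intH: "integrable lborel (H x)" for x
    unfolding H_def by (rule Bochner_Integration.integrable_bound[OF w]) (auto simp: w0)
  define G where "G \<omega> = w \<omega> *\<^sub>R cnj (ft V \<omega>)" for \<omega>
  have intG: "integrable lborel G"
  proof (rule Bochner_Integration.integrable_bound)
    show "integrable lborel (\<lambda>\<omega>. (\<integral>t. norm (V t) \<partial>lborel) * w \<omega>)" using w by simp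
    show "AE \<omega> in lborel. norm (G \<omega>) \<le> norm ((\<integral>t. norm (V t) \<partial>lborel) * w \<omega>)"
      unfolding G_def using norm_ft_le[OF V] w0 by (intro AE_I2) (simp add: mult.commute mult_left_mono mult_right_mono)
  qed (simp add: G_def[abs_def])
  have smooth: "cnj (ft G x) = (gauss_mean V r x)" for x
  proof -
    have "cnj (ft G x) = (\<integral>\<omega>. ft V \<omega> * H x \<omega> \<partial>lborel)"
      unfolding ft_def[of G]
      by (subst Bochner_Integration.integral_cnj[symmetric], intro Bochner_Integration.integral_cong refl)
         (simp add: G_def H_def cis_cnj inner_commute)
    also have "\<dots> = (\<integral>y. V y * ft (H x) y \<partial>lborel)"
      by (rule integral_ft_mult[OF V intH])
    also have "\<dots> = (\<integral>y. V y * complex_of_real (gauss ((y - x) /\<^sub>R r) / r ^ DIM('a)) \<partial>lborel)"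
      unfolding H_def w_def ft_gauss_modulated[OF r] ..
    also have "\<dots> = \<bar>r\<bar> ^ DIM('a) *\<^sub>R (\<integral>v. V (x + r *\<^sub>R v) * complex_of_real (gauss ((x + r *\<^sub>R v - x) /\<^sub>R r) / r ^ DIM('a)) \<partial>lborel)"
      using r by (intro integral_lborel_affine) auto
    also have "\<dots> = (gauss_mean V r x)"
      using r by (subst integral_scaleR_right[symmetric], intro Bochner_Integration.integral_cong refl)
        (simp add: scaleR_conv_of_real)
    finally show ?thesis .
  qed
  have "(\<integral>\<omega>. w \<omega> *\<^sub>R complex_of_real ((norm (ft V \<omega>))\<^sup>2) \<partial>lborel) = (\<integral>\<omega>. ft V \<omega> * G \<omega> \<partial>lborel)"
    unfolding G_def by (intro Bochner_Integration.integral_cong refl)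
      (simp only: complex_norm_square mult_scaleR_right)
  also have "\<dots> = (\<integral>x. V x * ft G x \<partial>lborel)"
    by (rule integral_ft_mult[OF V intG])
  also have "\<dots> = (\<integral>x. V x * cnj (gauss_mean V r x) \<partial>lborel)"
    by (simp flip: smooth)
  finally show ?thesis by (simp add: w_def)
qed

lemma norm_gauss_scaleR_le:
  fixes z :: complex
  assumes "norm z \<le> M"
  shows "norm (gauss v *\<^sub>R z) \<le> M * gauss v"
  using assms gauss_pos[of v] by (simp add: mult.commute[of M] mult_left_mono)

lemma gauss_smoothing_tendsto:
  fixes V :: "'a::euclidean_space \<Rightarrow> complex"
  assumes cont: "continuous_on UNIV V" and bd: "\<And>x. norm (V x) \<le> M"
    and r: "r \<longlonglongrightarrow> 0"
  shows "(\<lambda>n. gauss_mean V (r n) x) \<longlonglongrightarrow> V x"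
proof -
  have [measurable]: "V \<in> borel_measurable borel"
    using cont by (rule borel_measurable_continuous_onI)
  have "(\<lambda>n. gauss_mean V (r n) x) \<longlonglongrightarrow> (\<integral>v. gauss (v :: 'a) *\<^sub>R V x \<partial>lborel)"
  proof (rule integral_dominated_convergence[where w = "\<lambda>v. M * gauss v"])
    show "AE v in lborel. (\<lambda>n. gauss v *\<^sub>R V (x + r n *\<^sub>R v)) \<longlonglongrightarrow> gauss v *\<^sub>R V x"
    proof (intro AE_I2 tendsto_scaleR tendsto_const)
      fix v :: 'a
      have "(\<lambda>n. x + r n *\<^sub>R v) \<longlonglongrightarrow> x + 0 *\<^sub>R v"
        by (intro tendsto_intros r)
      moreover have "isCont V x"
        using cont by (simp add: continuous_on_eq_continuous_at)
      ultimately show "(\<lambda>n. V (x + r n *\<^sub>R v)) \<longlonglongrightarrow> V x"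
        by (auto intro: isCont_tendsto_compose)
    qed
    show "AE v in lborel. norm (gauss v *\<^sub>R V (x + r n *\<^sub>R v)) \<le> M * gauss v" for n
      by (intro AE_I2 norm_gauss_scaleR_le bd)
  qed auto
  then show ?thesis by (simp add: integral_gauss)
qed

text \<open>Let \<open>r\<close> tend to \<open>0\<close> in \<open>weighted_plancherel\<close>: the left-hand side
  converges by monotone convergence, the right-hand side by dominated convergence, since Gaussian means of the
  continuous function \<open>V\<close> tend to \<open>V\<close> pointwise. Correlations of an integrable function
  with a continuous, bounded and integrable one satisfy the hypotheses.\<close>

lemma plancherel:
  fixes V :: "'a::euclidean_space \<Rightarrow> complex"
  assumes cont: "continuous_on UNIV V" and bd: "\<And>x. norm (V x) \<le> M"
    and V: "integrable lborel V"
  shows "(\<integral>\<^sup>+\<omega>. sqn (ft V \<omega>) \<partial>lborel) = (\<integral>\<^sup>+x. sqn (V x) \<partial>lborel)"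
    and "integrable lborel (\<lambda>x. (norm (V x))\<^sup>2)"
proof -
  have [measurable]: "V \<in> borel_measurable borel"
    using cont by (rule borel_measurable_continuous_onI)
  define r where "r n = 1 / real (Suc n)" for n
  have r: "r n > 0" for n by (simp add: r_def)
  have r0: "r \<longlonglongrightarrow> 0" unfolding r_def by real_asymp
  define w where "w n \<omega> = exp (- (2 * pi * r n * norm \<omega>)\<^sup>2 / 2)" for n and \<omega> :: 'a
  have [measurable]: "w n \<in> borel_measurable borel" for n unfolding w_def by measurable
  show int2: "integrable lborel (\<lambda>x. (norm (V x))\<^sup>2)"
  proof (rule Bochner_Integration.integrable_bound)
    show "integrable lborel (\<lambda>x. M * norm (V x))" using V by simp
    show "AE x in lborel. norm ((norm (V x))\<^sup>2) \<le> norm (M * norm (V x))"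
    proof (rule AE_I2)
      fix x
      have "M \<ge> 0" using bd[of x] norm_ge_zero[of "V x"] by linarith
      then show "norm ((norm (V x))\<^sup>2) \<le> norm (M * norm (V x))"
        using bd[of x] by (simp add: power2_eq_square mult_right_mono)
    qed
  qed simp
  have lim: "(\<lambda>n. \<integral>x. V x * cnj (gauss_mean V (r n) x) \<partial>lborel)
      \<longlonglongrightarrow> (\<integral>x. V x * cnj (V x) \<partial>lborel)"
  proof (rule integral_dominated_convergence[where w = "\<lambda>x. M * norm (V x)"])
    show "AE x in lborel. (\<lambda>n. V x * cnj (gauss_mean V (r n) x)) \<longlonglongrightarrow> V x * cnj (V x)"
      by (intro AE_I2 tendsto_intros gauss_smoothing_tendsto[OF cont bd r0])
    show "AE x in lborel. norm (V x * cnj (gauss_mean V (r n) x)) \<le> M * norm (V x)" for n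
    proof (rule AE_I2)
      fix x
      have "norm (gauss_mean V (r n) x) \<le> (\<integral>v. norm (gauss v *\<^sub>R V (x + r n *\<^sub>R v)) \<partial>lborel)"
        by (rule integral_norm_bound)
      also have "\<dots> \<le> (\<integral>v. M * gauss (v :: 'a) \<partial>lborel)"
      proof (rule integral_mono_AE)
        show "integrable lborel (\<lambda>v. norm (gauss v *\<^sub>R V (x + r n *\<^sub>R v)))"
        proof (rule Bochner_Integration.integrable_bound[of _ "\<lambda>v. M * gauss v"])
          show "AE v in lborel. norm (norm (gauss v *\<^sub>R V (x + r n *\<^sub>R v))) \<le> norm (M * gauss v)"
            unfolding real_norm_def abs_norm_cancel
            by (intro AE_I2 order_trans[OF norm_gauss_scaleR_le[OF bd] abs_ge_self])
        qed auto
        show "AE v in lborel. norm (gauss v *\<^sub>R V (x + r n *\<^sub>R v)) \<le> M * gauss v"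
          by (intro AE_I2 norm_gauss_scaleR_le bd)
      qed simp
      also have "\<dots> = M" by (simp add: integral_gauss)
      finally show "norm (V x * cnj (gauss_mean V (r n) x)) \<le> M * norm (V x)"
        by (simp add: norm_mult mult.commute[of M] mult_left_mono)
    qed
  qed (use V in auto)
  have wint: "integrable lborel (\<lambda>\<omega>. w n \<omega> * (norm (ft V \<omega>))\<^sup>2)" for n
  proof (rule Bochner_Integration.integrable_bound)
    let ?c = "(\<integral>t. norm (V t) \<partial>lborel)\<^sup>2"
    have "integrable lborel (w n)"
      unfolding w_def using r[of n] by (intro integrable_exp_norm_square) simp
    then show "integrable lborel (\<lambda>\<omega>. ?c * w n \<omega>)" by simp
    show "AE \<omega> in lborel. norm (w n \<omega> * (norm (ft V \<omega>))\<^sup>2) \<le> norm (?c * w n \<omega>)"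
      using norm_ft_le[OF V] by (intro AE_I2) (auto simp: w_def mult.commute intro!: mult_right_mono power_mono)
  qed simp
  have eq: "(\<integral>x. V x * cnj (gauss_mean V (r n) x) \<partial>lborel)
     = complex_of_real (\<integral>\<omega>. w n \<omega> * (norm (ft V \<omega>))\<^sup>2 \<partial>lborel)" for n
    unfolding weighted_plancherel[OF V r, symmetric] integral_complex_of_real[symmetric]
    by (simp add: w_def scaleR_conv_of_real)
  have eq2: "(\<integral>x. V x * cnj (V x) \<partial>lborel) = complex_of_real (\<integral>x. (norm (V x))\<^sup>2 \<partial>lborel)"
    unfolding integral_complex_of_real[symmetric]
    by (intro Bochner_Integration.integral_cong refl) (simp only: complex_norm_square)
  have "(\<lambda>n. \<integral>\<omega>. w n \<omega> * (norm (ft V \<omega>))\<^sup>2 \<partial>lborel) \<longlonglongrightarrow> (\<integral>x. (norm (V x))\<^sup>2 \<partial>lborel)"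
    using lim unfolding eq eq2 by (simp only: tendsto_of_real_iff)
  then have l1: "(\<lambda>n. ennreal (\<integral>\<omega>. w n \<omega> * (norm (ft V \<omega>))\<^sup>2 \<partial>lborel)) \<longlonglongrightarrow> (\<integral>\<^sup>+x. sqn (V x) \<partial>lborel)"
    by (subst nn_integral_eq_integral[OF int2]) (auto intro!: tendsto_ennrealI)
  have "(\<integral>\<^sup>+\<omega>. ennreal (w n \<omega> * (norm (ft V \<omega>))\<^sup>2) \<partial>lborel) = ennreal (\<integral>\<omega>. w n \<omega> * (norm (ft V \<omega>))\<^sup>2 \<partial>lborel)" for n
    by (rule nn_integral_eq_integral[OF wint]) (simp add: w_def)
  moreover have "(\<lambda>n. \<integral>\<^sup>+\<omega>. ennreal (w n \<omega> * (norm (ft V \<omega>))\<^sup>2) \<partial>lborel) \<longlonglongrightarrow> (\<integral>\<^sup>+\<omega>. sqn (ft V \<omega>) \<partial>lborel)"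
  proof (rule nn_integral_LIMSEQ)
    show "incseq (\<lambda>n \<omega>. ennreal (w n \<omega> * (norm (ft V \<omega>))\<^sup>2))"
    proof (intro incseq_SucI le_funI ennreal_leI mult_right_mono)
      fix n \<omega>
      have "r (Suc n) \<le> r n" by (simp add: r_def frac_le)
      then show "w n \<omega> \<le> w (Suc n) \<omega>"
        using r[of "Suc n"] by (auto simp: w_def intro!: power_mono mult_right_mono)
    qed simp
    show "(\<lambda>n. ennreal (w n \<omega> * (norm (ft V \<omega>))\<^sup>2)) \<longlonglongrightarrow> sqn (ft V \<omega>)" for \<omega>
    proof -
      have "(\<lambda>n. exp (- (2 * pi * r n * norm \<omega>)\<^sup>2 / 2) * (norm (ft V \<omega>))\<^sup>2) \<longlonglongrightarrow> exp (- (2 * pi * 0 * norm \<omega>)\<^sup>2 / 2) * (norm (ft V \<omega>))\<^sup>2"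
        by (intro tendsto_intros r0) simp
      then show ?thesis unfolding w_def by (intro tendsto_ennrealI) simp
    qed
  qed simp
  ultimately show "(\<integral>\<^sup>+\<omega>. sqn (ft V \<omega>) \<partial>lborel) = (\<integral>\<^sup>+x. sqn (V x) \<partial>lborel)"
    using l1 by (simp add: LIMSEQ_unique)
qed

section \<open>Correlations\<close>

definition corr :: "('a::euclidean_space \<Rightarrow> complex) \<Rightarrow> ('a \<Rightarrow> complex) \<Rightarrow> 'a \<Rightarrow> complex" where
  "corr f g y = (\<integral>t. f t * cnj (g (t - y)) \<partial>lborel)"

lemma corr_eq:
  assumes [measurable]: "f \<in> borel_measurable borel" "g \<in> borel_measurable borel"
  shows "corr f g y = (\<integral>t. f (t + y) * cnj (g t) \<partial>lborel)"
  unfolding corr_def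
  by (subst integral_lborel_affine[where c = 1 and t = y]) (simp_all add: add.commute)

lemma isCont_of_cont_UNIV: "continuous_on UNIV f \<Longrightarrow> isCont f x"
  by (simp add: continuous_on_eq_continuous_at)

lemma corr_continuous_bounded:
  fixes f g :: "'a::euclidean_space \<Rightarrow> complex"
  assumes cont: "continuous_on UNIV f" and bd: "\<And>x. norm (f x) \<le> M" and g: "integrable lborel g"
  shows "continuous_on UNIV (corr f g)" and "norm (corr f g y) \<le> M * (\<integral>t. norm (g t) \<partial>lborel)"
proof -
  have [measurable]: "f \<in> borel_measurable borel"
    using cont by (rule borel_measurable_continuous_onI)
  have [measurable]: "g \<in> borel_measurable borel"
    using g borel_measurable_integrable by auto
  have le: "norm (f (t + y) * cnj (g t)) \<le> M * norm (g t)" for t y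
    using bd by (simp add: norm_mult mult_right_mono)
  show "continuous_on UNIV (corr f g)"
    unfolding continuous_on_sequentially
  proof (intro allI ballI impI)
    fix y :: "nat \<Rightarrow> 'a" and a
    assume "(\<forall>n. y n \<in> UNIV) \<and> y \<longlonglongrightarrow> a"
    then have y: "y \<longlonglongrightarrow> a" by simp
    have "(\<lambda>n. \<integral>t. f (t + y n) * cnj (g t) \<partial>lborel) \<longlonglongrightarrow> (\<integral>t. f (t + a) * cnj (g t) \<partial>lborel)"
    proof (rule integral_dominated_convergence[where w = "\<lambda>t. M * norm (g t)"])
      show "AE t in lborel. (\<lambda>n. f (t + y n) * cnj (g t)) \<longlonglongrightarrow> f (t + a) * cnj (g t)"
        by (intro AE_I2 tendsto_intros isCont_tendsto_compose[OF isCont_of_cont_UNIV[OF cont]] y)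
      show "AE t in lborel. norm (f (t + y n) * cnj (g t)) \<le> M * norm (g t)" for n
        by (intro AE_I2 le)
    qed (use g in auto)
    then show "(corr f g \<circ> y) \<longlonglongrightarrow> corr f g a"
      by (simp add: corr_eq o_def)
  qed
  have "norm (corr f g y) \<le> (\<integral>t. norm (f (t + y) * cnj (g t)) \<partial>lborel)"
    unfolding corr_eq[OF \<open>f \<in> _\<close> \<open>g \<in> _\<close>] by (rule integral_norm_bound)
  also have "\<dots> \<le> (\<integral>t. M * norm (g t) \<partial>lborel)"
  proof (rule integral_mono_AE)
    show "integrable lborel (\<lambda>t. norm (f (t + y) * cnj (g t)))"
    proof (rule Bochner_Integration.integrable_bound[of _ "\<lambda>t. M * norm (g t)"])
      show "AE t in lborel. norm (norm (f (t + y) * cnj (g t))) \<le> norm (M * norm (g t))"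
        unfolding real_norm_def abs_norm_cancel by (intro AE_I2 order_trans[OF le abs_ge_self])
    qed (use g in auto)
  qed (use g le in auto)
  finally show "norm (corr f g y) \<le> M * (\<integral>t. norm (g t) \<partial>lborel)" by simp
qed

text \<open>The correlation is the convolution of \<open>f\<close> with the conjugate reflection of \<open>g\<close>, hence
  the product formula.\<close>

lemma corr_integrable_ft:
  fixes f g :: "'a::euclidean_space \<Rightarrow> complex"
  assumes f: "integrable lborel f" and g: "integrable lborel g"
  shows "integrable lborel (corr f g)" and "ft (corr f g) \<omega> = ft f \<omega> * cnj (ft g \<omega>)"
proof -
  have [measurable]: "f \<in> borel_measurable borel" "g \<in> borel_measurable borel"
    using f g borel_measurable_integrable by auto
  have shift: "integrable lborel (\<lambda>y. f (t + y))" "(\<integral>y. norm (f (t + y)) \<partial>lborel) = (\<integral>y. norm (f y) \<partial>lborel)"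
    "(\<integral>y. f (t + y) * cis (- 2 * pi * ((t + y) \<bullet> \<omega>)) \<partial>lborel) = ft f \<omega>" for t
    using f integrable_lborel_affine[of f 1 t] integral_lborel_affine[of "\<lambda>y. norm (f y)" 1 t]
      integral_lborel_affine[of "\<lambda>y. f y * cis (- 2 * pi * (y \<bullet> \<omega>))" 1 t]
    by (simp_all add: ft_def)
  have pair: "integrable (lborel \<Otimes>\<^sub>M lborel) (\<lambda>(t, y). f (t + y) * cnj (g t))"
  proof (rule lborel_pair.Fubini_integrable)
    show "integrable lborel (\<lambda>t. \<integral>y. norm (case (t, y) of (t, y) \<Rightarrow> f (t + y) * cnj (g t)) \<partial>lborel)"
      using g by (simp add: norm_mult shift)
    show "AE t in lborel. integrable lborel (\<lambda>y. case (t, y) of (t, y) \<Rightarrow> f (t + y) * cnj (g t))"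
      using shift by (intro AE_I2) simp
  qed measurable
  have eq: "corr f g = (\<lambda>y. \<integral>t. f (t + y) * cnj (g t) \<partial>lborel)"
    by (rule ext) (simp add: corr_eq)
  show "integrable lborel (corr f g)"
    unfolding eq using lborel_pair.integrable_snd[OF pair] by simp
  let ?F = "\<lambda>t y. f (t + y) * cnj (g t) * cis (- 2 * pi * (y \<bullet> \<omega>))"
  have "integrable (lborel \<Otimes>\<^sub>M lborel) (case_prod ?F)"
    by (rule Bochner_Integration.integrable_bound[OF pair]) (auto simp: norm_mult)
  then have "(\<integral>y. (\<integral>t. ?F t y \<partial>lborel) \<partial>lborel) = (\<integral>t. (\<integral>y. ?F t y \<partial>lborel) \<partial>lborel)"
    by (rule lborel_pair.Fubini_integral)
  moreover have "(\<integral>t. ?F t y \<partial>lborel) = corr f g y * cis (- 2 * pi * (y \<bullet> \<omega>))" for y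
    unfolding eq by simp
  moreover have "(\<integral>y. ?F t y \<partial>lborel) = cnj (g t * cis (- 2 * pi * (t \<bullet> \<omega>))) * ft f \<omega>" for t
    unfolding shift(3)[of t, symmetric]
    by (subst integral_mult_right_zero[symmetric], intro Bochner_Integration.integral_cong refl)
       (simp add: cis_cnj cis_mult inner_add_left algebra_simps)
  moreover have "(\<integral>t. cnj (g t * cis (- 2 * pi * (t \<bullet> \<omega>))) * ft f \<omega> \<partial>lborel) = cnj (ft g \<omega>) * ft f \<omega>"
    unfolding ft_def[of g] by (simp only: integral_mult_left_zero Bochner_Integration.integral_cnj)
  ultimately show "ft (corr f g) \<omega> = ft f \<omega> * cnj (ft g \<omega>)"
    unfolding ft_def[of "corr f g"] by (simp only: mult.commute)
qed

lemma nn_integral_corr: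
  fixes f g :: "'a::euclidean_space \<Rightarrow> complex"
  assumes cont: "continuous_on UNIV f" and bd: "\<And>x. norm (f x) \<le> M" and f: "integrable lborel f"
    and g: "integrable lborel g"
  shows "(\<integral>\<^sup>+y. sqn (corr f g y) \<partial>lborel)
       = (\<integral>\<^sup>+\<omega>. sqn (ft f \<omega>) * sqn (ft g \<omega>) \<partial>lborel)"
proof -
  have "(\<integral>\<^sup>+y. sqn (corr f g y) \<partial>lborel) = (\<integral>\<^sup>+\<omega>. sqn (ft (corr f g) \<omega>) \<partial>lborel)"
    by (rule plancherel(1)[symmetric])
       (rule corr_continuous_bounded[OF cont bd g] corr_integrable_ft[OF f g])+
  then show ?thesis
    by (simp add: corr_integrable_ft[OF f g] norm_mult power_mult_distrib ennreal_mult)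
qed

lemma ft_modulate:
  "ft (\<lambda>t. cis (2 * pi * (\<beta> \<bullet> t)) * g t) \<omega> = ft g (\<omega> - \<beta>)"
  unfolding ft_def
  by (intro Bochner_Integration.integral_cong refl)
     (simp add: cis_mult inner_diff_right inner_commute algebra_simps)

lemma fourier_eq_ft:
  fixes g :: "real ^ 'm \<Rightarrow> complex"
  assumes [measurable]: "g \<in> borel_measurable borel"
  shows "fourier g = ft g"
  unfolding fourier_def ft_def by (intro ext integral_completion) measurable

lemma ex_borel_representative:
  fixes g :: "real ^ 'm \<Rightarrow> complex"
  assumes g: "g \<in> borel_measurable lebesgue"
  obtains h where "h \<in> borel_measurable borel" "AE t in lebesgue. g t = h t"
proof -
  have "(\<lambda>t. Re (g t)) \<in> borel_measurable (completion lborel)" "(\<lambda>t. Im (g t)) \<in> borel_measurable (completion lborel)"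
    using g by measurable
  from this[THEN completion_ex_borel_measurable_real] obtain u v where uv:
    "u \<in> borel_measurable lborel" "AE t in lborel. Re (g t) = u t"
    "v \<in> borel_measurable lborel" "AE t in lborel. Im (g t) = v t" by blast
  have "(\<lambda>t. complex_of_real (u t) + \<i> * complex_of_real (v t)) \<in> borel_measurable borel"
    using uv(1,3) by simp
  moreover have "AE t in lborel. g t = complex_of_real (u t) + \<i> * complex_of_real (v t)"
    using uv(2,4) by eventually_elim (simp add: complex_eq_iff)
  ultimately show ?thesis by (intro that) (auto intro: AE_completion)
qed

section \<open>Functions determined by Gaussian averages\<close>

abbreviation bump :: "real \<Rightarrow> 'a::euclidean_space \<Rightarrow> 'a \<Rightarrow> ennreal" where
  "bump r \<eta> \<omega> \<equiv> ennreal (gauss ((\<omega> - \<eta>) /\<^sub>R r))"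

lemma nn_integral_gauss_scaled:
  fixes \<eta> :: "'a::euclidean_space"
  assumes "r > 0"
  shows "(\<integral>\<^sup>+\<omega>. bump r \<eta> \<omega> \<partial>lborel) = ennreal (r ^ DIM('a))"
  using assms
  by (subst nn_integral_lborel_affine[where c = r and t = \<eta>]) (simp_all add: nn_integral_gauss)

text \<open>Average the hypothesis over all centres \<open>\<eta> \<in> A\<close> and normalize: the smoothed indicator
  \<open>h r\<close> of \<open>A\<close> has the same integral with respect to the density \<open>S\<close> as
  with respect to Lebesgue measure, namely the volume of \<open>A\<close>. For \<open>r \<rightarrow> 0\<close> it
  tends to at least \<open>1\<close> on the open set \<open>A\<close>, and Fatou's lemma gives the inequality.\<close>

lemma nn_integral_le_emeasure_open:
  fixes S :: "'a::euclidean_space \<Rightarrow> ennreal"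
  assumes [measurable]: "S \<in> borel_measurable borel"
    and eq: "\<And>r \<eta>. r > 0 \<Longrightarrow> (\<integral>\<^sup>+\<omega>. bump r \<eta> \<omega> * S \<omega> \<partial>lborel)
        = (\<integral>\<^sup>+\<omega>. bump r \<eta> \<omega> \<partial>lborel)"
    and A: "open A"
  shows "(\<integral>\<^sup>+\<omega>. S \<omega> * indicator A \<omega> \<partial>lborel) \<le> emeasure lborel A"
proof -
  have [measurable]: "A \<in> sets borel" using A by simp
  define h where "h r \<omega> = (\<integral>\<^sup>+v. ennreal (gauss v) * indicator A (\<omega> + r *\<^sub>R v) \<partial>lborel)" for r and \<omega> :: 'a
  have [measurable]: "h r \<in> borel_measurable borel" for r
    unfolding h_def by measurable
  have J: "(\<integral>\<^sup>+\<omega>. S \<omega> * h r \<omega> \<partial>lborel) = emeasure lborel A" if r: "r > 0" for r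
  proof -
    have h: "ennreal (r ^ DIM('a)) * h r \<omega> = (\<integral>\<^sup>+\<eta>. bump r \<eta> \<omega> * indicator A \<eta> \<partial>lborel)" for \<omega>
    proof -
      have "(\<integral>\<^sup>+\<eta>. bump r \<eta> \<omega> * indicator A \<eta> \<partial>lborel)
         = ennreal (\<bar>r\<bar> ^ DIM('a)) * (\<integral>\<^sup>+v. ennreal (gauss ((\<omega> - (\<omega> + r *\<^sub>R v)) /\<^sub>R r)) * indicator A (\<omega> + r *\<^sub>R v) \<partial>lborel)"
        using r by (intro nn_integral_lborel_affine) auto
      then show ?thesis using r by (simp add: h_def)
    qed
    have rD: "ennreal (r ^ DIM('a)) \<noteq> 0" "ennreal (r ^ DIM('a)) \<noteq> top"
      using r by (simp_all only: ennreal_eq_0_iff ennreal_neq_top not_le zero_less_power) simp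
    have "ennreal (r ^ DIM('a)) * (\<integral>\<^sup>+\<omega>. S \<omega> * h r \<omega> \<partial>lborel)
        = (\<integral>\<^sup>+\<omega>. S \<omega> * (ennreal (r ^ DIM('a)) * h r \<omega>) \<partial>lborel)"
      by (subst nn_integral_cmult[symmetric]) (auto simp: mult.left_commute)
    also have "\<dots> = (\<integral>\<^sup>+\<omega>. (\<integral>\<^sup>+\<eta>. S \<omega> * (bump r \<eta> \<omega> * indicator A \<eta>) \<partial>lborel) \<partial>lborel)"
      unfolding h by (subst nn_integral_cmult) auto
    also have "\<dots> = (\<integral>\<^sup>+\<eta>. (\<integral>\<^sup>+\<omega>. S \<omega> * (bump r \<eta> \<omega> * indicator A \<eta>) \<partial>lborel) \<partial>lborel)"
      by (rule lborel_pair.Fubini') measurable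
    also have "\<dots> = (\<integral>\<^sup>+\<eta>. ennreal (r ^ DIM('a)) * indicator A \<eta> \<partial>lborel)"
    proof (rule nn_integral_cong)
      fix \<eta>
      have "(\<integral>\<^sup>+\<omega>. S \<omega> * (bump r \<eta> \<omega> * indicator A \<eta>) \<partial>lborel)
          = (\<integral>\<^sup>+\<omega>. (bump r \<eta> \<omega> * S \<omega>) * indicator A \<eta> \<partial>lborel)"
        by (simp add: ac_simps)
      also have "\<dots> = ennreal (r ^ DIM('a)) * indicator A \<eta>"
        by (subst nn_integral_multc) (simp_all only: eq[OF r] nn_integral_gauss_scaled[OF r], measurable)
      finally show "(\<integral>\<^sup>+\<omega>. S \<omega> * (bump r \<eta> \<omega> * indicator A \<eta>) \<partial>lborel) = ennreal (r ^ DIM('a)) * indicator A \<eta>" .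
    qed
    also have "\<dots> = ennreal (r ^ DIM('a)) * emeasure lborel A"
      by (subst nn_integral_cmult_indicator) auto
    finally show ?thesis
      using rD by (simp only: ennreal_mult_cancel_left) auto
  qed
  define r where "r n = 1 / real (Suc n)" for n
  have r: "r n > 0" for n by (simp add: r_def)
  have r0: "r \<longlonglongrightarrow> 0" unfolding r_def by real_asymp
  have lb: "indicator A \<omega> \<le> liminf (\<lambda>n. h (r n) \<omega>)" for \<omega>
  proof (cases "\<omega> \<in> A")
    case True
    have "1 = (\<integral>\<^sup>+v. ennreal (gauss (v :: 'a)) \<partial>lborel)" by (simp add: nn_integral_gauss)
    also have "\<dots> = (\<integral>\<^sup>+v. liminf (\<lambda>n. ennreal (gauss v) * indicator A (\<omega> + r n *\<^sub>R v)) \<partial>lborel)"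
    proof (rule nn_integral_cong)
      fix v :: 'a
      have "(\<lambda>n. \<omega> + r n *\<^sub>R v) \<longlonglongrightarrow> \<omega> + 0 *\<^sub>R v" by (intro tendsto_intros r0)
      then have "\<forall>\<^sub>F n in sequentially. \<omega> + r n *\<^sub>R v \<in> A"
        using A True by (intro topological_tendstoD) auto
      then have "(\<lambda>n. ennreal (gauss v) * indicator A (\<omega> + r n *\<^sub>R v)) \<longlonglongrightarrow> ennreal (gauss v)"
        by (intro tendsto_eventually) (auto elim!: eventually_mono)
      then show "ennreal (gauss v) = liminf (\<lambda>n. ennreal (gauss v) * indicator A (\<omega> + r n *\<^sub>R v))"
        by (simp add: lim_imp_Liminf)
    qed
    also have "\<dots> \<le> liminf (\<lambda>n. h (r n) \<omega>)"
      unfolding h_def by (intro nn_integral_liminf) measurable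
    finally show ?thesis using True by simp
  qed simp
  \<comment> \<open>Fatou's lemma is applied to the measure with density \<open>S\<close>, so that \<open>S\<close> need not be moved out of a lower limit.\<close>
  let ?\<mu> = "density lborel S"
  have "(\<integral>\<^sup>+\<omega>. S \<omega> * indicator A \<omega> \<partial>lborel) = (\<integral>\<^sup>+\<omega>. indicator A \<omega> \<partial>?\<mu>)"
    by (rule nn_integral_density[symmetric]) auto
  also have "\<dots> \<le> (\<integral>\<^sup>+\<omega>. liminf (\<lambda>n. h (r n) \<omega>) \<partial>?\<mu>)"
    by (intro nn_integral_mono lb)
  also have "\<dots> \<le> liminf (\<lambda>n. \<integral>\<^sup>+\<omega>. h (r n) \<omega> \<partial>?\<mu>)"
    by (intro nn_integral_liminf) auto
  also have "\<dots> = liminf (\<lambda>n. \<integral>\<^sup>+\<omega>. S \<omega> * h (r n) \<omega> \<partial>lborel)"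
    by (subst nn_integral_density) auto
  also have "\<dots> = emeasure lborel A"
    by (simp add: J[OF r] Liminf_const)
  finally show ?thesis .
qed

text \<open>Outer regularity extends \<open>nn_integral_le_emeasure_open\<close> to Borel sets, so \<open>S \<le> 1\<close>
  almost everywhere. After that a single Gaussian suffices: \<open>1 - S\<close> is nonnegative and has integral
  \<open>0\<close> against a positive function.\<close>

lemma AE_eq_1_of_gaussian_averages:
  fixes S :: "'a::euclidean_space \<Rightarrow> ennreal"
  assumes [measurable]: "S \<in> borel_measurable borel"
    and eq: "\<And>r \<eta>. r > 0 \<Longrightarrow> (\<integral>\<^sup>+\<omega>. bump r \<eta> \<omega> * S \<omega> \<partial>lborel)
        = (\<integral>\<^sup>+\<omega>. bump r \<eta> \<omega> \<partial>lborel)"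
  shows "AE \<omega> in lborel. S \<omega> = 1"
proof -
  have le_borel: "(\<integral>\<^sup>+\<omega>. S \<omega> * indicator Z \<omega> \<partial>lborel) \<le> emeasure lborel Z" if [measurable]: "Z \<in> sets borel" for Z
  proof (rule ennreal_le_epsilon)
    fix e :: real assume "e > 0"
    then obtain U where U: "open U" "Z \<subseteq> U" "emeasure lborel (U - Z) < e"
      using outer_regular_lborel[OF \<open>Z \<in> sets borel\<close>] by blast
    have [measurable]: "U \<in> sets borel" using U by simp
    have "(\<integral>\<^sup>+\<omega>. S \<omega> * indicator Z \<omega> \<partial>lborel) \<le> (\<integral>\<^sup>+\<omega>. S \<omega> * indicator U \<omega> \<partial>lborel)"
      using U(2) by (intro nn_integral_mono) (auto simp: indicator_def)
    also have "\<dots> \<le> emeasure lborel U"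
      by (rule nn_integral_le_emeasure_open[OF _ eq U(1)]) auto
    also have "\<dots> = emeasure lborel Z + emeasure lborel (U - Z)"
      using U(2) by (subst plus_emeasure) (auto intro!: arg_cong[where f = "emeasure lborel"])
    also have "\<dots> \<le> emeasure lborel Z + e"
      using U(3) by (intro add_left_mono) auto
    finally show "(\<integral>\<^sup>+\<omega>. S \<omega> * indicator Z \<omega> \<partial>lborel) \<le> emeasure lborel Z + ennreal e" .
  qed
  have "AE \<omega> in lborel. \<omega> \<in> ball 0 (real n) \<longrightarrow> S \<omega> \<le> 1" for n
  proof -
    define Z where "Z = {\<omega> \<in> space borel. S \<omega> > 1} \<inter> ball 0 (real n)"
    have [measurable]: "Z \<in> sets borel" unfolding Z_def by measurable
    have fin: "emeasure lborel Z < top"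
      using emeasure_bounded_finite[of Z] bounded_subset[OF bounded_ball, of Z 0 "real n"] by (auto simp: Z_def)
    have "(\<integral>\<^sup>+\<omega>. (S \<omega> - 1) * indicator Z \<omega> \<partial>lborel) = (\<integral>\<^sup>+\<omega>. S \<omega> * indicator Z \<omega> - indicator Z \<omega> \<partial>lborel)"
      by (intro nn_integral_cong) (auto simp: indicator_def)
    also have "\<dots> = (\<integral>\<^sup>+\<omega>. S \<omega> * indicator Z \<omega> \<partial>lborel) - (\<integral>\<^sup>+\<omega>. indicator Z \<omega> \<partial>lborel)"
    proof (rule nn_integral_diff)
      show "(\<integral>\<^sup>+\<omega>. indicator Z \<omega> \<partial>lborel) \<noteq> \<infinity>"
        using fin by (subst nn_integral_indicator) auto
      show "AE \<omega> in lborel. indicator Z \<omega> \<le> S \<omega> * indicator Z \<omega>"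
        by (intro AE_I2) (auto simp: Z_def indicator_def)
    qed auto
    also have "\<dots> = 0"
    proof (rule diff_eq_0_ennreal)
      have Z: "(\<integral>\<^sup>+\<omega>. indicator Z \<omega> \<partial>lborel) = emeasure lborel Z"
        by (rule nn_integral_indicator) auto
      have "(\<integral>\<^sup>+\<omega>. S \<omega> * indicator Z \<omega> \<partial>lborel) \<le> emeasure lborel Z"
        by (rule le_borel) auto
      then show "(\<integral>\<^sup>+\<omega>. S \<omega> * indicator Z \<omega> \<partial>lborel) \<le> (\<integral>\<^sup>+\<omega>. indicator Z \<omega> \<partial>lborel)"
        "(\<integral>\<^sup>+\<omega>. S \<omega> * indicator Z \<omega> \<partial>lborel) < top"
        using fin unfolding Z by (auto intro: order_le_less_trans)
    qed
    finally have "(\<integral>\<^sup>+\<omega>. (S \<omega> - 1) * indicator Z \<omega> \<partial>lborel) = 0" .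
    then have "AE \<omega> in lborel. (S \<omega> - 1) * indicator Z \<omega> = 0"
      by (rule nn_integral_0_iff_AE[THEN iffD1, rotated]) measurable
    then show ?thesis
    proof eventually_elim
      case (elim \<omega>)
      show ?case
      proof (intro impI, rule ccontr)
        assume "\<omega> \<in> ball 0 (real n)" "\<not> S \<omega> \<le> 1"
        then have "\<omega> \<in> Z" by (simp add: Z_def not_le)
        with elim have "S \<omega> - 1 = 0" by simp
        with \<open>\<not> S \<omega> \<le> 1\<close> show False by (simp add: diff_eq_0_iff_ennreal)
      qed
    qed
  qed
  then have "AE \<omega> in lborel. \<forall>n. \<omega> \<in> ball 0 (real n) \<longrightarrow> S \<omega> \<le> 1"
    unfolding AE_all_countable by blast
  then have le1: "AE \<omega> in lborel. S \<omega> \<le> 1"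
  proof eventually_elim
    case (elim \<omega>)
    obtain n where "norm \<omega> < real n" using reals_Archimedean2 by blast
    then show ?case using elim[rule_format, of n] by simp
  qed
  have one: "(\<integral>\<^sup>+\<omega>. ennreal (gauss \<omega>) * S \<omega> \<partial>lborel) = 1"
    using eq[of 1 0] by (simp add: nn_integral_gauss)
  have "(\<integral>\<^sup>+\<omega>. ennreal (gauss \<omega>) - ennreal (gauss \<omega>) * S \<omega> \<partial>lborel)
      = (\<integral>\<^sup>+\<omega>. ennreal (gauss (\<omega> :: 'a)) \<partial>lborel) - (\<integral>\<^sup>+\<omega>. ennreal (gauss \<omega>) * S \<omega> \<partial>lborel)"
    using le1 one
    by (intro nn_integral_diff) (auto elim!: eventually_mono simp: mult_left_le)
  also have "\<dots> = 0" by (simp add: one nn_integral_gauss)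
  finally have "(\<integral>\<^sup>+\<omega>. ennreal (gauss \<omega>) - ennreal (gauss \<omega>) * S \<omega> \<partial>lborel) = 0" .
  then have "AE \<omega> in lborel. ennreal (gauss \<omega>) - ennreal (gauss \<omega>) * S \<omega> = 0"
    by (rule nn_integral_0_iff_AE[THEN iffD1, rotated]) measurable
  with le1 show ?thesis
  proof eventually_elim
    case (elim \<omega>)
    have "ennreal (gauss \<omega>) * 1 \<le> ennreal (gauss \<omega>) * S \<omega>"
      using elim(2) by (simp add: diff_eq_0_iff_ennreal)
    moreover have "ennreal (gauss \<omega>) \<noteq> 0" using gauss_pos[of \<omega>] by (simp only: ennreal_eq_0_iff not_le)
    ultimately have "1 \<le> S \<omega>"
      using ennreal_mult_le_mult_iff[OF _ ennreal_neq_top, of "gauss \<omega>" 1 "S \<omega>"] by blast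
    with elim(1) show ?case by (rule antisym)
  qed
qed

section \<open>Mean values of sums over a model set\<close>

abbreviation shifted_sum :: "(real ^ 'm) set \<Rightarrow> (real ^ 'm \<Rightarrow> ennreal) \<Rightarrow> real ^ 'm \<Rightarrow> ennreal" where
  "shifted_sum S F x \<equiv> (\<integral>\<^sup>+z. F (z - x) \<partial>count_space S)"

text \<open>Interchanging sum and integral turns the mean of a sum over \<open>\<Lambda>\<close> into an integral of
  \<open>F\<close> against point counts in cubes.\<close>

lemma nn_integral_model_mean:
  fixes \<Lambda> :: "(real ^ 'm) set" and F :: "real ^ 'm \<Rightarrow> ennreal"
  assumes \<Lambda>: "countable \<Lambda>" and F[measurable]: "F \<in> borel_measurable borel"
  shows "(\<integral>\<^sup>+x. (shifted_sum \<Lambda> F x) * indicator (cube 0 R) x \<partial>lborel)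
    = (\<integral>\<^sup>+y. F y * (cube_count \<Lambda> y R) \<partial>lborel)"
proof -
  have "(\<integral>\<^sup>+x. (shifted_sum \<Lambda> F x) * indicator (cube 0 R) x \<partial>lborel)
      = (\<integral>\<^sup>+x. (\<integral>\<^sup>+z. F (z - x) * indicator (cube 0 R) x \<partial>count_space \<Lambda>) \<partial>lborel)"
    by (simp add: nn_integral_multc)
  also have "\<dots> = (\<integral>\<^sup>+z. (\<integral>\<^sup>+x. F (z - x) * indicator (cube 0 R) x \<partial>lborel) \<partial>count_space \<Lambda>)"
    by (rule nn_integral_count_space_nn_integral) (use \<Lambda> in auto)
  also have "\<dots> = (\<integral>\<^sup>+z. (\<integral>\<^sup>+y. F y * indicator (cube y R) z \<partial>lborel) \<partial>count_space \<Lambda>)"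
  proof (rule nn_integral_cong)
    fix z
    have "(\<integral>\<^sup>+x. F (z - x) * indicator (cube 0 R) x \<partial>lborel)
        = (\<integral>\<^sup>+y. F (z - (z + (-1) *\<^sub>R y)) * indicator (cube 0 R) (z + (-1) *\<^sub>R y) \<partial>lborel)"
      by (subst nn_integral_lborel_affine[where c = "-1" and t = z]) auto
    also have "\<dots> = (\<integral>\<^sup>+y. F y * indicator (cube y R) z \<partial>lborel)"
      by (intro nn_integral_cong) (auto simp: indicator_def mem_cube algebra_simps)
    finally show "(\<integral>\<^sup>+x. F (z - x) * indicator (cube 0 R) x \<partial>lborel) = (\<integral>\<^sup>+y. F y * indicator (cube y R) z \<partial>lborel)" .
  qed
  also have "\<dots> = (\<integral>\<^sup>+y. (\<integral>\<^sup>+z. F y * indicator (cube y R) z \<partial>count_space \<Lambda>) \<partial>lborel)"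
  proof (rule nn_integral_count_space_nn_integral[symmetric, OF \<Lambda>])
    fix z
    have "(\<lambda>y. F y * indicator (cube 0 R) (z - y)) \<in> borel_measurable lborel" by measurable
    moreover have "indicator (cube 0 R) (z - y) = (indicator (cube y R) z :: ennreal)" for y
      by (auto simp: indicator_def mem_cube algebra_simps)
    ultimately show "(\<lambda>y. F y * indicator (cube y R) z) \<in> borel_measurable lborel" by simp
  qed
  also have "\<dots> = (\<integral>\<^sup>+y. F y * (cube_count \<Lambda> y R) \<partial>lborel)"
    by (simp add: nn_integral_cmult)
  finally show ?thesis .
qed

lemma model_mean_bounds:
  fixes \<Lambda> :: "(real ^ 'm) set"
  assumes \<Lambda>: "countable \<Lambda>" and D: "has_uniform_density \<Lambda> D" and e: "\<epsilon> > 0"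
  obtains R0 where "R0 > 0"
   "\<And>R F. R \<ge> R0 \<Longrightarrow> F \<in> borel_measurable borel \<Longrightarrow>
       ennreal ((D - \<epsilon>) * R ^ CARD('m)) * (\<integral>\<^sup>+y. F y \<partial>lborel)
         \<le> (\<integral>\<^sup>+x. (shifted_sum \<Lambda> F x) * indicator (cube 0 R) x \<partial>lborel)"
   "\<And>R F. R \<ge> R0 \<Longrightarrow> F \<in> borel_measurable borel \<Longrightarrow>
       (\<integral>\<^sup>+x. (shifted_sum \<Lambda> F x) * indicator (cube 0 R) x \<partial>lborel)
         \<le> ennreal ((D + \<epsilon>) * R ^ CARD('m)) * (\<integral>\<^sup>+y. F y \<partial>lborel)"
proof -
  obtain R0 where R0: "R0 > 0" "\<And>R y. R \<ge> R0 \<Longrightarrow>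
        ennreal ((D - \<epsilon>) * R ^ CARD('m)) \<le> (cube_count \<Lambda> y R) \<and>
        (cube_count \<Lambda> y R) \<le> ennreal ((D + \<epsilon>) * R ^ CARD('m))"
    using D e unfolding has_uniform_density_def by blast
  show ?thesis
  proof (rule that[OF R0(1)])
    fix R and F :: "real ^ 'm \<Rightarrow> ennreal"
    assume R: "R \<ge> R0" and [measurable]: "F \<in> borel_measurable borel"
    have "ennreal ((D - \<epsilon>) * R ^ CARD('m)) * (\<integral>\<^sup>+y. F y \<partial>lborel) = (\<integral>\<^sup>+y. F y * ennreal ((D - \<epsilon>) * R ^ CARD('m)) \<partial>lborel)"
      by (subst nn_integral_multc) (auto simp: mult.commute)
    also have "\<dots> \<le> (\<integral>\<^sup>+y. F y * (cube_count \<Lambda> y R) \<partial>lborel)"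
      using R0(2)[OF R] by (intro nn_integral_mono mult_left_mono) auto
    finally show "ennreal ((D - \<epsilon>) * R ^ CARD('m)) * (\<integral>\<^sup>+y. F y \<partial>lborel)
         \<le> (\<integral>\<^sup>+x. (shifted_sum \<Lambda> F x) * indicator (cube 0 R) x \<partial>lborel)"
      by (subst nn_integral_model_mean[OF \<Lambda>]) auto
    have "(\<integral>\<^sup>+y. F y * (cube_count \<Lambda> y R) \<partial>lborel)
       \<le> (\<integral>\<^sup>+y. F y * ennreal ((D + \<epsilon>) * R ^ CARD('m)) \<partial>lborel)"
      using R0(2)[OF R] by (intro nn_integral_mono mult_left_mono) auto
    also have "\<dots> = ennreal ((D + \<epsilon>) * R ^ CARD('m)) * (\<integral>\<^sup>+y. F y \<partial>lborel)"
      by (subst nn_integral_multc) (auto simp: mult.commute)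
    finally show "(\<integral>\<^sup>+x. (shifted_sum \<Lambda> F x) * indicator (cube 0 R) x \<partial>lborel)
         \<le> ennreal ((D + \<epsilon>) * R ^ CARD('m)) * (\<integral>\<^sup>+y. F y \<partial>lborel)"
      by (subst nn_integral_model_mean[OF \<Lambda>]) auto
  qed
qed

lemma nn_integral_const_cube:
  "0 \<le> R \<Longrightarrow> 0 \<le> E \<Longrightarrow> (\<integral>\<^sup>+x. ennreal E * indicator (cube (0 :: real ^ 'm) R) x \<partial>lborel) = ennreal (E * R ^ CARD('m))"
  by (simp add: nn_integral_cmult_indicator emeasure_cube ennreal_mult)

text \<open>Two point sets are treated at once because the recurrence argument adds to a sum over one model set a term that
  records the nearby points of another one.\<close>

lemma model_mean_le:
  fixes \<Lambda> \<Lambda>' :: "(real ^ 'm) set"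
  assumes \<Lambda>: "countable \<Lambda>" "has_uniform_density \<Lambda> D" "D > 0"
    and \<Lambda>': "countable \<Lambda>'" "has_uniform_density \<Lambda>' D'" "D' > 0"
    and [measurable]: "F \<in> borel_measurable borel" "F' \<in> borel_measurable borel" and E: "0 \<le> E"
    and le: "\<And>x. (shifted_sum \<Lambda> F x) + (shifted_sum \<Lambda>' F' x) \<le> ennreal E"
  shows "ennreal D * (\<integral>\<^sup>+y. F y \<partial>lborel) + ennreal D' * (\<integral>\<^sup>+y. F' y \<partial>lborel) \<le> ennreal E"
proof -
  let ?I = "\<integral>\<^sup>+y. F y \<partial>lborel" and ?I' = "\<integral>\<^sup>+y. F' y \<partial>lborel"
  have key: "ennreal (D - \<epsilon>) * ?I + ennreal (D' - \<epsilon>) * ?I' \<le> ennreal E"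
    if e: "0 < \<epsilon>" "\<epsilon> < D" "\<epsilon> < D'" for \<epsilon>
  proof -
    obtain R0 where R0: "R0 > 0" "\<And>R F. R \<ge> R0 \<Longrightarrow> F \<in> borel_measurable borel \<Longrightarrow>
       ennreal ((D - \<epsilon>) * R ^ CARD('m)) * (\<integral>\<^sup>+y. F y \<partial>lborel)
         \<le> (\<integral>\<^sup>+x. (shifted_sum \<Lambda> F x) * indicator (cube 0 R) x \<partial>lborel)"
      by (rule model_mean_bounds[OF \<Lambda>(1,2) e(1)]) (rule that, assumption+)
    obtain R1 where R1: "R1 > 0" "\<And>R F. R \<ge> R1 \<Longrightarrow> F \<in> borel_measurable borel \<Longrightarrow>
       ennreal ((D' - \<epsilon>) * R ^ CARD('m)) * (\<integral>\<^sup>+y. F y \<partial>lborel)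
         \<le> (\<integral>\<^sup>+x. (shifted_sum \<Lambda>' F x) * indicator (cube 0 R) x \<partial>lborel)"
      by (rule model_mean_bounds[OF \<Lambda>'(1,2) e(1)]) (rule that, assumption+)
    define R where "R = max R0 R1"
    have R: "R > 0" "R \<ge> R0" "R \<ge> R1" using R0(1) by (auto simp: R_def)
    let ?r = "R ^ CARD('m)"
    have r: "?r > 0" using R by simp
    have "ennreal ?r * (ennreal (D - \<epsilon>) * ?I + ennreal (D' - \<epsilon>) * ?I')
        = ennreal ((D - \<epsilon>) * ?r) * ?I + ennreal ((D' - \<epsilon>) * ?r) * ?I'"
      using e r by (simp add: ennreal_mult distrib_left ac_simps)
    also have "\<dots> \<le> (\<integral>\<^sup>+x. (shifted_sum \<Lambda> F x) * indicator (cube 0 R) x \<partial>lborel)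
        + (\<integral>\<^sup>+x. (shifted_sum \<Lambda>' F' x) * indicator (cube 0 R) x \<partial>lborel)"
      using R by (intro add_mono R0(2) R1(2)) auto
    also have "\<dots> = (\<integral>\<^sup>+x. ((shifted_sum \<Lambda> F x) + (shifted_sum \<Lambda>' F' x)) * indicator (cube 0 R) x \<partial>lborel)"
      by (subst nn_integral_add[symmetric])
         (auto simp: distrib_right intro!: borel_measurable_times_ennreal borel_measurable_nn_integral_countable \<Lambda>(1) \<Lambda>'(1))
    also have "\<dots> \<le> (\<integral>\<^sup>+x. ennreal E * indicator (cube (0 :: real ^ 'm) R) x \<partial>lborel)"
      by (intro nn_integral_mono mult_right_mono le) auto
    also have "\<dots> = ennreal ?r * ennreal E"
      using R E by (simp add: nn_integral_const_cube ennreal_mult mult.commute)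
    finally have *: "ennreal ?r * (ennreal (D - \<epsilon>) * ?I + ennreal (D' - \<epsilon>) * ?I') \<le> ennreal ?r * ennreal E" .
    have r0: "ennreal ?r \<noteq> 0" using r by (simp only: ennreal_eq_0_iff not_le)
    show ?thesis using * unfolding ennreal_mult_le_mult_iff[OF r0 ennreal_neq_top] .
  qed
  have fin: "?I < top" "?I' < top"
  proof -
    define \<epsilon> where "\<epsilon> = min D D' / 2"
    have e: "0 < \<epsilon>" "\<epsilon> < D" "\<epsilon> < D'" using \<Lambda>(3) \<Lambda>'(3) by (auto simp: \<epsilon>_def min_def)
    have "ennreal (D - \<epsilon>) * ?I + ennreal (D' - \<epsilon>) * ?I' < top"
      using key[OF e] ennreal_less_top by (rule order_le_less_trans)
    then show "?I < top" "?I' < top" using e by (auto simp: ennreal_mult_less_top)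
  qed
  define i i' where "i = enn2real ?I" and "i' = enn2real ?I'"
  have I: "?I = ennreal i" "?I' = ennreal i'" "i \<ge> 0" "i' \<ge> 0"
    using fin by (simp_all add: i_def i'_def)
  have lim: "((\<lambda>\<epsilon>. (D - \<epsilon>) * i + (D' - \<epsilon>) * i') \<longlongrightarrow> (D - 0) * i + (D' - 0) * i') (at_right 0)"
    by (intro tendsto_intros)
  have "\<forall>\<^sub>F \<epsilon> in at_right 0. (D - \<epsilon>) * i + (D' - \<epsilon>) * i' \<le> E"
  proof -
    have "(D - \<epsilon>) * i + (D' - \<epsilon>) * i' \<le> E" if e: "0 < \<epsilon>" "\<epsilon> < min D D'" for \<epsilon>
      using key[of \<epsilon>] e I E by (simp add: ennreal_mult[symmetric] ennreal_plus[symmetric] del: ennreal_plus)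
    then show ?thesis unfolding eventually_at_right_field
      using \<Lambda>(3) \<Lambda>'(3) by (intro exI[of _ "min D D'"]) auto
  qed
  from tendsto_upperbound[OF lim this] have "D * i + D' * i' \<le> E" by simp
  then show ?thesis
    using I \<Lambda>(3) \<Lambda>'(3) E by (simp add: ennreal_mult[symmetric] ennreal_plus[symmetric] del: ennreal_plus)
qed

lemma model_mean_eq:
  fixes \<Lambda> :: "(real ^ 'm) set"
  assumes \<Lambda>: "countable \<Lambda>" "has_uniform_density \<Lambda> D" "D > 0"
    and [measurable]: "F \<in> borel_measurable borel" and E: "0 \<le> E"
    and eq: "\<And>x. (shifted_sum \<Lambda> F x) = ennreal E"
  shows "ennreal D * (\<integral>\<^sup>+y. F y \<partial>lborel) = ennreal E"
proof (rule antisym)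
  let ?I = "\<integral>\<^sup>+y. F y \<partial>lborel"
  show le: "ennreal D * ?I \<le> ennreal E"
    using model_mean_le[OF \<Lambda> \<Lambda>, of F "\<lambda>_. 0" E] eq E by simp
  have "ennreal D * ?I < top"
    using le ennreal_less_top by (rule order_le_less_trans)
  then have "?I < top" using \<Lambda>(3) by (auto simp: ennreal_mult_less_top)
  then obtain i where I: "?I = ennreal i" "i \<ge> 0"
    by (cases ?I) auto
  have "E \<le> (D + \<epsilon>) * i" if e: "\<epsilon> > 0" for \<epsilon>
  proof -
    obtain R0 where R0: "R0 > 0" "\<And>R F. R \<ge> R0 \<Longrightarrow> F \<in> borel_measurable borel \<Longrightarrow>
       (\<integral>\<^sup>+x. (shifted_sum \<Lambda> F x) * indicator (cube 0 R) x \<partial>lborel)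
         \<le> ennreal ((D + \<epsilon>) * R ^ CARD('m)) * (\<integral>\<^sup>+y. F y \<partial>lborel)"
      by (rule model_mean_bounds[OF \<Lambda>(1,2) e]) (rule that, assumption+)
    obtain R where R: "R > 0" "(\<integral>\<^sup>+x. (shifted_sum \<Lambda> F x) * indicator (cube 0 R) x \<partial>lborel)
         \<le> ennreal ((D + \<epsilon>) * R ^ CARD('m)) * ?I"
      using R0(1) R0(2)[of R0 F] assms(4) by auto
    have "ennreal (E * R ^ CARD('m)) \<le> ennreal ((D + \<epsilon>) * R ^ CARD('m) * i)"
      using R(2) R(1) E e \<Lambda>(3) I unfolding eq by (simp add: nn_integral_const_cube ennreal_mult)
    then have "E * R ^ CARD('m) \<le> ((D + \<epsilon>) * i) * R ^ CARD('m)"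
      using R(1) e \<Lambda>(3) I by (subst (asm) ennreal_le_iff) (auto simp: ac_simps)
    then show ?thesis using R(1) by simp
  qed
  then have ev: "\<forall>\<^sub>F \<epsilon> in at_right 0. E \<le> (D + \<epsilon>) * i"
    by (auto simp: eventually_at_right_field intro!: exI[of _ 1])
  have "((\<lambda>\<epsilon>. (D + \<epsilon>) * i) \<longlongrightarrow> (D + 0) * i) (at_right 0)"
    by (intro tendsto_intros)
  from tendsto_lowerbound[OF this ev] have "E \<le> D * i" by simp
  then show "ennreal E \<le> ennreal D * ?I"
    using I \<Lambda>(3) by (simp add: ennreal_mult[symmetric] ennreal_leI)
qed

section \<open>Recurrence of low values\<close>

lemma nn_integral_lattice_shift_add:
  assumes "is_lattice \<Gamma>" "\<gamma>0 \<in> \<Gamma>"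
  shows "(\<integral>\<^sup>+\<gamma>. f (\<gamma> + \<gamma>0) \<partial>count_space \<Gamma>) = (\<integral>\<^sup>+\<gamma>. f \<gamma> \<partial>count_space \<Gamma>)"
  using nn_integral_lattice_shift[OF assms(1) lattice_uminus[OF assms]] by simp

abbreviation window_sum ::
    "((real ^ 'm) \<times> real) set \<Rightarrow> (real ^ 'm \<Rightarrow> ennreal) \<Rightarrow> real set \<Rightarrow> ennreal" where
  "window_sum \<Gamma> W \<Omega> \<equiv> (\<integral>\<^sup>+\<gamma>. W (fst \<gamma>) * indicator \<Omega> (snd \<gamma>) \<partial>count_space \<Gamma>)"

text \<open>An interval is compact, and the translates of the interior of another one by a dense set cover the line.\<close>

lemma finite_interval_cover:
  fixes \<Gamma> :: "('a \<times> real) set"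
  assumes dense: "closure (snd ` \<Gamma>) = UNIV" and ab: "a < b"
  obtains G where "finite G" "G \<subseteq> \<Gamma>" "\<And>s. s \<in> {c..d} \<Longrightarrow> \<exists>\<gamma>\<in>G. s - snd \<gamma> \<in> {a..b}"
proof -
  have cov: "{c..d} \<subseteq> (\<Union>\<gamma>\<in>\<Gamma>. {snd \<gamma> + a<..<snd \<gamma> + b})"
  proof
    fix s :: real
    have "(s - b + (s - a)) / 2 \<in> closure (snd ` \<Gamma>)" using dense by simp
    then obtain \<gamma> where \<gamma>: "\<gamma> \<in> \<Gamma>" "dist (snd \<gamma>) ((s - b + (s - a)) / 2) < (b - a) / 2"
      using ab unfolding closure_approachable by (metis diff_gt_0_iff_gt half_gt_zero imageE)
    then have "\<bar>snd \<gamma> - (s - b + (s - a)) / 2\<bar> < (b - a) / 2" by (simp only: dist_real_def)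
    then have "s \<in> {snd \<gamma> + a<..<snd \<gamma> + b}" unfolding abs_less_iff by (auto simp: field_simps)
    then show "s \<in> (\<Union>\<gamma>\<in>\<Gamma>. {snd \<gamma> + a<..<snd \<gamma> + b})" using \<gamma>(1) by blast
  qed
  have op: "open {snd \<gamma> + a<..<snd \<gamma> + b}" if "\<gamma> \<in> \<Gamma>" for \<gamma> by simp
  obtain G where G: "G \<subseteq> \<Gamma>" "finite G" "{c..d} \<subseteq> (\<Union>\<gamma>\<in>G. {snd \<gamma> + a<..<snd \<gamma> + b})"
    by (rule compactE_image[OF compact_Icc op cov]) (assumption, rule that, assumption+)
  have "\<exists>\<gamma>\<in>G. s - snd \<gamma> \<in> {a..b}" if "s \<in> {c..d}" for s
  proof -
    obtain \<gamma> where "\<gamma> \<in> G" "s \<in> {snd \<gamma> + a<..<snd \<gamma> + b}" using G(3) \<open>s \<in> {c..d}\<close> by blast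
    then show ?thesis by (intro bexI[of _ \<gamma>]) auto
  qed
  then show ?thesis using G(1,2) by (intro that[of G])
qed

text \<open>The enlarged window is covered by finitely many translates of the original one by second coordinates of lattice
  points. Translating by a lattice point turns the sum over such a window into a value of the original sum at
  another point.\<close>

lemma model_sum_enlarged_finite:
  fixes \<Gamma> :: "((real ^ 'm) \<times> real) set" and W :: "real ^ 'm \<Rightarrow> ennreal"
  assumes lat: "is_lattice \<Gamma>" and dense: "closure (snd ` \<Gamma>) = UNIV" and ab: "a < b"
    and bound: "\<And>x. (\<integral>\<^sup>+\<gamma>. W (fst \<gamma> - x) * indicator {a..b} (snd \<gamma>) \<partial>count_space \<Gamma>) \<le> ennreal E"
  shows "(window_sum \<Gamma> W {c..d}) < top"
proof -
  obtain G where G: "finite G" "G \<subseteq> \<Gamma>" "\<And>s. s \<in> {c..d} \<Longrightarrow> \<exists>\<gamma>\<in>G. s - snd \<gamma> \<in> {a..b}"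
    by (rule finite_interval_cover[OF dense ab, where c = c and d = d]) (rule that, assumption+)
  have "(window_sum \<Gamma> W {c..d})
      \<le> (\<integral>\<^sup>+\<gamma>. (\<Sum>\<gamma>0\<in>G. W (fst \<gamma>) * indicator {a..b} (snd \<gamma> - snd \<gamma>0)) \<partial>count_space \<Gamma>)"
  proof (rule nn_integral_mono)
    fix \<gamma>
    show "W (fst \<gamma>) * indicator {c..d} (snd \<gamma>) \<le> (\<Sum>\<gamma>0\<in>G. W (fst \<gamma>) * indicator {a..b} (snd \<gamma> - snd \<gamma>0))"
    proof (cases "snd \<gamma> \<in> {c..d}")
      case True
      then obtain \<gamma>0 where g: "\<gamma>0 \<in> G" "snd \<gamma> - snd \<gamma>0 \<in> {a..b}" using G(3) by blast
      then have "W (fst \<gamma>) * indicator {c..d} (snd \<gamma>) = W (fst \<gamma>) * indicator {a..b} (snd \<gamma> - snd \<gamma>0)"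
        using True by simp
      also have "\<dots> \<le> (\<Sum>\<gamma>0\<in>G. W (fst \<gamma>) * indicator {a..b} (snd \<gamma> - snd \<gamma>0))"
        using g(1) G(1) by (intro member_le_sum) auto
      finally show ?thesis .
    qed simp
  qed
  also have "\<dots> = (\<Sum>\<gamma>0\<in>G. \<integral>\<^sup>+\<gamma>. W (fst \<gamma>) * indicator {a..b} (snd \<gamma> - snd \<gamma>0) \<partial>count_space \<Gamma>)"
    by (rule nn_integral_sum) simp
  also have "\<dots> \<le> (\<Sum>\<gamma>0\<in>G. ennreal E)"
  proof (rule sum_mono)
    fix \<gamma>0 assume "\<gamma>0 \<in> G"
    then have g: "\<gamma>0 \<in> \<Gamma>" using G(2) by blast
    have "(\<integral>\<^sup>+\<gamma>. W (fst \<gamma>) * indicator {a..b} (snd \<gamma> - snd \<gamma>0) \<partial>count_space \<Gamma>)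
        = (\<integral>\<^sup>+\<gamma>. W (fst \<gamma> - (- fst \<gamma>0)) * indicator {a..b} (snd \<gamma>) \<partial>count_space \<Gamma>)"
      using nn_integral_lattice_shift_add[OF lat g, of "\<lambda>\<gamma>. W (fst \<gamma>) * indicator {a..b} (snd \<gamma> - snd \<gamma>0)"] by simp
    also have "\<dots> \<le> ennreal E" by (rule bound)
    finally show "(\<integral>\<^sup>+\<gamma>. W (fst \<gamma>) * indicator {a..b} (snd \<gamma> - snd \<gamma>0) \<partial>count_space \<Gamma>) \<le> ennreal E" .
  qed
  also have "\<dots> = ennreal (real (card G)) * ennreal E"
    by (simp add: ennreal_of_nat_eq_real_of_nat)
  also have "\<dots> < top" by (simp add: ennreal_mult_less_top)
  finally show ?thesis .
qed

text \<open>The sets \<open>[a - \<delta>, b + \<delta>] - [a, b]\<close> decrease to the empty set because the window is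
  closed, and the sums are dominated by a finite one.\<close>

lemma model_sum_boundary_small:
  fixes \<Gamma> :: "((real ^ 'm) \<times> real) set" and W :: "real ^ 'm \<Rightarrow> ennreal"
  assumes fin: "(window_sum \<Gamma> W {a - 1..b + 1}) < top" and \<epsilon>: "\<epsilon> > 0"
  obtains \<delta> where "\<delta> > 0"
    "(window_sum \<Gamma> W ({a - \<delta>..b + \<delta>} - {a..b})) < ennreal \<epsilon>"
proof -
  define r where "r n = 1 / real (Suc n)" for n
  have r: "r n > 0" "r n \<le> 1" for n by (simp_all add: r_def)
  have r0: "r \<longlonglongrightarrow> 0" unfolding r_def by real_asymp
  have "(\<lambda>n. \<integral>\<^sup>+\<gamma>. W (fst \<gamma>) * indicator ({a - r n..b + r n} - {a..b}) (snd \<gamma>) \<partial>count_space \<Gamma>)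
      \<longlonglongrightarrow> (\<integral>\<^sup>+\<gamma>. 0 \<partial>count_space \<Gamma>)"
  proof (rule nn_integral_dominated_convergence[where w = "\<lambda>\<gamma>. W (fst \<gamma>) * indicator {a - 1..b + 1} (snd \<gamma>)"])
    show "AE \<gamma> in count_space \<Gamma>. W (fst \<gamma>) * indicator ({a - r n..b + r n} - {a..b}) (snd \<gamma>)
        \<le> W (fst \<gamma>) * indicator {a - 1..b + 1} (snd \<gamma>)" for n
      using r[of n] by (intro AE_I2 mult_left_mono) (auto simp: indicator_def)
    show "AE \<gamma> in count_space \<Gamma>. (\<lambda>n. W (fst \<gamma>) * indicator ({a - r n..b + r n} - {a..b}) (snd \<gamma>)) \<longlonglongrightarrow> 0"
    proof (rule AE_I2)
      fix \<gamma> :: "(real ^ 'm) \<times> real"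
      have "\<forall>\<^sub>F n in sequentially. snd \<gamma> \<notin> {a - r n..b + r n} - {a..b}"
      proof (cases "snd \<gamma> \<in> {a..b}")
        case False
        define e where "e = (if snd \<gamma> < a then a - snd \<gamma> else snd \<gamma> - b)"
        have "e > 0" using False by (auto simp: e_def)
        with r0 have "\<forall>\<^sub>F n in sequentially. r n < e" by (rule order_tendstoD)
        then show ?thesis by eventually_elim (auto simp: e_def split: if_splits)
      qed simp
      then have "\<forall>\<^sub>F n in sequentially. W (fst \<gamma>) * indicator ({a - r n..b + r n} - {a..b}) (snd \<gamma>) = 0"
        by eventually_elim (simp only: indicator_simps(2) mult_zero_right not_False_eq_True)
      then show "(\<lambda>n. W (fst \<gamma>) * indicator ({a - r n..b + r n} - {a..b}) (snd \<gamma>)) \<longlonglongrightarrow> 0"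
        by (rule tendsto_eventually)
    qed
  qed (use fin in auto)
  then have "\<forall>\<^sub>F n in sequentially. (window_sum \<Gamma> W ({a - r n..b + r n} - {a..b})) < ennreal \<epsilon>"
    using \<epsilon> by (intro order_tendstoD(2)[where y = 0]) auto
  then obtain n where "(window_sum \<Gamma> W ({a - r n..b + r n} - {a..b})) < ennreal \<epsilon>"
    by (auto simp: eventually_sequentially)
  then show ?thesis by (intro that[of "r n"] r)
qed

text \<open>A nonnegative function \<open>E - N\<close> with mean value \<open>0\<close> can exceed a given positive
  constant only on a set of density \<open>0\<close>. The shifts by first coordinates of lattice points with
  second coordinate in \<open>[-\<delta>, \<delta>]\<close> enlarge the window by at most \<open>\<delta>\<close>,
  hence increase \<open>N\<close> at \<open>0\<close> only slightly; \<open>quasi\<close> spreads the resulting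
  bound to neighbourhoods of fixed size. As these shifts form a model set of positive density, a deficit at
  \<open>0\<close> contradicts the mean value \<open>E\<close>. The factor \<open>1 + \<alpha>\<close> in
  \<open>quasi\<close> replaces a triangle inequality for the square root of \<open>N\<close>.\<close>

lemma model_sum_attains_mean:
  fixes \<Gamma> :: "((real ^ 'm) \<times> real) set" and W :: "real ^ 'm \<Rightarrow> ennreal"
  defines "N \<equiv> \<lambda>a b x. \<integral>\<^sup>+z. W (z - x) \<partial>count_space (model_set \<Gamma> {a..b})"
  assumes cp: "cut_and_project \<Gamma>" and ab: "a < b"
    and p: "p > 0" "\<And>a b. a < b \<Longrightarrow> has_uniform_density (model_set \<Gamma> {a..b}) ((b - a) / p)"
    and W[measurable]: "W \<in> borel_measurable borel" and E: "0 \<le> E"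
    and bound: "\<And>x. N a b x \<le> ennreal E"
    and mean: "ennreal ((b - a) / p) * (\<integral>\<^sup>+y. W y \<partial>lborel) = ennreal E"
    and quasi: "\<And>\<alpha> \<eta>. 0 < \<alpha> \<Longrightarrow> 0 < \<eta> \<Longrightarrow>
      \<exists>\<rho>>0. \<forall>x y. norm y < \<rho> \<longrightarrow> N a b (x + y) \<le> ennreal (1 + \<alpha>) * N a b x + ennreal \<eta>"
  shows "N a b 0 = ennreal E"
proof (rule ccontr)
  have lat: "is_lattice \<Gamma>" and inj: "inj_on fst \<Gamma>" and dense: "closure (snd ` \<Gamma>) = UNIV"
    using cp by (auto simp: cut_and_project_def)
  have cnt: "countable (model_set \<Gamma> \<Omega>)" for \<Omega>
    by (intro countable_model_set countable_lattice lat)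
  have N: "N a b x = (\<integral>\<^sup>+\<gamma>. W (fst \<gamma> - x) * indicator {a..b} (snd \<gamma>) \<partial>count_space \<Gamma>)" for x
    unfolding N_def by (rule nn_integral_model_set[OF inj])
  assume "N a b 0 \<noteq> ennreal E"
  with bound[of 0] have less: "N a b 0 < ennreal E" by simp
  then obtain n0 where n0: "N a b 0 = ennreal n0" "0 \<le> n0"
    by (cases "N a b 0") auto
  define \<epsilon> where "\<epsilon> = E - n0"
  have \<epsilon>: "\<epsilon> > 0" "E > 0" using less n0 by (auto simp: \<epsilon>_def ennreal_less_iff)
  have fin: "(window_sum \<Gamma> W {a - 1..b + 1}) < top"
    by (rule model_sum_enlarged_finite[OF lat dense ab bound[unfolded N]])
  obtain \<delta> where \<delta>: "\<delta> > 0"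
    "(window_sum \<Gamma> W ({a - \<delta>..b + \<delta>} - {a..b})) < ennreal (\<epsilon> / 4)"
    using model_sum_boundary_small[OF fin, of "\<epsilon> / 4"] \<epsilon> by auto
  have period: "N a b z \<le> ennreal (n0 + \<epsilon> / 4)" if z: "z \<in> model_set \<Gamma> {-\<delta>..\<delta>}" for z
  proof -
    obtain \<gamma>0 where g: "\<gamma>0 \<in> \<Gamma>" "z = fst \<gamma>0" "\<bar>snd \<gamma>0\<bar> \<le> \<delta>"
      using z by (auto simp: model_set_def)
    have "N a b z = (\<integral>\<^sup>+\<gamma>. W (fst (\<gamma> - \<gamma>0)) * indicator {a..b} (snd (\<gamma> - \<gamma>0) + snd \<gamma>0) \<partial>count_space \<Gamma>)"
      unfolding N by (simp add: g)
    also have "\<dots> = (\<integral>\<^sup>+\<gamma>. W (fst \<gamma>) * indicator {a..b} (snd \<gamma> + snd \<gamma>0) \<partial>count_space \<Gamma>)"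
      by (rule nn_integral_lattice_shift[OF lat g(1), of "\<lambda>\<gamma>. W (fst \<gamma>) * indicator {a..b} (snd \<gamma> + snd \<gamma>0)"])
    also have "\<dots> \<le> (\<integral>\<^sup>+\<gamma>. W (fst \<gamma> - 0) * indicator {a..b} (snd \<gamma>)
        + W (fst \<gamma>) * indicator ({a - \<delta>..b + \<delta>} - {a..b}) (snd \<gamma>) \<partial>count_space \<Gamma>)"
      using g(3) by (intro nn_integral_mono) (auto simp: indicator_def)
    also have "\<dots> = N a b 0 + (window_sum \<Gamma> W ({a - \<delta>..b + \<delta>} - {a..b}))"
      unfolding N by (rule nn_integral_add) auto
    also have "\<dots> \<le> ennreal n0 + ennreal (\<epsilon> / 4)"
      using \<delta>(2) n0 by (intro add_mono) auto
    also have "\<dots> = ennreal (n0 + \<epsilon> / 4)" using n0 \<epsilon> by simp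
    finally show ?thesis .
  qed
  \<comment> \<open>A quarter of the deficit \<open>\<epsilon>\<close> is spent on each of the enlarged window, the factor \<open>1 + \<alpha>\<close> and the additive error.\<close>
  define \<alpha> where "\<alpha> = \<epsilon> / (4 * E)"
  have \<alpha>: "\<alpha> > 0" "\<alpha> * E = \<epsilon> / 4" using \<epsilon> by (simp_all add: \<alpha>_def)
  obtain \<rho> where \<rho>: "\<rho> > 0" "\<And>x y. norm y < \<rho> \<Longrightarrow> N a b (x + y) \<le> ennreal (1 + \<alpha>) * N a b x + ennreal (\<epsilon> / 4)"
    using quasi[OF \<alpha>(1), of "\<epsilon> / 4"] \<epsilon> by auto
  have near: "N a b (z + y) \<le> ennreal (E - \<epsilon> / 4)" if "z \<in> model_set \<Gamma> {-\<delta>..\<delta>}" "norm y < \<rho>" for z y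
  proof -
    have "N a b (z + y) \<le> ennreal (1 + \<alpha>) * N a b z + ennreal (\<epsilon> / 4)"
      by (rule \<rho>(2)[OF that(2)])
    also have "\<dots> \<le> ennreal (1 + \<alpha>) * ennreal (n0 + \<epsilon> / 4) + ennreal (\<epsilon> / 4)"
      by (intro add_mono mult_left_mono period that(1)) auto
    also have "\<dots> = ennreal ((1 + \<alpha>) * (n0 + \<epsilon> / 4) + \<epsilon> / 4)"
      using n0(2) \<epsilon> \<alpha>(1) by (simp add: ennreal_mult[symmetric] ennreal_plus[symmetric] del: ennreal_plus)
    also have "\<dots> \<le> ennreal (E - \<epsilon> / 4)"
    proof (rule ennreal_leI)
      have "\<alpha> * (n0 + \<epsilon> / 4) \<le> \<alpha> * E"
        using \<alpha>(1) \<epsilon> by (intro mult_left_mono) (auto simp: \<epsilon>_def field_simps)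
      then have "\<alpha> * (n0 + \<epsilon> / 4) \<le> \<epsilon> / 4" unfolding \<alpha>(2) .
      moreover have "(1 + \<alpha>) * (n0 + \<epsilon> / 4) = n0 + \<epsilon> / 4 + \<alpha> * (n0 + \<epsilon> / 4)" by (simp add: distrib_right)
      moreover have "n0 = E - \<epsilon>" by (simp add: \<epsilon>_def)
      ultimately show "(1 + \<alpha>) * (n0 + \<epsilon> / 4) + \<epsilon> / 4 \<le> E - \<epsilon> / 4" by linarith
    qed
    finally show ?thesis .
  qed
  define s where "s = \<rho> / (2 * real CARD('m))"
  have s: "s > 0" using \<rho>(1) by (simp add: s_def)
  have small: "norm y < \<rho>" if "\<And>i. \<bar>y $ i\<bar> \<le> s" for y :: "real ^ 'm"
  proof -
    have "norm y \<le> (\<Sum>i\<in>UNIV. \<bar>y $ i\<bar>)" by (rule norm_le_l1_cart)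
    also have "\<dots> \<le> (\<Sum>i\<in>(UNIV :: 'm set). s)" by (intro sum_mono that)
    also have "\<dots> < \<rho>" using \<rho>(1) by (simp add: s_def)
    finally show ?thesis .
  qed
  let ?\<Lambda>' = "model_set \<Gamma> {-\<delta>..\<delta>}"
  define D' where "D' = (\<delta> - (- \<delta>)) / p"
  have D': "D' > 0" "has_uniform_density ?\<Lambda>' D'"
    using p(1) \<delta>(1) p(2)[of "-\<delta>" \<delta>] by (auto simp: D'_def)
  obtain R0 where R0: "R0 > 0" "\<And>R y. R \<ge> R0 \<Longrightarrow>
        (cube_count ?\<Lambda>' y R) \<le> ennreal ((D' + 1) * R ^ CARD('m))"
    using D'(2) unfolding has_uniform_density_def by (metis zero_less_one)
  \<comment> \<open>The count in cubes of side \<open>s\<close> is bounded by that in larger cubes, to which the density estimate applies.\<close>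
  define R where "R = max R0 s"
  define C where "C = (D' + 1) * R ^ CARD('m)"
  have C: "C \<ge> 0" using D'(1) s by (simp add: C_def R_def)
  \<comment> \<open>At most \<open>C\<close> points of the recurrence set are counted near any \<open>x\<close>, so the total weight added there is at most \<open>\<epsilon> / 4\<close>.\<close>
  define \<kappa> where "\<kappa> = \<epsilon> / (4 * (C + 1))"
  have \<kappa>: "\<kappa> > 0" "\<kappa> * C \<le> \<epsilon> / 4" using \<epsilon> C by (simp_all add: \<kappa>_def field_simps)
  define F' where "F' w = ennreal \<kappa> * indicator (cube 0 s) w" for w :: "real ^ 'm"
  have [measurable]: "F' \<in> borel_measurable borel" unfolding F'_def by measurable
  have F'eq: "F' (z - x) = ennreal \<kappa> * indicator (cube x s) z" for z x
    by (auto simp: F'_def indicator_def mem_cube algebra_simps)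
  have le: "N a b x + (shifted_sum ?\<Lambda>' F' x) \<le> ennreal E" for x
  proof (cases "\<exists>z\<in>?\<Lambda>'. z \<in> cube x s")
    case True
    then obtain z where z: "z \<in> ?\<Lambda>'" "z \<in> cube x s" by blast
    have "\<bar>(x - z) $ i\<bar> \<le> s" for i
      using z(2)[unfolded mem_cube, rule_format, of i] by (simp add: abs_le_iff)
    then have "norm (x - z) < \<rho>" by (rule small)
    from near[OF z(1) this] have 1: "N a b x \<le> ennreal (E - \<epsilon> / 4)" by simp
    have "(shifted_sum ?\<Lambda>' F' x) = ennreal \<kappa> * (cube_count ?\<Lambda>' x s)"
      unfolding F'eq by (rule nn_integral_cmult) simp
    also have "\<dots> \<le> ennreal \<kappa> * (cube_count ?\<Lambda>' x R)"
    proof (intro mult_left_mono nn_integral_mono)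
      fix z
      have "cube x s \<subseteq> cube x R"
      proof
        fix w assume w: "w \<in> cube x s"
        have "x $ i \<le> w $ i \<and> w $ i \<le> x $ i + R" for i
          using w[unfolded mem_cube, rule_format, of i] max.cobounded2[of s R0] unfolding R_def by linarith
        then show "w \<in> cube x R" by (simp add: mem_cube)
      qed
      then show "indicator (cube x s) z \<le> (indicator (cube x R) z :: ennreal)"
        by (auto simp: indicator_def)
    qed simp
    also have "\<dots> \<le> ennreal \<kappa> * ennreal C"
      unfolding C_def by (intro mult_left_mono R0(2)) (simp_all add: R_def)
    also have "\<dots> = ennreal (\<kappa> * C)" using \<kappa>(1) C by (simp add: ennreal_mult)
    also have "\<dots> \<le> ennreal (\<epsilon> / 4)" using \<kappa>(2) by (rule ennreal_leI)
    finally have "N a b x + (shifted_sum ?\<Lambda>' F' x) \<le> ennreal (E - \<epsilon> / 4) + ennreal (\<epsilon> / 4)"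
      by (intro add_mono 1)
    also have "\<dots> = ennreal E"
      using \<epsilon> n0(2) by (subst ennreal_plus[symmetric]) (auto simp: \<epsilon>_def)
    finally show ?thesis .
  next
    case False
    then have "(shifted_sum ?\<Lambda>' F' x) = (\<integral>\<^sup>+z. 0 \<partial>count_space ?\<Lambda>')"
      unfolding F'eq by (intro nn_integral_cong) (auto simp: indicator_def)
    then show ?thesis using bound[of x] by simp
  qed
  have "ennreal ((b - a) / p) * (\<integral>\<^sup>+y. W y \<partial>lborel) + ennreal D' * (\<integral>\<^sup>+y. F' y \<partial>lborel) \<le> ennreal E"
    by (rule model_mean_le[OF cnt p(2)[OF ab] _ cnt D'(2,1)]) (use p(1) ab E le in \<open>auto simp: N_def\<close>)
  moreover have "(\<integral>\<^sup>+y. F' y \<partial>lborel) = ennreal (\<kappa> * s ^ CARD('m))"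
    unfolding F'_def using s \<kappa>(1) by (intro nn_integral_const_cube) auto
  ultimately have "ennreal E + ennreal D' * ennreal (\<kappa> * s ^ CARD('m)) \<le> ennreal E"
    by (simp only: mean)
  then have "ennreal (E + D' * (\<kappa> * s ^ CARD('m))) \<le> ennreal E"
    using E D'(1) \<kappa>(1) s by (simp add: ennreal_mult[symmetric] ennreal_plus[symmetric] del: ennreal_plus)
  then have "E + D' * (\<kappa> * s ^ CARD('m)) \<le> E" using E by (simp only: ennreal_le_iff)
  moreover have "D' * (\<kappa> * s ^ CARD('m)) > 0" using D'(1) \<kappa>(1) s by simp
  ultimately show False by linarith
qed

section \<open>Frame coefficients of Gabor systems\<close>

lemma nn_integral_count_space_Times:
  fixes f :: "'a \<times> 'b \<Rightarrow> ennreal"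
  assumes A: "countable A" and B: "countable B"
  shows "(\<integral>\<^sup>+x. f x \<partial>count_space (A \<times> B)) = (\<integral>\<^sup>+a. \<integral>\<^sup>+b. f (a, b) \<partial>count_space B \<partial>count_space A)"
proof -
  interpret sigma_finite_measure "count_space B"
    using B by (rule sigma_finite_measure_count_space_countable)
  show ?thesis
    by (subst pair_measure_countable[OF A B, symmetric], subst nn_integral_fst[symmetric])
       (simp_all add: pair_measure_countable[OF A B])
qed

lemma countable_int_vectors: "countable (int_vectors :: (real ^ 'm) set)"
proof -
  have "(int_vectors :: (real ^ 'm) set) \<subseteq> range (\<lambda>k :: 'm \<Rightarrow> int. \<chi> i. of_int (k i))"
  proof
    fix x :: "real ^ 'm" assume "x \<in> int_vectors"
    then have "x = (\<chi> i. of_int (\<lfloor>x $ i\<rfloor>))"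
      by (auto simp: int_vectors_def vec_eq_iff elim!: Ints_cases)
    then show "x \<in> range (\<lambda>k :: 'm \<Rightarrow> int. \<chi> i. of_int (k i))"
      by (rule image_eqI[where x = "\<lambda>i. \<lfloor>x $ i\<rfloor>"]) simp
  qed
  then show ?thesis by (rule countable_subset) simp
qed

lemma ennreal_power2_le_imp_le:
  assumes "a\<^sup>2 \<le> (ennreal b)\<^sup>2" "0 \<le> b"
  shows "a \<le> ennreal b"
proof (cases a)
  case (real r)
  then have "ennreal (r\<^sup>2) \<le> ennreal (b\<^sup>2)" using assms by (simp add: ennreal_power)
  then have "r\<^sup>2 \<le> b\<^sup>2" by (simp add: ennreal_le_iff)
  then have "r \<le> b" using assms(2) by (rule power2_le_imp_le)
  then show ?thesis using real by (simp add: ennreal_leI)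
next
  case top
  then show ?thesis using assms by (simp add: ennreal_power top_unique)
qed

text \<open>On each unit cube the \<open>L\<^sup>1\<close> norm is at most the \<open>L\<^sup>2\<close> norm, and these are
  summable. Thus the integral defining \<^const>\<open>fourier\<close> converges for the windows.\<close>

lemma in_wiener_imp_integrable:
  fixes g :: "real ^ 'm \<Rightarrow> complex"
  assumes "in_wiener 2 1 g"
  shows "integrable lebesgue g"
proof (rule integrableI_bounded)
  have [measurable]: "g \<in> borel_measurable lebesgue"
    and Lp: "\<And>k. k \<in> int_vectors \<Longrightarrow> in_Lp 2 (\<lambda>t. indicator (cube k 1) t * g t)"
    and sm: "(\<lambda>k. Lp_norm 2 (\<lambda>t. indicator (cube k 1) t * g t) powr 1) summable_on int_vectors"
    using assms unfolding in_wiener_def by blast+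
  show "g \<in> borel_measurable lebesgue" by measurable
  define N where "N k = Lp_norm 2 (\<lambda>t. indicator (cube k 1) t * g t)" for k
  have N0: "N k \<ge> 0" for k by (simp add: N_def Lp_norm_def)
  have sN: "N summable_on int_vectors" using sm N0 by (simp add: N_def[abs_def])
  have [measurable]: "cube k 1 \<in> sets lebesgue" for k :: "real ^ 'm"
    using cube_borel[of k 1] by simp
  have local: "(\<integral>\<^sup>+t. ennreal (norm (g t)) * indicator (cube k 1) t \<partial>lebesgue) \<le> ennreal (N k)"
    if k: "k \<in> int_vectors" for k
  proof -
    let ?u = "\<lambda>t. indicator (cube k 1) t * g t"
    have int: "integrable lebesgue (\<lambda>t. (norm (?u t))\<^sup>2)"
      using Lp[OF k] by (simp add: in_Lp_def)
    have "(\<integral>\<^sup>+t. ennreal (norm (?u t)) * indicator (cube k 1) t \<partial>lebesgue)\<^sup>2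
       \<le> (\<integral>\<^sup>+t. ennreal (norm (?u t)) ^ 2 \<partial>lebesgue) * (\<integral>\<^sup>+t. indicator (cube k 1) t ^ 2 \<partial>lebesgue)"
      by (rule Cauchy_Schwarz_nn_integral) measurable
    also have "(\<integral>\<^sup>+t. indicator (cube k 1) t ^ 2 \<partial>lebesgue) = (\<integral>\<^sup>+t. indicator (cube k 1) t \<partial>lebesgue)"
      by (intro nn_integral_cong) (simp add: indicator_def)
    also have "\<dots> = 1"
      by (subst nn_integral_completion, subst nn_integral_indicator) (auto simp: emeasure_cube)
    also have "(\<integral>\<^sup>+t. ennreal (norm (?u t)) ^ 2 \<partial>lebesgue) = ennreal (\<integral>t. (norm (?u t))\<^sup>2 \<partial>lebesgue)"
      by (subst nn_integral_eq_integral[OF int, symmetric]) (simp_all add: ennreal_power)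
    also have "(\<integral>t. (norm (?u t))\<^sup>2 \<partial>lebesgue) = (N k)\<^sup>2"
      by (simp add: N_def Lp_norm_def powr_half_sqrt)
    finally have "(\<integral>\<^sup>+t. ennreal (norm (?u t)) * indicator (cube k 1) t \<partial>lebesgue)\<^sup>2 \<le> (ennreal (N k))\<^sup>2"
      using N0 by (simp add: ennreal_power)
    then have "(\<integral>\<^sup>+t. ennreal (norm (?u t)) * indicator (cube k 1) t \<partial>lebesgue) \<le> ennreal (N k)"
      using N0 by (rule ennreal_power2_le_imp_le)
    also have "(\<integral>\<^sup>+t. ennreal (norm (?u t)) * indicator (cube k 1) t \<partial>lebesgue)
        = (\<integral>\<^sup>+t. ennreal (norm (g t)) * indicator (cube k 1) t \<partial>lebesgue)"
      by (intro nn_integral_cong) (simp add: indicator_def)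
    finally show ?thesis .
  qed
  have "(\<integral>\<^sup>+t. ennreal (norm (g t)) \<partial>lebesgue)
      \<le> (\<integral>\<^sup>+t. (\<integral>\<^sup>+k. ennreal (norm (g t)) * indicator (cube k 1) t \<partial>count_space int_vectors) \<partial>lebesgue)"
  proof (rule nn_integral_mono)
    fix t :: "real ^ 'm"
    define k :: "real ^ 'm" where "k = (\<chi> i. of_int \<lfloor>t $ i\<rfloor>)"
    have k: "k \<in> int_vectors" "t \<in> cube k 1"
      by (auto simp: k_def int_vectors_def mem_cube)
    have "ennreal (norm (g t)) = (\<integral>\<^sup>+k'. ennreal (norm (g t)) * indicator {k} k' \<partial>count_space int_vectors)"
      using k by (subst nn_integral_cmult_indicator) auto
    also have "\<dots> \<le> (\<integral>\<^sup>+k. ennreal (norm (g t)) * indicator (cube k 1) t \<partial>count_space int_vectors)"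
      using k(2) by (intro nn_integral_mono mult_left_mono) (auto simp: indicator_def)
    finally show "ennreal (norm (g t)) \<le> (\<integral>\<^sup>+k. ennreal (norm (g t)) * indicator (cube k 1) t \<partial>count_space int_vectors)" .
  qed
  also have "\<dots> = (\<integral>\<^sup>+k. (\<integral>\<^sup>+t. ennreal (norm (g t)) * indicator (cube k 1) t \<partial>lebesgue) \<partial>count_space int_vectors)"
    by (rule nn_integral_count_space_nn_integral[OF countable_int_vectors]) measurable
  also have "\<dots> \<le> (\<integral>\<^sup>+k. ennreal (N k) \<partial>count_space (int_vectors :: (real ^ 'm) set))"
    by (intro nn_integral_mono) (simp add: local)
  also have "\<dots> = ennreal (infsum N int_vectors)"
    using infsum_nonneg_is_SUPREMUM_ennreal[OF sN] N0 
    by (simp add: infsum_ennreal_eq_nn_integral[OF countable_int_vectors, symmetric] nonneg_infsum_complete sum_ennreal)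
  also have "\<dots> < \<infinity>" by simp
  finally show "(\<integral>\<^sup>+t. ennreal (norm (g t)) \<partial>lebesgue) < \<infinity>" .
qed

definition frame_sum :: "'i set \<Rightarrow> ('i \<Rightarrow> real ^ 'm \<Rightarrow> complex) \<Rightarrow> (real ^ 'm \<Rightarrow> complex) \<Rightarrow> ennreal" where
  "frame_sum I e f = (\<Sum>\<^sub>\<infinity>j\<in>I. sqn (L2_inner f (e j)))"

text \<open>The part of the frame sum of \<open>f\<close> that belongs to one translation parameter \<open>y\<close>, for
  Borel representatives \<open>h l\<close> of the windows.\<close>

definition window_energy ::
    "nat \<Rightarrow> (real ^ 'm) set \<Rightarrow> (nat \<Rightarrow> real ^ 'm \<Rightarrow> complex) \<Rightarrow> (real ^ 'm \<Rightarrow> complex) \<Rightarrow> real ^ 'm \<Rightarrow> ennreal" where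
  "window_energy L \<Delta> h f y =
     (\<Sum>l=1..L. \<integral>\<^sup>+\<beta>. sqn (corr f (modulation \<beta> (h l)) y) \<partial>count_space \<Delta>)"

lemma modulation_borel[measurable]: "h \<in> borel_measurable borel \<Longrightarrow> modulation \<beta> h \<in> borel_measurable borel"
  unfolding modulation_def[abs_def] by measurable

lemma integrable_modulation: "integrable lborel h \<Longrightarrow> integrable lborel (modulation \<beta> h)"
  unfolding modulation_def[abs_def]
  using integrable_mult_cis[of h "\<lambda>t. 2 * pi * (\<beta> \<bullet> t)"] by (simp add: mult.commute)

lemma corr_borel[measurable]:
  assumes [measurable]: "f \<in> borel_measurable borel" "h \<in> borel_measurable borel"
  shows "corr f h \<in> borel_measurable borel"
  unfolding corr_def[abs_def] by measurable

lemma window_energy_borel: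
  assumes [measurable]: "f \<in> borel_measurable borel" "\<And>l. l \<in> {1..L} \<Longrightarrow> h l \<in> borel_measurable borel"
    and \<Delta>: "countable \<Delta>"
  shows "window_energy L \<Delta> h f \<in> borel_measurable borel"
  unfolding window_energy_def[abs_def]
  by (intro borel_measurable_sum borel_measurable_nn_integral_countable[OF \<Delta>]) measurable

text \<open>A Lebesgue measurable window may be replaced by a Borel function that agrees with it almost everywhere.\<close>

lemma L2_inner_gabor:
  fixes f :: "real ^ 'm \<Rightarrow> complex"
  assumes [measurable]: "f \<in> borel_measurable borel" "h \<in> borel_measurable borel"
    and ae: "AE t in lebesgue. g t = h t"
  shows "L2_inner f (translation y (modulation \<beta> g)) = corr f (modulation \<beta> h) y"
proof -
  have "AE t in lborel. g t = h t" using ae by (simp add: AE_completion_iff)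
  then obtain N where N: "\<And>t. t \<in> space lborel - N \<Longrightarrow> g t = h t" "N \<in> null_sets lborel"
    by (rule AE_E3) (rule that, assumption+)
  have "{t. t - y \<in> N} \<in> null_sets lborel" by (rule null_sets_translation[OF N(2)])
  then have "AE t in lborel. t - y \<notin> N" by (rule AE_I') auto
  then have "AE t in lborel. g (t - y) = h (t - y)"
    using N(1) by (auto elim!: eventually_mono)
  then have ae': "AE t in lebesgue. g (t - y) = h (t - y)" by (rule AE_completion)
  have m: "(\<lambda>t. f t * cnj (translation y (modulation \<beta> h) t)) \<in> borel_measurable lborel"
    unfolding translation_def modulation_def by measurable
  have "L2_inner f (translation y (modulation \<beta> g)) = L2_inner f (translation y (modulation \<beta> h))"
    unfolding L2_inner_def
  proof (rule integral_cong_AE)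
    show eq: "AE t in lebesgue. f t * cnj (translation y (modulation \<beta> g) t) = f t * cnj (translation y (modulation \<beta> h) t)"
      using ae' by eventually_elim (simp add: translation_def modulation_def)
    show mh: "(\<lambda>t. f t * cnj (translation y (modulation \<beta> h) t)) \<in> borel_measurable lebesgue"
      using m by (rule measurable_completion)
    show "(\<lambda>t. f t * cnj (translation y (modulation \<beta> g) t)) \<in> borel_measurable lebesgue"
      by (rule borel_measurable_AE[OF mh]) (use eq in eventually_elim, erule sym)
  qed
  also have "\<dots> = corr f (modulation \<beta> h) y"
    unfolding L2_inner_def corr_def using m
    by (subst integral_completion) (simp_all add: translation_def)
  finally show ?thesis .
qed

lemma frame_sum_gabor:
  fixes f :: "real ^ 'm \<Rightarrow> complex"
  assumes f[measurable]: "f \<in> borel_measurable borel" and h: "\<And>l. l \<in> {1..L} \<Longrightarrow> h l \<in> borel_measurable borel"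
    and ae: "\<And>l. l \<in> {1..L} \<Longrightarrow> AE t in lebesgue. g l t = h l t"
    and \<Lambda>: "countable \<Lambda>" and \<Delta>: "countable \<Delta>"
  shows "frame_sum (gabor_index L \<Lambda> \<Delta>) (gabor g) f = (\<integral>\<^sup>+z. window_energy L \<Delta> h f z \<partial>count_space \<Lambda>)"
proof -
  let ?F = "\<lambda>j. sqn (L2_inner f (gabor g j))"
  have c: "countable ({1..L} \<times> \<Lambda> \<times> \<Delta>)" "countable (\<Lambda> \<times> \<Delta>)" "countable {1..L}"
    using \<Lambda> \<Delta> by (auto intro: countable_finite)
  have "frame_sum (gabor_index L \<Lambda> \<Delta>) (gabor g) f = (\<integral>\<^sup>+j. ?F j \<partial>count_space ({1..L} \<times> \<Lambda> \<times> \<Delta>))"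
    unfolding frame_sum_def gabor_index_def by (rule infsum_ennreal_eq_nn_integral[OF c(1)])
  also have "\<dots> = (\<Sum>l=1..L. \<integral>\<^sup>+z. \<integral>\<^sup>+\<beta>. ?F (l, z, \<beta>) \<partial>count_space \<Delta> \<partial>count_space \<Lambda>)"
    by (subst nn_integral_count_space_Times[OF c(3,2)], subst nn_integral_count_space_Times[OF \<Lambda> \<Delta>])
       (simp add: nn_integral_count_space_finite)
  also have "\<dots> = (\<integral>\<^sup>+z. (\<Sum>l=1..L. \<integral>\<^sup>+\<beta>. ?F (l, z, \<beta>) \<partial>count_space \<Delta>) \<partial>count_space \<Lambda>)"
    by (rule nn_integral_sum[symmetric]) simp
  also have "\<dots> = (\<integral>\<^sup>+z. window_energy L \<Delta> h f z \<partial>count_space \<Lambda>)"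
    unfolding window_energy_def
    by (intro nn_integral_cong sum.cong refl) (simp add: gabor_def L2_inner_gabor[OF f h ae])
  finally show ?thesis .
qed

lemma corr_translation:
  assumes [measurable]: "f \<in> borel_measurable borel" "h \<in> borel_measurable borel"
  shows "corr (translation x f) h z = corr f h (z - x)"
  unfolding corr_def
  by (subst integral_lborel_affine[where c = 1 and t = x])
     (simp_all add: translation_def algebra_simps)

text \<open>For this class Plancherel's theorem holds in the above form; it contains the Gaussians as well as the continuous
  functions with compact support, which are dense in \<open>L\<^sup>2\<close>.\<close>

definition test_fun :: "('a::euclidean_space \<Rightarrow> complex) \<Rightarrow> bool" where
  "test_fun f \<longleftrightarrow> continuous_on UNIV f \<and> (\<exists>M. \<forall>x. norm (f x) \<le> M) \<and> integrable lborel f"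

definition energy :: "('a::euclidean_space \<Rightarrow> complex) \<Rightarrow> real" where
  "energy f = (\<integral>t. (norm (f t))\<^sup>2 \<partial>lborel)"

lemma test_fun_borel: "test_fun f \<Longrightarrow> f \<in> borel_measurable borel"
  unfolding test_fun_def by (auto intro: borel_measurable_continuous_onI)

lemma test_fun_square_integrable: "test_fun f \<Longrightarrow> integrable lborel (\<lambda>t. (norm (f t))\<^sup>2)"
  unfolding test_fun_def using plancherel(2) by blast

lemma energy_nonneg: "energy f \<ge> 0"
  by (simp add: energy_def)

lemma test_fun_translation: "test_fun f \<Longrightarrow> test_fun (translation x f)"
proof -
  assume f: "test_fun f"
  then have "continuous_on UNIV (\<lambda>t. f (t - x))"
    by (auto simp: test_fun_def intro!: continuous_on_compose2[of UNIV f] continuous_intros)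
  moreover have "integrable lborel (\<lambda>t. f (t - x))"
    using f test_fun_borel[OF f] integrable_lborel_affine[of f 1 "- x"] by (simp add: test_fun_def)
  ultimately show ?thesis using f by (auto simp: test_fun_def translation_def)
qed

lemma energy_translation: "test_fun f \<Longrightarrow> energy (translation x f) = energy f"
  using integral_lborel_affine[of "\<lambda>t. (norm (f t))\<^sup>2" 1 "- x"] test_fun_borel[of f]
  by (simp add: energy_def translation_def)

lemma nn_integral_energy: "test_fun f \<Longrightarrow> (\<integral>\<^sup>+t. sqn (f t) \<partial>lborel) = ennreal (energy f)"
  unfolding energy_def by (rule nn_integral_eq_integral) (auto intro: test_fun_square_integrable)

lemma test_fun_in_Lp:
  assumes "test_fun f"
  shows "in_Lp 2 f" and "(Lp_norm 2 f)\<^sup>2 = energy f"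
proof -
  have [measurable]: "f \<in> borel_measurable borel" by (rule test_fun_borel[OF assms])
  have m: "(\<lambda>t. (norm (f t))\<^sup>2) \<in> borel_measurable lborel" by measurable
  show "in_Lp 2 f"
    using test_fun_square_integrable[OF assms] m by (simp add: in_Lp_def integrable_completion measurable_completion)
  show "(Lp_norm 2 f)\<^sup>2 = energy f"
    using m by (simp add: Lp_norm_def energy_def powr_half_sqrt integral_completion)
qed

definition fiber_sum :: "nat \<Rightarrow> (real ^ 'm) set \<Rightarrow> (nat \<Rightarrow> real ^ 'm \<Rightarrow> complex) \<Rightarrow> real ^ 'm \<Rightarrow> ennreal" where
  "fiber_sum L \<Delta> h \<omega> = (\<Sum>l=1..L. \<integral>\<^sup>+\<beta>. sqn (ft (h l) (\<omega> - \<beta>)) \<partial>count_space \<Delta>)"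

lemma fiber_sum_borel:
  assumes h: "\<And>l. l \<in> {1..L} \<Longrightarrow> h l \<in> borel_measurable borel" and \<Delta>: "countable \<Delta>"
  shows "fiber_sum L \<Delta> h \<in> borel_measurable borel"
  unfolding fiber_sum_def[abs_def]
proof (intro borel_measurable_sum borel_measurable_nn_integral_countable[OF \<Delta>])
  fix l \<beta> assume "l \<in> {1..L}"
  then have [measurable]: "h l \<in> borel_measurable borel" by (rule h)
  show "(\<lambda>\<omega>. sqn (ft (h l) (\<omega> - \<beta>))) \<in> borel_measurable borel" by measurable
qed

text \<open>Each summand is the integral of the squared modulus of a correlation; modulating the window by
  \<open>\<beta>\<close> shifts its Fourier transform.\<close>

lemma nn_integral_window_energy:
  fixes f :: "real ^ 'm \<Rightarrow> complex"
  assumes f: "test_fun f" and h: "\<And>l. l \<in> {1..L} \<Longrightarrow> integrable lborel (h l)" and \<Delta>: "countable \<Delta>"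
  shows "(\<integral>\<^sup>+y. window_energy L \<Delta> h f y \<partial>lborel) = (\<integral>\<^sup>+\<omega>. sqn (ft f \<omega>) * fiber_sum L \<Delta> h \<omega> \<partial>lborel)"
proof -
  have fb[measurable]: "f \<in> borel_measurable borel" by (rule test_fun_borel[OF f])
  obtain M where f': "continuous_on UNIV f" "\<And>x. norm (f x) \<le> M" "integrable lborel f"
    using f unfolding test_fun_def by blast
  have hb: "h l \<in> borel_measurable borel" if "l \<in> {1..L}" for l
    using borel_measurable_integrable[OF h[OF that]] by simp
  have m1: "(\<lambda>y. sqn (corr f (modulation \<beta> (h l)) y)) \<in> borel_measurable lborel" if "l \<in> {1..L}" for l \<beta>
    using hb[OF that] by measurable
  have m2: "(\<lambda>\<omega>. sqn (ft f \<omega>) * sqn (ft (h l) (\<omega> - \<beta>))) \<in> borel_measurable lborel"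
    if "l \<in> {1..L}" for l \<beta>
    using hb[OF that] by measurable
  have one: "(\<integral>\<^sup>+y. (\<integral>\<^sup>+\<beta>. sqn (corr f (modulation \<beta> (h l)) y) \<partial>count_space \<Delta>) \<partial>lborel)
      = (\<integral>\<^sup>+\<omega>. sqn (ft f \<omega>) * (\<integral>\<^sup>+\<beta>. sqn (ft (h l) (\<omega> - \<beta>)) \<partial>count_space \<Delta>) \<partial>lborel)"
    if l: "l \<in> {1..L}" for l
  proof -
    have "(\<integral>\<^sup>+y. (\<integral>\<^sup>+\<beta>. sqn (corr f (modulation \<beta> (h l)) y) \<partial>count_space \<Delta>) \<partial>lborel)
        = (\<integral>\<^sup>+\<beta>. (\<integral>\<^sup>+y. sqn (corr f (modulation \<beta> (h l)) y) \<partial>lborel) \<partial>count_space \<Delta>)"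
      by (rule nn_integral_count_space_nn_integral[OF \<Delta> m1[OF l]])
    also have "\<dots> = (\<integral>\<^sup>+\<beta>. (\<integral>\<^sup>+\<omega>. sqn (ft f \<omega>) * sqn (ft (h l) (\<omega> - \<beta>)) \<partial>lborel) \<partial>count_space \<Delta>)"
      by (subst nn_integral_corr[OF f' integrable_modulation[OF h[OF l]]])
         (simp add: modulation_def[abs_def] ft_modulate)
    also have "\<dots> = (\<integral>\<^sup>+\<omega>. (\<integral>\<^sup>+\<beta>. sqn (ft f \<omega>) * sqn (ft (h l) (\<omega> - \<beta>)) \<partial>count_space \<Delta>) \<partial>lborel)"
      by (rule nn_integral_count_space_nn_integral[OF \<Delta> m2[OF l], symmetric])
    finally show ?thesis by (simp add: nn_integral_cmult)
  qed
  have "(\<integral>\<^sup>+y. window_energy L \<Delta> h f y \<partial>lborel)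
     = (\<Sum>l=1..L. \<integral>\<^sup>+y. (\<integral>\<^sup>+\<beta>. sqn (corr f (modulation \<beta> (h l)) y) \<partial>count_space \<Delta>) \<partial>lborel)"
    unfolding window_energy_def
    by (intro nn_integral_sum borel_measurable_nn_integral_countable[OF \<Delta> m1])
  also have "\<dots> = (\<Sum>l=1..L. \<integral>\<^sup>+\<omega>. sqn (ft f \<omega>) * (\<integral>\<^sup>+\<beta>. sqn (ft (h l) (\<omega> - \<beta>)) \<partial>count_space \<Delta>) \<partial>lborel)"
    by (intro sum.cong refl one)
  also have "\<dots> = (\<integral>\<^sup>+\<omega>. (\<Sum>l=1..L. sqn (ft f \<omega>) * (\<integral>\<^sup>+\<beta>. sqn (ft (h l) (\<omega> - \<beta>)) \<partial>count_space \<Delta>)) \<partial>lborel)"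
  proof (rule nn_integral_sum[symmetric])
    fix l assume l: "l \<in> {1..L}"
    have [measurable]: "h l \<in> borel_measurable borel" by (rule hb[OF l])
    have "(\<lambda>\<omega>. \<integral>\<^sup>+\<beta>. sqn (ft (h l) (\<omega> - \<beta>)) \<partial>count_space \<Delta>) \<in> borel_measurable lborel"
      by (intro borel_measurable_nn_integral_countable[OF \<Delta>]) measurable
    then show "(\<lambda>\<omega>. sqn (ft f \<omega>) * (\<integral>\<^sup>+\<beta>. sqn (ft (h l) (\<omega> - \<beta>)) \<partial>count_space \<Delta>)) \<in> borel_measurable lborel"
      by (intro borel_measurable_times_ennreal) simp_all
  qed
  also have "\<dots> = (\<integral>\<^sup>+\<omega>. sqn (ft f \<omega>) * fiber_sum L \<Delta> h \<omega> \<partial>lborel)"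
    by (simp add: fiber_sum_def sum_distrib_left)
  finally show ?thesis .
qed

section \<open>Square-integrable functions and their approximation\<close>

lemma in_Lp_2_iff:
  "in_Lp 2 f \<longleftrightarrow> f \<in> borel_measurable lebesgue \<and> integrable lebesgue (\<lambda>t. (cmod (f t))\<^sup>2)"
  by (simp add: in_Lp_def)

lemma Lp_norm_2_square: "(Lp_norm 2 f)\<^sup>2 = (\<integral>t. (cmod (f t))\<^sup>2 \<partial>lebesgue)"
  by (simp add: Lp_norm_def powr_half_sqrt)

text \<open>A substitute for the triangle inequality that stays with squares, and hence is inherited by sums and integrals
  of squares.\<close>

lemma norm_add_square_le:
  fixes x y :: complex
  assumes "\<alpha> > 0"
  shows "(norm (x + y))\<^sup>2 \<le> (1 + \<alpha>) * (norm x)\<^sup>2 + (1 + 1 / \<alpha>) * (norm y)\<^sup>2"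
proof -
  have "(norm (x + y))\<^sup>2 \<le> (norm x + norm y)\<^sup>2"
    by (intro power_mono norm_triangle_ineq) simp
  also have "\<dots> = (norm x)\<^sup>2 + (norm y)\<^sup>2 + 2 * norm x * norm y"
    by (rule power2_sum)
  also have "2 * norm x * norm y \<le> \<alpha> * (norm x)\<^sup>2 + (norm y)\<^sup>2 / \<alpha>"
  proof -
    have "0 \<le> (\<alpha> * norm x - norm y)\<^sup>2 / \<alpha>" using assms by simp
    also have "\<dots> = \<alpha> * (norm x)\<^sup>2 + (norm y)\<^sup>2 / \<alpha> - 2 * norm x * norm y"
      using assms by (simp add: field_simps power2_eq_square)
    finally show ?thesis by simp
  qed
  finally show ?thesis by (simp add: algebra_simps)
qed

lemma in_Lp_2_add:
  assumes u: "in_Lp 2 u" and v: "in_Lp 2 v"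
  shows "in_Lp 2 (\<lambda>t. u t + v t)"
proof -
  have [measurable]: "u \<in> borel_measurable lebesgue" "v \<in> borel_measurable lebesgue"
    using u v by (auto simp: in_Lp_2_iff)
  have "integrable lebesgue (\<lambda>t. (cmod (u t + v t))\<^sup>2)"
  proof (rule Bochner_Integration.integrable_bound)
    show "integrable lebesgue (\<lambda>t. (1 + 1) * (cmod (u t))\<^sup>2 + (1 + 1 / 1) * (cmod (v t))\<^sup>2)"
      using u v by (auto simp: in_Lp_2_iff)
    show "AE t in lebesgue. norm ((cmod (u t + v t))\<^sup>2) \<le> norm ((1 + 1) * (cmod (u t))\<^sup>2 + (1 + 1 / 1) * (cmod (v t))\<^sup>2)"
      using norm_add_square_le[of 1] by (intro AE_I2) simp
  qed measurable
  then show ?thesis by (simp add: in_Lp_2_iff)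
qed

lemma in_Lp_2_uminus: "in_Lp 2 u \<Longrightarrow> in_Lp 2 (\<lambda>t. - u t)"
  by (simp add: in_Lp_2_iff)

lemma in_Lp_2_diff: "in_Lp 2 u \<Longrightarrow> in_Lp 2 v \<Longrightarrow> in_Lp 2 (\<lambda>t. u t - v t)"
  using in_Lp_2_add[OF _ in_Lp_2_uminus, of u v] by simp

lemma Lp_norm_2_add_le:
  assumes u: "in_Lp 2 u" and v: "in_Lp 2 v" and \<alpha>: "\<alpha> > 0"
  shows "(Lp_norm 2 (\<lambda>t. u t + v t))\<^sup>2 \<le> (1 + \<alpha>) * (Lp_norm 2 u)\<^sup>2 + (1 + 1 / \<alpha>) * (Lp_norm 2 v)\<^sup>2"
proof -
  have i: "integrable lebesgue (\<lambda>t. (cmod (u t))\<^sup>2)" "integrable lebesgue (\<lambda>t. (cmod (v t))\<^sup>2)"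
    "integrable lebesgue (\<lambda>t. (cmod (u t + v t))\<^sup>2)"
    using u v in_Lp_2_add[OF u v] by (auto simp: in_Lp_2_iff)
  have "(Lp_norm 2 (\<lambda>t. u t + v t))\<^sup>2 \<le> (\<integral>t. (1 + \<alpha>) * (cmod (u t))\<^sup>2 + (1 + 1 / \<alpha>) * (cmod (v t))\<^sup>2 \<partial>lebesgue)"
    unfolding Lp_norm_2_square using i norm_add_square_le[OF \<alpha>] by (intro integral_mono) auto
  also have "\<dots> = (1 + \<alpha>) * (Lp_norm 2 u)\<^sup>2 + (1 + 1 / \<alpha>) * (Lp_norm 2 v)\<^sup>2"
    unfolding Lp_norm_2_square using i by simp
  finally show ?thesis .
qed

lemma L2_inner_add:
  assumes u: "in_Lp 2 u" and v: "in_Lp 2 v" and e: "in_Lp 2 e"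
  shows "L2_inner (\<lambda>t. u t + v t) e = L2_inner u e + L2_inner v e"
proof -
  have int: "integrable lebesgue (\<lambda>t. f t * cnj (e t))" if f: "in_Lp 2 f" for f
  proof (rule Bochner_Integration.integrable_bound)
    have [measurable]: "f \<in> borel_measurable lebesgue" "e \<in> borel_measurable lebesgue"
      using f e by (auto simp: in_Lp_2_iff)
    show "integrable lebesgue (\<lambda>t. (cmod (f t))\<^sup>2 + (cmod (e t))\<^sup>2)"
      using f e by (auto simp: in_Lp_2_iff)
    show "(\<lambda>t. f t * cnj (e t)) \<in> borel_measurable lebesgue" by measurable
    show "AE t in lebesgue. norm (f t * cnj (e t)) \<le> norm ((cmod (f t))\<^sup>2 + (cmod (e t))\<^sup>2)"
    proof (rule AE_I2)
      fix t
      have "0 \<le> (cmod (f t) - cmod (e t))\<^sup>2" by simp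
      then have "2 * (cmod (f t) * cmod (e t)) \<le> (cmod (f t))\<^sup>2 + (cmod (e t))\<^sup>2"
        by (simp add: power2_diff)
      moreover have "0 \<le> cmod (f t) * cmod (e t)" by simp
      ultimately have "cmod (f t) * cmod (e t) \<le> (cmod (f t))\<^sup>2 + (cmod (e t))\<^sup>2" by linarith
      then show "norm (f t * cnj (e t)) \<le> norm ((cmod (f t))\<^sup>2 + (cmod (e t))\<^sup>2)"
        by (simp add: norm_mult)
    qed
  qed
  show ?thesis
    unfolding L2_inner_def using int[OF u] int[OF v] by (simp add: distrib_right)
qed

lemma frame_sum_add_le:
  assumes I: "countable I" and e: "\<And>j. j \<in> I \<Longrightarrow> in_Lp 2 (e j)"
    and u: "in_Lp 2 u" and v: "in_Lp 2 v" and \<alpha>: "\<alpha> > 0"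
  shows "frame_sum I e (\<lambda>t. u t + v t)
     \<le> ennreal (1 + \<alpha>) * frame_sum I e u + ennreal (1 + 1 / \<alpha>) * frame_sum I e v"
proof -
  have "frame_sum I e (\<lambda>t. u t + v t) = (\<integral>\<^sup>+j. sqn (L2_inner u (e j) + L2_inner v (e j)) \<partial>count_space I)"
    unfolding frame_sum_def infsum_ennreal_eq_nn_integral[OF I]
    by (intro nn_integral_cong) (simp add: L2_inner_add u v e)
  also have "\<dots> \<le> (\<integral>\<^sup>+j. ennreal (1 + \<alpha>) * sqn (L2_inner u (e j))
      + ennreal (1 + 1 / \<alpha>) * sqn (L2_inner v (e j)) \<partial>count_space I)"
  proof (rule nn_integral_mono)
    fix j
    show "sqn (L2_inner u (e j) + L2_inner v (e j))
      \<le> ennreal (1 + \<alpha>) * sqn (L2_inner u (e j))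
      + ennreal (1 + 1 / \<alpha>) * sqn (L2_inner v (e j))"
      using norm_add_square_le[OF \<alpha>, of "L2_inner u (e j)" "L2_inner v (e j)"] \<alpha>
      by (simp add: ennreal_mult[symmetric] ennreal_plus[symmetric] ennreal_leI del: ennreal_plus)
  qed
  also have "\<dots> = ennreal (1 + \<alpha>) * frame_sum I e u + ennreal (1 + 1 / \<alpha>) * frame_sum I e v"
    unfolding frame_sum_def infsum_ennreal_eq_nn_integral[OF I]
    by (simp add: nn_integral_add nn_integral_cmult)
  finally show ?thesis .
qed

text \<open>The values are projected radially to the ball of radius \<open>k\<close>, and the result is cut off continuously
  outside the ball of radius \<open>k\<close> in the domain. Both operations preserve continuity and act as the
  identity where \<open>f t\<close> and \<open>t\<close> have norm at most \<open>k\<close>.\<close>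

definition clamp_cut :: "real \<Rightarrow> (real ^ 'm \<Rightarrow> complex) \<Rightarrow> real ^ 'm \<Rightarrow> complex" where
  "clamp_cut k f t = (max 0 (min 1 (k + 1 - norm t)) * (k / max k (norm (f t)))) *\<^sub>R f t"

lemma clamp_cut_bounds:
  assumes "k > 0"
  shows "norm (clamp_cut k f t) \<le> norm (f t)"
    and "norm (clamp_cut k f t) \<le> k * indicator (cball 0 (k + 1)) t"
    and "norm (f t) \<le> k \<Longrightarrow> norm t \<le> k \<Longrightarrow> clamp_cut k f t = f t"
proof -
  define c where "c = max 0 (min 1 (k + 1 - norm t))"
  have c: "0 \<le> c" "c \<le> 1" by (auto simp: c_def)
  define d where "d = k / max k (norm (f t))"
  have d: "0 \<le> d" "d \<le> 1" "d * norm (f t) \<le> k"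
    using assms by (auto simp: d_def divide_le_eq max_def field_simps)
  have n: "norm (clamp_cut k f t) = c * (d * norm (f t))"
    using c d by (simp add: clamp_cut_def c_def[symmetric] d_def[symmetric] abs_mult)
  show "norm (clamp_cut k f t) \<le> norm (f t)"
    unfolding n using c d by (simp add: mult_le_one mult_left_le_one_le mult.assoc[symmetric])
  have "c = 0" if "t \<notin> cball 0 (k + 1)" using that by (auto simp: c_def)
  moreover have "c * (d * norm (f t)) \<le> 1 * k" using c d by (intro mult_mono) auto
  ultimately show "norm (clamp_cut k f t) \<le> k * indicator (cball 0 (k + 1)) t"
    unfolding n by (auto simp: indicator_def)
  show "clamp_cut k f t = f t" if "norm (f t) \<le> k" "norm t \<le> k"
    using that assms by (simp add: clamp_cut_def max_def)
qed

lemma test_fun_clamp_cut: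
  assumes k: "k > 0" and g: "continuous_on UNIV g"
  shows "test_fun (clamp_cut k g)"
proof -
  have "max k (norm (g t)) \<noteq> 0" for t using k by (auto simp: max_def)
  then have c: "continuous_on UNIV (clamp_cut k g)"
    unfolding clamp_cut_def[abs_def] using g by (intro continuous_intros) auto
  have le: "norm (clamp_cut k g t) \<le> k" for t
    using clamp_cut_bounds(2)[OF k, of g t] k by (cases "t \<in> cball 0 (k + 1)") auto
  have "integrable lborel (clamp_cut k g)"
  proof (rule Bochner_Integration.integrable_bound)
    show "integrable lborel (\<lambda>t :: real ^ 'a. k * indicator (cball 0 (k + 1)) t)"
      by (intro integrable_mult_right integrable_real_indicator) (use emeasure_bounded_finite[OF bounded_cball] in auto)
    show "clamp_cut k g \<in> borel_measurable lborel"
      using borel_measurable_continuous_onI[OF c] by simp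
    show "AE t in lborel. norm (clamp_cut k g t) \<le> norm (k * indicator (cball 0 (k + 1)) t)"
      unfolding real_norm_def by (intro AE_I2 order_trans[OF clamp_cut_bounds(2)[OF k] abs_ge_self])
  qed
  with c le show ?thesis unfolding test_fun_def by blast
qed

text \<open>First \<open>f\<close> is replaced by its truncation. A measurable function is the limit almost everywhere of
  continuous ones, and truncating these at the same level provides a dominating function for the convergence in
  \<open>L\<^sup>2\<close>.\<close>

lemma ex_test_fun_approx:
  fixes f :: "real ^ 'm \<Rightarrow> complex"
  assumes f: "in_Lp 2 f" and e: "e > 0"
  obtains \<phi> where "test_fun \<phi>" "(Lp_norm 2 (\<lambda>t. f t - \<phi> t))\<^sup>2 < e"
proof -
  have fm[measurable]: "f \<in> borel_measurable lebesgue" and fi: "integrable lebesgue (\<lambda>t. (cmod (f t))\<^sup>2)"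
    using f by (auto simp: in_Lp_2_iff)
  have "f measurable_on UNIV" using fm by (intro lebesgue_measurable_imp_measurable_on) auto
  then obtain Z g where Z: "negligible Z" and g: "\<And>n. continuous_on UNIV (g n)"
    and lim: "\<And>t. t \<notin> Z \<Longrightarrow> (\<lambda>n. g n t) \<longlonglongrightarrow> f t"
    unfolding measurable_on_def by auto
  have aeZ: "AE t in lebesgue. t \<notin> Z"
    using Z by (simp add: negligible_iff_null_sets AE_not_in)
  have cm: "clamp_cut k u \<in> borel_measurable lebesgue" if [measurable]: "u \<in> borel_measurable lebesgue" for k and u :: "real ^ 'm \<Rightarrow> complex"
  proof -
    have [measurable]: "(\<lambda>t :: real ^ 'm. norm t) \<in> borel_measurable lebesgue"
      by (rule measurable_completion) simp
    show ?thesis unfolding clamp_cut_def[abs_def] by measurable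
  qed
  have "(\<lambda>n. \<integral>t. (cmod (f t - clamp_cut (real (Suc n)) f t))\<^sup>2 \<partial>lebesgue) \<longlonglongrightarrow> (\<integral>t. 0 \<partial>(lebesgue :: (real ^ 'm) measure))"
  proof (rule integral_dominated_convergence[where w = "\<lambda>t. 4 * (cmod (f t))\<^sup>2"])
    show "AE t in lebesgue. (\<lambda>n. (cmod (f t - clamp_cut (real (Suc n)) f t))\<^sup>2) \<longlonglongrightarrow> 0"
    proof (rule AE_I2, rule tendsto_eventually)
      fix t
      obtain n0 where n0: "max (norm (f t)) (norm t) < real n0" using reals_Archimedean2 by blast
      show "\<forall>\<^sub>F n in sequentially. (cmod (f t - clamp_cut (real (Suc n)) f t))\<^sup>2 = 0"
        unfolding eventually_sequentially
      proof (intro exI allI impI)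
        fix n assume "n0 \<le> n"
        then have "norm (f t) \<le> real (Suc n)" "norm t \<le> real (Suc n)" using n0 by auto
        then show "(cmod (f t - clamp_cut (real (Suc n)) f t))\<^sup>2 = 0"
          using clamp_cut_bounds(3)[of "real (Suc n)" f t] by simp
      qed
    qed
    show "AE t in lebesgue. norm ((cmod (f t - clamp_cut (real (Suc n)) f t))\<^sup>2) \<le> 4 * (cmod (f t))\<^sup>2" for n
    proof (rule AE_I2)
      fix t
      have "cmod (f t - clamp_cut (real (Suc n)) f t) \<le> cmod (f t) + cmod (f t)"
        by (rule order_trans[OF norm_triangle_ineq4]) (simp add: clamp_cut_bounds(1) del: of_nat_Suc)
      then have "(cmod (f t - clamp_cut (real (Suc n)) f t))\<^sup>2 \<le> (2 * cmod (f t))\<^sup>2"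
        by (intro power_mono) auto
      then show "norm ((cmod (f t - clamp_cut (real (Suc n)) f t))\<^sup>2) \<le> 4 * (cmod (f t))\<^sup>2"
        by (simp add: power_mult_distrib)
    qed
  qed (use fi cm[OF fm] in \<open>auto simp del: of_nat_Suc\<close>)
  then have "\<forall>\<^sub>F n in sequentially. (\<integral>t. (cmod (f t - clamp_cut (real (Suc n)) f t))\<^sup>2 \<partial>lebesgue) < e / 4"
    using e by (intro order_tendstoD(2)) auto
  then obtain n where n: "(\<integral>t. (cmod (f t - clamp_cut (real (Suc n)) f t))\<^sup>2 \<partial>lebesgue) < e / 4"
    by (auto simp: eventually_sequentially)
  define k where "k = real (Suc n)"
  have k: "k > 0" by (simp add: k_def)
  have gm: "g i \<in> borel_measurable lebesgue" for i
    using borel_measurable_continuous_onI[OF g] by (intro measurable_completion) simp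
  have "(\<lambda>i. \<integral>t. (cmod (clamp_cut k f t - clamp_cut k (g i) t))\<^sup>2 \<partial>lebesgue) \<longlonglongrightarrow> (\<integral>t. 0 \<partial>(lebesgue :: (real ^ 'm) measure))"
  proof (rule integral_dominated_convergence[where w = "\<lambda>t. 4 * k\<^sup>2 * indicator (cball 0 (k + 1)) t"])
    show "AE t in lebesgue. (\<lambda>i. (cmod (clamp_cut k f t - clamp_cut k (g i) t))\<^sup>2) \<longlonglongrightarrow> 0"
      using aeZ
    proof eventually_elim
      case (elim t)
      have "max k (norm (f t)) \<noteq> 0" using k by (auto simp: max_def)
      then have "(\<lambda>i. clamp_cut k (g i) t) \<longlonglongrightarrow> clamp_cut k f t"
        unfolding clamp_cut_def by (intro tendsto_intros lim[OF elim])
      then have "(\<lambda>i. (cmod (clamp_cut k f t - clamp_cut k (g i) t))\<^sup>2) \<longlonglongrightarrow> (cmod (clamp_cut k f t - clamp_cut k f t))\<^sup>2"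
        by (intro tendsto_intros)
      then show ?case by simp
    qed
    show "AE t in lebesgue. norm ((cmod (clamp_cut k f t - clamp_cut k (g i) t))\<^sup>2) \<le> 4 * k\<^sup>2 * indicator (cball 0 (k + 1)) t" for i
    proof (rule AE_I2)
      fix t :: "real ^ 'm"
      have "cmod (clamp_cut k f t - clamp_cut k (g i) t) \<le> 2 * k * indicator (cball 0 (k + 1)) t"
        using norm_triangle_ineq4[of "clamp_cut k f t" "clamp_cut k (g i) t"]
          clamp_cut_bounds(2)[OF k, of f t] clamp_cut_bounds(2)[OF k, of "g i" t] by linarith
      then have "(cmod (clamp_cut k f t - clamp_cut k (g i) t))\<^sup>2 \<le> (2 * k * indicator (cball 0 (k + 1)) t)\<^sup>2"
        by (intro power_mono) auto
      also have "\<dots> = 4 * k\<^sup>2 * indicator (cball 0 (k + 1)) t"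
        by (simp add: indicator_def power_mult_distrib)
      finally show "norm ((cmod (clamp_cut k f t - clamp_cut k (g i) t))\<^sup>2) \<le> 4 * k\<^sup>2 * indicator (cball 0 (k + 1)) t"
        by simp
    qed
    show "integrable lebesgue (\<lambda>t :: real ^ 'm. 4 * k\<^sup>2 * indicator (cball 0 (k + 1)) t)"
      by (intro integrable_mult_right integrable_real_indicator) (use emeasure_bounded_finite[OF bounded_cball] in auto)
  qed (use cm[OF fm] cm[OF gm] in auto)
  then have "\<forall>\<^sub>F i in sequentially. (\<integral>t. (cmod (clamp_cut k f t - clamp_cut k (g i) t))\<^sup>2 \<partial>lebesgue) < e / 4"
    using e by (intro order_tendstoD(2)) auto
  then obtain i where i: "(\<integral>t. (cmod (clamp_cut k f t - clamp_cut k (g i) t))\<^sup>2 \<partial>lebesgue) < e / 4"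
    by (auto simp: eventually_sequentially)
  have F: "in_Lp 2 (clamp_cut k f)"
  proof -
    have "integrable lebesgue (\<lambda>t. (cmod (clamp_cut k f t))\<^sup>2)"
    proof (rule Bochner_Integration.integrable_bound[OF fi])
      show "(\<lambda>t. (cmod (clamp_cut k f t))\<^sup>2) \<in> borel_measurable lebesgue"
        using cm[OF fm, of k] by measurable
      show "AE t in lebesgue. norm ((cmod (clamp_cut k f t))\<^sup>2) \<le> norm ((cmod (f t))\<^sup>2)"
        using clamp_cut_bounds(1)[OF k] by (intro AE_I2) (simp add: power_mono)
    qed
    then show ?thesis using cm[OF fm] by (simp add: in_Lp_2_iff)
  qed
  have \<phi>: "test_fun (clamp_cut k (g i))" by (rule test_fun_clamp_cut[OF k g])
  have "(Lp_norm 2 (\<lambda>t. (f t - clamp_cut k f t) + (clamp_cut k f t - clamp_cut k (g i) t)))\<^sup>2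
     \<le> (1 + 1) * (Lp_norm 2 (\<lambda>t. f t - clamp_cut k f t))\<^sup>2 + (1 + 1 / 1) * (Lp_norm 2 (\<lambda>t. clamp_cut k f t - clamp_cut k (g i) t))\<^sup>2"
    by (intro Lp_norm_2_add_le in_Lp_2_diff f F test_fun_in_Lp(1)[OF \<phi>]) simp
  also have "\<dots> < e"
    unfolding Lp_norm_2_square using n i by (simp add: k_def)
  finally have "(Lp_norm 2 (\<lambda>t. f t - clamp_cut k (g i) t))\<^sup>2 < e" by simp
  with \<phi> show ?thesis by (rule that)
qed

section \<open>From a tight frame to the condition on the Fourier transforms\<close>

text \<open>The mean of a constant is the constant, so the integrals of \<open>\<bar>F\<bar>\<^sup>2 D S\<close> and of
  \<open>\<bar>F\<bar>\<^sup>2\<close> agree for the Fourier transform \<open>F\<close> of every test function.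
  Modulated Gaussians yield all Gaussian bumps as \<open>\<bar>F\<bar>\<^sup>2\<close>, up to a constant factor.\<close>

lemma fiber_sum_eq_1_of_constant_model_sum:
  fixes h :: "nat \<Rightarrow> real ^ 'm \<Rightarrow> complex"
  assumes \<Lambda>: "countable \<Lambda>" "has_uniform_density \<Lambda> D" "D > 0" and \<Delta>: "countable \<Delta>"
    and h: "\<And>l. l \<in> {1..L} \<Longrightarrow> integrable lborel (h l)"
    and tight: "\<And>f x. test_fun f \<Longrightarrow> (shifted_sum \<Lambda> (window_energy L \<Delta> h f) x) = ennreal (energy f)"
  shows "AE \<omega> in lborel. ennreal D * fiber_sum L \<Delta> h \<omega> = 1"
proof (rule AE_eq_1_of_gaussian_averages)
  have hb: "h l \<in> borel_measurable borel" if "l \<in> {1..L}" for l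
    using borel_measurable_integrable[OF h[OF that]] by simp
  have Sb[measurable]: "fiber_sum L \<Delta> h \<in> borel_measurable borel"
    by (rule fiber_sum_borel[OF hb \<Delta>])
  show "(\<lambda>\<omega>. ennreal D * fiber_sum L \<Delta> h \<omega>) \<in> borel_measurable borel" by measurable
  fix r :: real and \<eta> :: "real ^ 'm"
  assume r: "r > 0"
  \<comment> \<open>Squaring a Gaussian divides its width by \<open>sqrt 2\<close>.\<close>
  define q where "q = sqrt 2 * r"
  have q: "q > 0" using r by (simp add: q_def)
  define f where "f t = exp (- (2 * pi * q * norm t)\<^sup>2 / 2) *\<^sub>R cis (2 * pi * (\<eta> \<bullet> t))" for t
  have f: "test_fun f"
    unfolding test_fun_def
  proof (intro conjI exI allI)
    show c: "continuous_on UNIV f" unfolding f_def by (intro continuous_intros) auto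
    show "norm (f t) \<le> 1" for t by (simp add: f_def)
    have "integrable lborel (\<lambda>t :: real ^ 'm. exp (- (2 * pi * q * norm t)\<^sup>2 / 2))"
      using q by (intro integrable_exp_norm_square) simp
    then show "integrable lborel f"
      by (rule Bochner_Integration.integrable_bound)
         (use borel_measurable_continuous_onI[OF c] in \<open>auto simp: f_def\<close>)
  qed
  define K where "K = 1 / (sqrt (2 * pi) ^ CARD('m) * (q ^ CARD('m))\<^sup>2)"
  have K: "K > 0" using q by (simp add: K_def)
  have ftf: "(norm (ft f \<omega>))\<^sup>2 = K * gauss ((\<omega> - \<eta>) /\<^sub>R r)" for \<omega>
  proof -
    have "ft f \<omega> = complex_of_real (gauss ((\<omega> - \<eta>) /\<^sub>R q) / q ^ CARD('m))"
      unfolding f_def ft_gauss_modulated[OF q] by simp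
    then have "(norm (ft f \<omega>))\<^sup>2 = (gauss ((\<omega> - \<eta>) /\<^sub>R q) / q ^ CARD('m))\<^sup>2"
      by (simp only: norm_of_real power2_abs)
    also have "\<dots> = (gauss ((\<omega> - \<eta>) /\<^sub>R q))\<^sup>2 / (q ^ CARD('m))\<^sup>2" by (rule power_divide)
    also have "(gauss ((\<omega> - \<eta>) /\<^sub>R q))\<^sup>2 = gauss ((\<omega> - \<eta>) /\<^sub>R r) / sqrt (2 * pi) ^ CARD('m)"
    proof -
      have "(norm ((\<omega> - \<eta>) /\<^sub>R q))\<^sup>2 = (norm ((\<omega> - \<eta>) /\<^sub>R r))\<^sup>2 / 2"
      proof -
        have n: "norm (w /\<^sub>R c) = norm w / c" if "c > 0" for c :: real and w :: "real ^ 'm"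
          using that by (simp add: divide_inverse mult.commute)
        show ?thesis
          unfolding n[OF q] n[OF r] by (simp add: q_def power_mult_distrib power_divide)
      qed
      then have "(exp (- (norm ((\<omega> - \<eta>) /\<^sub>R q))\<^sup>2 / 2))\<^sup>2 = exp (- (norm ((\<omega> - \<eta>) /\<^sub>R r))\<^sup>2 / 2)"
        by (simp add: exp_double[symmetric])
      moreover define S where "S = sqrt (2 * pi) ^ CARD('m)"
      moreover have g: "gauss v = exp (- (norm v)\<^sup>2 / 2) / S" for v :: "real ^ 'm"
        by (simp add: gauss_def S_def)
      ultimately show ?thesis
        unfolding S_def[symmetric] g power_divide by (simp only: power2_eq_square[of S] divide_divide_eq_left)
    qed
    finally show ?thesis by (simp add: K_def)
  qed
  have Kg: "ennreal (K * gauss v) = ennreal K * ennreal (gauss v)" for v :: "real ^ 'm"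
    using K gauss_pos[of v] by (intro ennreal_mult) auto
  have "ennreal D * (\<integral>\<^sup>+y. window_energy L \<Delta> h f y \<partial>lborel) = ennreal (energy f)"
    by (rule model_mean_eq[OF \<Lambda> window_energy_borel[OF test_fun_borel[OF f] hb \<Delta>] energy_nonneg tight[OF f]])
  also have "\<dots> = (\<integral>\<^sup>+t. sqn (f t) \<partial>lborel)"
    by (rule nn_integral_energy[OF f, symmetric])
  also have "\<dots> = (\<integral>\<^sup>+\<omega>. sqn (ft f \<omega>) \<partial>lborel)"
  proof -
    obtain M where "continuous_on UNIV f" "\<And>x. norm (f x) \<le> M" "integrable lborel f"
      using f unfolding test_fun_def by blast
    then show ?thesis by (rule plancherel(1)[symmetric])
  qed
  also have "\<dots> = ennreal K * (\<integral>\<^sup>+\<omega>. bump r \<eta> \<omega> \<partial>lborel)"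
    unfolding ftf Kg by (rule nn_integral_cmult) measurable
  also have "ennreal D * (\<integral>\<^sup>+y. window_energy L \<Delta> h f y \<partial>lborel)
      = ennreal K * (\<integral>\<^sup>+\<omega>. bump r \<eta> \<omega> * (ennreal D * fiber_sum L \<Delta> h \<omega>) \<partial>lborel)"
  proof -
    have we: "(\<integral>\<^sup>+y. window_energy L \<Delta> h f y \<partial>lborel)
        = (\<integral>\<^sup>+\<omega>. sqn (ft f \<omega>) * fiber_sum L \<Delta> h \<omega> \<partial>lborel)"
      by (rule nn_integral_window_energy[OF f h \<Delta>])
    have "ennreal D * (\<integral>\<^sup>+y. window_energy L \<Delta> h f y \<partial>lborel)
        = ennreal D * (\<integral>\<^sup>+\<omega>. ennreal K * bump r \<eta> \<omega> * fiber_sum L \<Delta> h \<omega> \<partial>lborel)"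
      by (simp only: we ftf Kg)
    also have "\<dots> = (\<integral>\<^sup>+\<omega>. ennreal D * (ennreal K * bump r \<eta> \<omega> * fiber_sum L \<Delta> h \<omega>) \<partial>lborel)"
      by (rule nn_integral_cmult[symmetric]) measurable
    also have "\<dots> = (\<integral>\<^sup>+\<omega>. ennreal K * (bump r \<eta> \<omega> * (ennreal D * fiber_sum L \<Delta> h \<omega>)) \<partial>lborel)"
      by (simp only: ac_simps)
    also have "\<dots> = ennreal K * (\<integral>\<^sup>+\<omega>. bump r \<eta> \<omega> * (ennreal D * fiber_sum L \<Delta> h \<omega>) \<partial>lborel)"
      by (rule nn_integral_cmult) measurable
    finally show ?thesis .
  qed
  finally have eq: "ennreal K * (\<integral>\<^sup>+\<omega>. bump r \<eta> \<omega> * (ennreal D * fiber_sum L \<Delta> h \<omega>) \<partial>lborel)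
      = ennreal K * (\<integral>\<^sup>+\<omega>. bump r \<eta> \<omega> \<partial>lborel)" .
  have K0: "ennreal K \<noteq> 0" using K by (simp only: ennreal_eq_0_iff not_le)
  from eq K0 show "(\<integral>\<^sup>+\<omega>. bump r \<eta> \<omega> * (ennreal D * fiber_sum L \<Delta> h \<omega>) \<partial>lborel)
      = (\<integral>\<^sup>+\<omega>. bump r \<eta> \<omega> \<partial>lborel)"
    using ennreal_mult_cancel_left[of "ennreal K"] ennreal_neq_top[of K] by blast
qed

section \<open>From the condition on the Fourier transforms to a tight frame\<close>

lemma test_fun_diff: "test_fun u \<Longrightarrow> test_fun v \<Longrightarrow> test_fun (\<lambda>t. u t - v t)"
proof -
  assume u: "test_fun u" and v: "test_fun v"
  then obtain M M' where M: "\<And>x. norm (u x) \<le> M" "\<And>x. norm (v x) \<le> M'"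
    unfolding test_fun_def by blast
  have "norm (u x - v x) \<le> M + M'" for x
    using norm_triangle_ineq4[of "u x" "v x"] M(1)[of x] M(2)[of x] by linarith
  moreover have "continuous_on UNIV (\<lambda>t. u t - v t)" "integrable lborel (\<lambda>t. u t - v t)"
    using u v by (auto simp: test_fun_def intro!: continuous_intros)
  ultimately show ?thesis unfolding test_fun_def by blast
qed

text \<open>Expanding the square expresses the energy of the difference by the autocorrelation of \<open>f\<close>, which is
  continuous at \<open>0\<close>.\<close>

lemma energy_translation_diff_small:
  fixes f :: "real ^ 'm \<Rightarrow> complex"
  assumes f: "test_fun f" and e: "e > 0"
  obtains \<rho> where "\<rho> > 0" "\<And>y. norm y < \<rho> \<Longrightarrow> energy (\<lambda>t. translation y f t - f t) < e"
proof -
  have [measurable]: "f \<in> borel_measurable borel" by (rule test_fun_borel[OF f])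
  obtain M where f': "continuous_on UNIV f" "\<And>x. norm (f x) \<le> M" "integrable lborel f"
    using f unfolding test_fun_def by blast
  have E: "energy (\<lambda>t. translation y f t - f t) = 2 * energy f - 2 * Re (corr f f y)" for y
  proof -
    have i1: "integrable lborel (\<lambda>t. (norm (f t))\<^sup>2)" by (rule test_fun_square_integrable[OF f])
    have i2: "integrable lborel (\<lambda>t. (norm (f (t - y)))\<^sup>2)"
      using test_fun_square_integrable[OF test_fun_translation[OF f, of y]] by (simp add: translation_def)
    have i3: "integrable lborel (\<lambda>t. f t * cnj (f (t - y)))"
    proof (rule Bochner_Integration.integrable_bound)
      show "integrable lborel (\<lambda>t. M * norm (f t))" using f'(3) by simp
      show "AE t in lborel. norm (f t * cnj (f (t - y))) \<le> norm (M * norm (f t))"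
      proof (rule AE_I2)
        fix t
        have "norm (f (t - y)) * norm (f t) \<le> M * norm (f t)" using f'(2) by (intro mult_right_mono) auto
        then show "norm (f t * cnj (f (t - y))) \<le> norm (M * norm (f t))"
          by (simp add: norm_mult mult.commute abs_le_iff order_trans[OF _ abs_ge_self])
      qed
    qed simp
    have "energy (\<lambda>t. translation y f t - f t)
        = (\<integral>t. (norm (f (t - y)))\<^sup>2 + (norm (f t))\<^sup>2 - 2 * Re (f t * cnj (f (t - y))) \<partial>lborel)"
      unfolding energy_def translation_def
      by (intro Bochner_Integration.integral_cong refl)
         (simp add: cmod_power2 power2_diff algebra_simps)
    also have "\<dots> = (\<integral>t. (norm (f (t - y)))\<^sup>2 \<partial>lborel) + energy f - 2 * Re (corr f f y)"
    proof -
      define k where "k t = f t * cnj (f (t - y))" for t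
      have k: "integrable lborel k" using i3 by (simp add: k_def[abs_def])
      show ?thesis
        unfolding energy_def corr_def k_def[symmetric] using i1 i2 k by (simp add: integral_Re)
    qed
    also have "(\<integral>t. (norm (f (t - y)))\<^sup>2 \<partial>lborel) = energy f"
      using energy_translation[OF f, of y] by (simp add: energy_def translation_def)
    finally show ?thesis by simp
  qed
  have c0: "Re (corr f f 0) = energy f"
    using E[of 0] by (simp add: translation_def energy_def)
  have "isCont (\<lambda>y. Re (corr f f y)) 0"
    by (intro isCont_Re isCont_of_cont_UNIV corr_continuous_bounded(1)[OF f'])
  then have "\<forall>\<^sub>F y in at 0. dist (Re (corr f f y)) (Re (corr f f 0)) < e / 2"
    unfolding isCont_def using e by (intro tendstoD) auto
  then obtain \<rho> where \<rho>: "\<rho> > 0" "\<And>y. y \<noteq> 0 \<Longrightarrow> dist y 0 < \<rho> \<Longrightarrow> dist (Re (corr f f y)) (Re (corr f f 0)) < e / 2"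
    unfolding eventually_at by auto
  have "energy (\<lambda>t. translation y f t - f t) < e" if "norm y < \<rho>" for y
  proof (cases "y = 0")
    case True
    then show ?thesis using e by (simp add: translation_def energy_def)
  next
    case False
    then have "dist (Re (corr f f y)) (Re (corr f f 0)) < e / 2" using \<rho>(2) that by simp
    then show ?thesis unfolding E c0 dist_real_def by arith
  qed
  with \<rho>(1) show ?thesis by (rule that)
qed

text \<open>Only the lower bound is at stake. For a test function \<open>\<phi>\<close> near \<open>f\<close>, the norm of
  \<open>f\<close> is close to that of \<open>\<phi>\<close>, which equals the frame sum of \<open>\<phi>\<close>,
  and by the Bessel bound the latter is close to the frame sum of \<open>f\<close>.\<close>

lemma tight_of_tight_on_test_fun:
  fixes e :: "'i \<Rightarrow> real ^ 'm \<Rightarrow> complex"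
  assumes I: "countable I" and bessel: "is_Bessel_seq 1 I e"
    and test_fun: "\<And>\<phi>. test_fun \<phi> \<Longrightarrow> frame_sum I e \<phi> = ennreal (energy \<phi>)"
    and f: "in_Lp 2 f"
  shows "frame_sum I e f = ennreal ((Lp_norm 2 f)\<^sup>2)"
proof (rule antisym)
  have eL: "\<And>j. j \<in> I \<Longrightarrow> in_Lp 2 (e j)" and B: "\<And>f. in_Lp 2 f \<Longrightarrow> frame_sum I e f \<le> ennreal ((Lp_norm 2 f)\<^sup>2)"
    using bessel by (auto simp: is_Bessel_seq_def frame_sum_def)
  show "frame_sum I e f \<le> ennreal ((Lp_norm 2 f)\<^sup>2)" by (rule B[OF f])
  then obtain s where s: "frame_sum I e f = ennreal s" "0 \<le> s"
    by (cases "frame_sum I e f") (auto simp: top_unique)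
  have key: "(Lp_norm 2 f)\<^sup>2 \<le> (1 + \<alpha>) * ((1 + \<alpha>) * s + (1 + 1 / \<alpha>) * \<alpha>\<^sup>2) + (1 + 1 / \<alpha>) * \<alpha>\<^sup>2" if \<alpha>: "\<alpha> > 0" for \<alpha>
  proof -
    obtain \<phi> where \<phi>: "test_fun \<phi>" "(Lp_norm 2 (\<lambda>t. f t - \<phi> t))\<^sup>2 < \<alpha>\<^sup>2"
      using ex_test_fun_approx[OF f, of "\<alpha>\<^sup>2"] \<alpha> by auto
    have \<phi>L: "in_Lp 2 \<phi>" "(Lp_norm 2 \<phi>)\<^sup>2 = energy \<phi>" by (rule test_fun_in_Lp[OF \<phi>(1)])+
    have d: "in_Lp 2 (\<lambda>t. f t - \<phi> t)" by (rule in_Lp_2_diff[OF f \<phi>L(1)])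
    have d': "(Lp_norm 2 (\<lambda>t. - (f t - \<phi> t)))\<^sup>2 = (Lp_norm 2 (\<lambda>t. f t - \<phi> t))\<^sup>2"
      unfolding Lp_norm_2_square norm_minus_cancel ..
    have "ennreal (energy \<phi>) = frame_sum I e (\<lambda>t. f t + - (f t - \<phi> t))"
      using test_fun[OF \<phi>(1)] by simp
    also have "\<dots> \<le> ennreal (1 + \<alpha>) * frame_sum I e f + ennreal (1 + 1 / \<alpha>) * frame_sum I e (\<lambda>t. - (f t - \<phi> t))"
      by (rule frame_sum_add_le[OF I eL f in_Lp_2_uminus[OF d] \<alpha>])
    also have "\<dots> \<le> ennreal (1 + \<alpha>) * ennreal s + ennreal (1 + 1 / \<alpha>) * ennreal (\<alpha>\<^sup>2)"
      unfolding s(1)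
    proof (intro add_mono mult_left_mono order_refl)
      have "frame_sum I e (\<lambda>t. - (f t - \<phi> t)) \<le> ennreal ((Lp_norm 2 (\<lambda>t. - (f t - \<phi> t)))\<^sup>2)"
        by (rule B[OF in_Lp_2_uminus[OF d]])
      also have "\<dots> \<le> ennreal (\<alpha>\<^sup>2)" unfolding d' using \<phi>(2) by (intro ennreal_leI) simp
      finally show "frame_sum I e (\<lambda>t. - (f t - \<phi> t)) \<le> ennreal (\<alpha>\<^sup>2)" .
    qed auto
    also have "\<dots> = ennreal ((1 + \<alpha>) * s + (1 + 1 / \<alpha>) * \<alpha>\<^sup>2)"
      using s(2) \<alpha> by (simp add: ennreal_mult[symmetric] ennreal_plus[symmetric] del: ennreal_plus)
    finally have en: "energy \<phi> \<le> (1 + \<alpha>) * s + (1 + 1 / \<alpha>) * \<alpha>\<^sup>2"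
      using s(2) \<alpha> by (subst (asm) ennreal_le_iff) auto
    have "(Lp_norm 2 f)\<^sup>2 = (Lp_norm 2 (\<lambda>t. \<phi> t + (f t - \<phi> t)))\<^sup>2" by simp
    also have "\<dots> \<le> (1 + \<alpha>) * (Lp_norm 2 \<phi>)\<^sup>2 + (1 + 1 / \<alpha>) * (Lp_norm 2 (\<lambda>t. f t - \<phi> t))\<^sup>2"
      by (rule Lp_norm_2_add_le[OF \<phi>L(1) d \<alpha>])
    also have "\<dots> \<le> (1 + \<alpha>) * ((1 + \<alpha>) * s + (1 + 1 / \<alpha>) * \<alpha>\<^sup>2) + (1 + 1 / \<alpha>) * \<alpha>\<^sup>2"
      unfolding \<phi>L(2) using en \<phi>(2) \<alpha> by (intro add_mono mult_left_mono) auto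
    finally show ?thesis .
  qed
  \<comment> \<open>The tolerance \<open>\<alpha>\<^sup>2\<close> compensates the factor \<open>1 + 1 / \<alpha>\<close>, so that a single limit \<open>\<alpha> \<rightarrow> 0\<close> remains.\<close>
  have simp_eq: "(1 + 1 / \<alpha>) * \<alpha>\<^sup>2 = \<alpha>\<^sup>2 + \<alpha>" if "\<alpha> > 0" for \<alpha> :: real
    using that by (simp add: field_simps power2_eq_square)
  have "((\<lambda>\<alpha>. (1 + \<alpha>) * ((1 + \<alpha>) * s + (\<alpha>\<^sup>2 + \<alpha>)) + (\<alpha>\<^sup>2 + \<alpha>))
      \<longlongrightarrow> (1 + 0) * ((1 + 0) * s + (0\<^sup>2 + 0)) + (0\<^sup>2 + 0)) (at_right 0)"
    by (intro tendsto_intros)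
  moreover have "\<forall>\<^sub>F \<alpha> in at_right 0. (Lp_norm 2 f)\<^sup>2 \<le> (1 + \<alpha>) * ((1 + \<alpha>) * s + (\<alpha>\<^sup>2 + \<alpha>)) + (\<alpha>\<^sup>2 + \<alpha>)"
    unfolding eventually_at_right_field using key by (auto simp: simp_eq intro!: exI[of _ 1])
  ultimately have "(Lp_norm 2 f)\<^sup>2 \<le> (1 + 0) * ((1 + 0) * s + (0\<^sup>2 + 0)) + (0\<^sup>2 + 0)"
    by (rule tendsto_lowerbound) simp
  then show "ennreal ((Lp_norm 2 f)\<^sup>2) \<le> frame_sum I e f"
    unfolding s(1) by (intro ennreal_leI) simp
qed

lemma uniform_discrete_imp_countable:
  fixes S :: "'a::heine_borel set"
  assumes "uniform_discrete S"
  shows "countable S"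
proof -
  have "finite (S \<inter> cball undefined (real n))" for n
    using assms uniform_discrete_subset[of S "S \<inter> cball undefined (real n)"] bounded_cball
    unfolding uniform_discrete_finite_iff[symmetric] by (auto intro: bounded_subset)
  then have "countable (\<Union>n. S \<inter> cball undefined (real n))"
    by (intro countable_UN[OF countableI_type] countable_finite)
  moreover have "S \<subseteq> (\<Union>n. S \<inter> cball undefined (real n))"
  proof
    fix x assume "x \<in> S"
    moreover obtain n where "dist undefined x \<le> real n" using real_arch_simple by blast
    ultimately show "x \<in> (\<Union>n. S \<inter> cball undefined (real n))" by auto
  qed
  ultimately show ?thesis by (rule countable_subset[rotated])
qed

text \<open>A translate of \<open>f\<close> tested against a translate by \<open>z\<close> depends only on the difference of
  the two translations.\<close>

lemma frame_sum_gabor_translation: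
  fixes f :: "real ^ 'm \<Rightarrow> complex"
  assumes f: "test_fun f" and h: "\<And>l. l \<in> {1..L} \<Longrightarrow> h l \<in> borel_measurable borel"
    and ae: "\<And>l. l \<in> {1..L} \<Longrightarrow> AE t in lebesgue. g l t = h l t"
    and \<Lambda>: "countable \<Lambda>" and \<Delta>: "countable \<Delta>"
  shows "frame_sum (gabor_index L \<Lambda> \<Delta>) (gabor g) (translation x f)
       = (shifted_sum \<Lambda> (window_energy L \<Delta> h f) x)"
proof -
  have "window_energy L \<Delta> h (translation x f) z = window_energy L \<Delta> h f (z - x)" for z
    unfolding window_energy_def
    by (intro sum.cong refl nn_integral_cong)
       (simp add: corr_translation test_fun_borel[OF f] modulation_borel h)
  then show ?thesis
    using frame_sum_gabor[where L = L and h = h and g = g, OF test_fun_borel[OF test_fun_translation[OF f, of x]] h ae \<Lambda> \<Delta>] by simp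
qed

text \<open>This checks the hypotheses of \<open>model_sum_attains_mean\<close> for the function that assigns to
  \<open>x\<close> the frame sum of the translate of \<open>f\<close> by \<open>x\<close>: the bound and the
  quasi-continuity come from the Bessel inequality, the mean value from Plancherel's theorem and the condition on
  the Fourier transforms.\<close>

lemma tight_on_test_fun_of_fiber_sum:
  fixes \<Gamma> :: "((real ^ 'm) \<times> real) set" and g h :: "nat \<Rightarrow> real ^ 'm \<Rightarrow> complex"
  assumes cp: "cut_and_project \<Gamma>" and ab: "a < b"
    and p: "p > 0" "\<And>a b. a < b \<Longrightarrow> has_uniform_density (model_set \<Gamma> {a..b}) ((b - a) / p)"
    and \<Delta>: "countable \<Delta>" and h: "\<And>l. l \<in> {1..L} \<Longrightarrow> integrable lborel (h l)"
    and ae: "\<And>l. l \<in> {1..L} \<Longrightarrow> AE t in lebesgue. g l t = h l t"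
    and bessel: "is_Bessel_seq 1 (gabor_index L (model_set \<Gamma> {a..b}) \<Delta>) (gabor g)"
    and fiber: "AE \<omega> in lborel. ennreal ((b - a) / p) * fiber_sum L \<Delta> h \<omega> = 1"
    and f: "test_fun f"
  shows "frame_sum (gabor_index L (model_set \<Gamma> {a..b}) \<Delta>) (gabor g) f = ennreal (energy f)"
proof -
  let ?I = "gabor_index L (model_set \<Gamma> {a..b}) \<Delta>"
  have \<Lambda>: "countable (model_set \<Gamma> {a..b})"
    using cp by (intro countable_model_set countable_lattice) (simp add: cut_and_project_def)
  have I: "countable ?I"
    unfolding gabor_index_def using \<Lambda> \<Delta> by (auto intro: countable_finite)
  have hb: "h l \<in> borel_measurable borel" if "l \<in> {1..L}" for l
    using borel_measurable_integrable[OF h[OF that]] by simp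
  have eL: "\<And>j. j \<in> ?I \<Longrightarrow> in_Lp 2 (gabor g j)"
    and B: "\<And>f. in_Lp 2 f \<Longrightarrow> frame_sum ?I (gabor g) f \<le> ennreal ((Lp_norm 2 f)\<^sup>2)"
    using bessel by (auto simp: is_Bessel_seq_def frame_sum_def)
  have B': "frame_sum ?I (gabor g) \<phi> \<le> ennreal (energy \<phi>)" if "test_fun \<phi>" for \<phi>
    using B[OF test_fun_in_Lp(1)[OF that]] by (simp add: test_fun_in_Lp(2)[OF that])
  let ?W = "window_energy L \<Delta> h f"
  have shift: "frame_sum ?I (gabor g) (translation x f) = (shifted_sum (model_set \<Gamma> {a..b}) ?W x)" for x
    by (rule frame_sum_gabor_translation[OF f hb ae \<Lambda> \<Delta>])
  have [measurable]: "fiber_sum L \<Delta> h \<in> borel_measurable borel"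
    by (rule fiber_sum_borel[OF hb \<Delta>])
  have mean: "ennreal ((b - a) / p) * (\<integral>\<^sup>+y. ?W y \<partial>lborel) = ennreal (energy f)"
  proof -
    have [measurable]: "f \<in> borel_measurable borel" by (rule test_fun_borel[OF f])
    obtain M where f': "continuous_on UNIV f" "\<And>x. norm (f x) \<le> M" "integrable lborel f"
      using f unfolding test_fun_def by blast
    have we: "(\<integral>\<^sup>+y. ?W y \<partial>lborel) = (\<integral>\<^sup>+\<omega>. sqn (ft f \<omega>) * fiber_sum L \<Delta> h \<omega> \<partial>lborel)"
      by (rule nn_integral_window_energy[OF f h \<Delta>])
    have "ennreal ((b - a) / p) * (\<integral>\<^sup>+y. ?W y \<partial>lborel)
        = (\<integral>\<^sup>+\<omega>. ennreal ((b - a) / p) * (sqn (ft f \<omega>) * fiber_sum L \<Delta> h \<omega>) \<partial>lborel)"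
      unfolding we by (rule nn_integral_cmult[symmetric]) measurable
    also have "\<dots> = (\<integral>\<^sup>+\<omega>. sqn (ft f \<omega>) \<partial>lborel)"
    proof (rule nn_integral_cong_AE)
      show "AE \<omega> in lborel. ennreal ((b - a) / p) * (sqn (ft f \<omega>) * fiber_sum L \<Delta> h \<omega>)
          = sqn (ft f \<omega>)"
        using fiber
      proof eventually_elim
        case (elim \<omega>)
        have "ennreal ((b - a) / p) * (sqn (ft f \<omega>) * fiber_sum L \<Delta> h \<omega>)
            = sqn (ft f \<omega>) * (ennreal ((b - a) / p) * fiber_sum L \<Delta> h \<omega>)"
          by (rule mult.left_commute)
        then show ?case by (simp only: elim mult_1_right)
      qed
    qed
    also have "\<dots> = (\<integral>\<^sup>+t. sqn (f t) \<partial>lborel)"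
      by (rule plancherel(1)[OF f'])
    also have "\<dots> = ennreal (energy f)" by (rule nn_integral_energy[OF f])
    finally show ?thesis .
  qed
  have quasi: "\<exists>\<rho>>0. \<forall>x y. norm y < \<rho> \<longrightarrow>
      (shifted_sum (model_set \<Gamma> {a..b}) ?W (x + y))
        \<le> ennreal (1 + \<alpha>) * (shifted_sum (model_set \<Gamma> {a..b}) ?W x) + ennreal \<eta>"
    if \<alpha>: "\<alpha> > 0" and \<eta>: "\<eta> > 0" for \<alpha> \<eta>
  proof -
    define c where "c = 1 + 1 / \<alpha>"
    have c: "c > 0" using \<alpha> by (simp add: c_def add_pos_pos)
    obtain \<rho> where \<rho>: "\<rho> > 0" "\<And>y. norm y < \<rho> \<Longrightarrow> energy (\<lambda>t. translation y f t - f t) < \<eta> / c"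
      using energy_translation_diff_small[OF f, of "\<eta> / c"] \<eta> c by auto
    have "frame_sum ?I (gabor g) (translation (x + y) f)
        \<le> ennreal (1 + \<alpha>) * frame_sum ?I (gabor g) (translation x f) + ennreal \<eta>"
      if y: "norm y < \<rho>" for x y
    proof -
      let ?d = "\<lambda>t. translation y f t - f t"
      have d: "test_fun ?d" by (rule test_fun_diff[OF test_fun_translation[OF f] f])
      have split: "translation (x + y) f = (\<lambda>t. translation x f t + translation x ?d t)"
        by (rule ext) (simp add: translation_def algebra_simps)
      have "frame_sum ?I (gabor g) (translation (x + y) f)
          \<le> ennreal (1 + \<alpha>) * frame_sum ?I (gabor g) (translation x f)
            + ennreal (1 + 1 / \<alpha>) * frame_sum ?I (gabor g) (translation x ?d)"
        unfolding split
        by (rule frame_sum_add_le[OF I eL test_fun_in_Lp(1)[OF test_fun_translation[OF f]] test_fun_in_Lp(1)[OF test_fun_translation[OF d]] \<alpha>])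
      also have "\<dots> \<le> ennreal (1 + \<alpha>) * frame_sum ?I (gabor g) (translation x f) + ennreal \<eta>"
      proof (rule add_left_mono)
        have "frame_sum ?I (gabor g) (translation x ?d) \<le> ennreal (energy ?d)"
          using B'[OF test_fun_translation[OF d, of x]] by (simp only: energy_translation[OF d])
        also have "\<dots> \<le> ennreal (\<eta> / c)" using \<rho>(2)[OF y] by (intro ennreal_leI) simp
        finally have "ennreal c * frame_sum ?I (gabor g) (translation x ?d) \<le> ennreal c * ennreal (\<eta> / c)"
          by (rule mult_left_mono) simp
        also have "\<dots> = ennreal \<eta>" using c \<eta> by (simp add: ennreal_mult[symmetric])
        finally show "ennreal (1 + 1 / \<alpha>) * frame_sum ?I (gabor g) (translation x ?d) \<le> ennreal \<eta>"
          by (simp only: c_def)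
      qed
      finally show ?thesis .
    qed
    with \<rho>(1) show ?thesis unfolding shift by blast
  qed
  have "(shifted_sum (model_set \<Gamma> {a..b}) ?W 0) = ennreal (energy f)"
  proof (rule model_sum_attains_mean[OF cp ab p window_energy_borel[OF test_fun_borel[OF f] hb \<Delta>] energy_nonneg _ mean quasi])
    fix x
    show "(shifted_sum (model_set \<Gamma> {a..b}) ?W x) \<le> ennreal (energy f)"
      using B'[OF test_fun_translation[OF f, of x]] by (simp only: energy_translation[OF f] shift)
  qed
  then show ?thesis
    using frame_sum_gabor[where L = L and h = h and g = g, OF test_fun_borel[OF f] hb ae \<Lambda> \<Delta>] by simp
qed

theorem corollary5p2:
  fixes \<Gamma> :: "((real ^ 'm) \<times> real) set"
    and \<Omega> :: "real set"
    and \<Delta> :: "(real ^ 'm) set"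
    and g :: "nat \<Rightarrow> real ^ 'm \<Rightarrow> complex"
    and L :: nat
  assumes "cut_and_project \<Gamma>"
    and "is_interval \<Omega>" and "compact \<Omega>" and "interior \<Omega> \<noteq> {}"
    and "generic_window \<Gamma> \<Omega>"
    and "generic_window (dual_lattice \<Gamma>) \<Omega>"
    and "uminus ` \<Omega> = \<Omega>"
    and "relatively_dense \<Delta>" and "uniform_discrete \<Delta>"
    and "\<And>l. l \<in> {1..L} \<Longrightarrow> in_wiener 2 1 (g l)"
  shows "is_normalized_tight_frame (gabor_index L (model_set \<Gamma> \<Omega>) \<Delta>) (gabor g) \<longleftrightarrow>
           is_Bessel_seq 1 (gabor_index L (model_set \<Gamma> \<Omega>) \<Delta>) (gabor g) \<and>
           (AE t in lebesgue.
              ennreal (point_density (model_set \<Gamma> \<Omega>)) *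
              (\<Sum>l=1..L. \<Sum>\<^sub>\<infinity>\<beta>\<in>\<Delta>. ennreal ((cmod (fourier (g l) (t - \<beta>)))\<^sup>2)) = 1)"
proof -
  have "connected \<Omega>" using assms(2) by (simp add: is_interval_connected_1)
  then obtain a b where \<Omega>: "\<Omega> = {a..b}"
    using assms(3) connected_compact_interval_1 by blast
  have ab: "a < b" using assms(4) by (simp add: \<Omega> interior_atLeastAtMost_real)
  let ?\<Lambda> = "model_set \<Gamma> {a..b}"
  let ?I = "gabor_index L ?\<Lambda> \<Delta>"
  have lat: "is_lattice \<Gamma>" using assms(1) by (simp add: cut_and_project_def)
  have \<Lambda>: "countable ?\<Lambda>" by (intro countable_model_set countable_lattice lat)
  have \<Delta>: "countable \<Delta>" using assms(9) by (rule uniform_discrete_imp_countable)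
  have I: "countable ?I"
    unfolding gabor_index_def using \<Lambda> \<Delta> by (auto intro: countable_finite)
  obtain p :: real where p: "p > 0" "\<And>a b. a < b \<Longrightarrow> has_uniform_density (model_set \<Gamma> {a..b}) ((b - a) / p)"
    by (rule model_set_uniform_density[OF assms(1)]) (rule that, assumption+)
  define D where "D = (b - a) / p"
  have D: "D > 0" "has_uniform_density ?\<Lambda> D"
    using p ab by (auto simp: D_def)
  have pd: "point_density ?\<Lambda> = D"
    using D by (intro point_density_eqI) auto
  have "\<exists>h. h \<in> borel_measurable borel \<and> (AE t in lebesgue. g l t = h t)" if "l \<in> {1..L}" for l
  proof -
    have "g l \<in> borel_measurable lebesgue" using assms(10)[OF that] by (simp add: in_wiener_def)
    from ex_borel_representative[OF this] show ?thesis by blast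
  qed
  then obtain h where hb: "\<And>l. l \<in> {1..L} \<Longrightarrow> h l \<in> borel_measurable borel"
    and ae: "\<And>l. l \<in> {1..L} \<Longrightarrow> AE t in lebesgue. g l t = h l t"
    by metis
  have h: "integrable lborel (h l)" if l: "l \<in> {1..L}" for l
  proof -
    have gi: "integrable lebesgue (g l)" by (rule in_wiener_imp_integrable[OF assms(10)[OF l]])
    have m: "h l \<in> borel_measurable lborel" using hb[OF l] by simp
    have "integrable lebesgue (h l)"
      by (rule integrable_cong_AE[THEN iffD1, OF borel_measurable_integrable[OF gi] measurable_completion[OF m] ae[OF l] gi])
    then show ?thesis using integrable_completion[OF m] by simp
  qed
  have four: "fourier (g l) = ft (h l)" if l: "l \<in> {1..L}" for l
  proof -
    have gm: "g l \<in> borel_measurable lebesgue" using assms(10)[OF l] by (simp add: in_wiener_def)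
    have hm: "h l \<in> borel_measurable lebesgue" using hb[OF l] by (intro measurable_completion) simp
    have cm: "(\<lambda>t. cis (- 2 * pi * (t \<bullet> \<omega>))) \<in> borel_measurable lebesgue" for \<omega> :: "real ^ 'm"
      by (rule measurable_completion) measurable
    have "fourier (g l) \<omega> = fourier (h l) \<omega>" for \<omega>
      unfolding fourier_def
    proof (rule integral_cong_AE)
      show "AE t in lebesgue. g l t * cis (- 2 * pi * (t \<bullet> \<omega>)) = h l t * cis (- 2 * pi * (t \<bullet> \<omega>))"
        using ae[OF l] by eventually_elim simp
    qed (intro borel_measurable_times gm hm cm)+
    then show ?thesis using fourier_eq_ft[OF hb[OF l]] by auto
  qed
  have "(\<Sum>l=1..L. \<Sum>\<^sub>\<infinity>\<beta>\<in>\<Delta>. sqn (fourier (g l) (t - \<beta>))) = fiber_sum L \<Delta> h t" for t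
    unfolding fiber_sum_def
    by (intro sum.cong refl) (simp add: infsum_ennreal_eq_nn_integral[OF \<Delta>] four)
  then have cond: "(AE t in lebesgue. ennreal (point_density ?\<Lambda>) *
      (\<Sum>l=1..L. \<Sum>\<^sub>\<infinity>\<beta>\<in>\<Delta>. sqn (fourier (g l) (t - \<beta>))) = 1)
      \<longleftrightarrow> (AE t in lborel. ennreal D * fiber_sum L \<Delta> h t = 1)"
    by (simp only: AE_completion_iff pd)
  show ?thesis
    unfolding \<Omega> cond
  proof (intro iffI conjI)
    assume tight: "is_normalized_tight_frame ?I (gabor g)"
    then show "is_Bessel_seq 1 ?I (gabor g)"
      by (simp add: is_normalized_tight_frame_def is_Bessel_seq_def)
    show "AE t in lborel. ennreal D * fiber_sum L \<Delta> h t = 1"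
    proof (rule fiber_sum_eq_1_of_constant_model_sum[OF \<Lambda> D(2,1) \<Delta> h])
      fix f :: "real ^ 'm \<Rightarrow> complex" and x
      assume f: "test_fun f"
      note fx = test_fun_translation[OF f, of x]
      have "(shifted_sum ?\<Lambda> (window_energy L \<Delta> h f) x) = frame_sum ?I (gabor g) (translation x f)"
        by (rule frame_sum_gabor_translation[OF f hb ae \<Lambda> \<Delta>, symmetric])
      also have "\<dots> = ennreal ((Lp_norm 2 (translation x f))\<^sup>2)"
        using tight test_fun_in_Lp(1)[OF fx] by (simp add: is_normalized_tight_frame_def frame_sum_def)
      also have "\<dots> = ennreal (energy f)"
        by (simp only: test_fun_in_Lp(2)[OF fx] energy_translation[OF f])
      finally show "(shifted_sum ?\<Lambda> (window_energy L \<Delta> h f) x) = ennreal (energy f)" .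
    qed
  next
    assume *: "is_Bessel_seq 1 ?I (gabor g) \<and> (AE t in lborel. ennreal D * fiber_sum L \<Delta> h t = 1)"
    have "frame_sum ?I (gabor g) f = ennreal ((Lp_norm 2 f)\<^sup>2)" if f: "in_Lp 2 f" for f
    proof (rule tight_of_tight_on_test_fun[OF I _ _ f])
      show "is_Bessel_seq 1 ?I (gabor g)" using * ..
      show "frame_sum ?I (gabor g) \<phi> = ennreal (energy \<phi>)" if "test_fun \<phi>" for \<phi>
        by (rule tight_on_test_fun_of_fiber_sum[OF assms(1) ab p \<Delta> h ae]) (use * that in \<open>auto simp: D_def\<close>)
    qed
    then show "is_normalized_tight_frame ?I (gabor g)"
      using * by (auto simp: is_normalized_tight_frame_def is_Bessel_seq_def frame_sum_def)
  qed
qed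

end
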